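(* Let $\Phi:D\to\mathbb{R}^d$ be a $(d+p+1)$-admissible warping function with control weight $v_0$, where $p=0$ if $R_\Phi:=\sup_{\xi\in D}\|\mathrm{D}\Phi(\xi)\|=\infty$ and $p\in\mathbb{N}_0$ otherwise. Let $m:\Lambda\times\Lambda\to(0,\infty)$ be a symmetric weight satisfying $$m\bigl((y,\xi),(z,\eta)\bigr)\le(1+|y-z|)^p\cdot v_1\bigl(\Phi(\xi)-\Phi(\eta)\bigr)\qquad\text{for all }y,z\in\mathbb{R}^d,\ \xi,\eta\in D,$$ for some continuous and submultiplicative weight $v_1:\mathbb{R}^d\to(0,\infty)$ satisfying $v_1(\upsilon)=v_1(-\upsilon)$ for all $\upsilon\in\mathbb{R}^d$. With $$w_2:\mathbb{R}^d\to(0,\infty),\quad \upsilon\mapsto(1+|\upsilon|)^{d+1}\cdot v_1(\upsilon)\cdot[v_0(\upsilon)]^{9d/2+3p+3},$$ assume that $\theta_1,\theta_2\in C^{d+p+1}(\mathbb{R}^d)$ and $$\frac{\partial^n}{\partial\upsilon_j^n}\theta_\ell\in L^2_{w_2}(\mathbb{R}^d)\qquad\text{for all }j\in\{1,\dots,d\},\ \ell\in\{1,2\},\ 0\le n\le d+p+1,$$ and let $$C_{\max}:=\prod_{\ell\in\{1,2\}}\Bigl(\max_{1\le j\le d}\ \max_{0\le n\le d+p+1}\Bigl\|\frac{\partial^n}{\partial\upsilon_j^n}\theta_\ell\Bigr\|_{L^2_{w_2}(\mathbb{R}^d)}\Bigr).$$ Then $m$ is $\Phi$-compatible with dominating weight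 $m^\Phi(x,\tau)=(1+|x|)^p\cdot v_1(\tau)$, and there is a constant $C>0$, independent of $\theta_1,\theta_2$ and $m$, satisfying $$\|K_{\theta_1,\theta_2}\|_{\mathcal{B}_m}\le C\cdot C_{\max}<\infty.$$
   Context: Notation. $|\cdot|$ is the Euclidean norm, $\|\cdot\|$ for matrices is the induced operator norm, $(T_xf)(y)=f(y-x)$, $\widehat f(\xi)=\int f(x)e^{-2\pi i\langle x,\xi\rangle}dx$ with inverse $\mathcal{F}^{-1}$; $B^{-T}$ is the inverse transpose. A weight is a measurable function with values in $(0,\infty)$. $L^p_v(\mathbb{R}^d)$ has norm $\|f\|_{L^p_v}=\|v f\|_{L^p}$. A weight $v$ on $\mathbb{R}^d$ is submultiplicative if $v(\sigma+\tau)\le v(\sigma)v(\tau)$ for all $\sigma,\tau$, and radially increasing if $v(\sigma)\le v(\tau)$ whenever $|\sigma|\le|\tau|$. A weight $m$ on $\Lambda\times\Lambda$ is symmetric if $m(\lambda,\rho)=m(\rho,\lambda)$. $D\subset\mathbb{R}^d$ is non-empty and open and $\Lambda=\mathbb{R}^d\times D$ with Lebesgue measure. $k$-admissible warping functions ($k\in\mathbb{N}_0$). A map $\Phi:D\to\mathbb{R}^d$ is a $k$-admissible warping function with control weight $v_0:\mathbb{R}^d\to(0,\infty)$ if $v_0$ is continuous, submultiplicative and radially increasing, $\Phi$ is a $C^{k+1}$-diffeomorphism (onto $\mathbb{R}^d$), $A:=\mathrm{D}\Phi^{-1}$ has positive determinant everywhere, and with $\phi_\tau(\upsilon):=A^T(\upsilon+\tau)A^{-T}(\tau)$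 one has $\|\partial^\alpha\phi_\tau(\upsilon)\|\le v_0(\upsilon)$ for all $\tau,\upsilon\in\mathbb{R}^d$ and all multiindices $\alpha\in\mathbb{N}_0^d$ with $|\alpha|\le k$ (derivatives in $\upsilon$). Warped time-frequency system. Let $w(\tau)=\det A(\tau)$. For a prototype $\theta:\mathbb{R}^d\to\mathbb{C}$ in $L^2_{\sqrt w}(\mathbb{R}^d)$, $(y,\omega)\in\Lambda$, put $g_\omega:=w(\Phi(\omega))^{-1/2}\,(T_{\Phi(\omega)}\theta)\circ\Phi$, extended by zero from $D$ to $\mathbb{R}^d$, and $g_{y,\omega}:=T_y\mathcal{F}^{-1}g_\omega$; $\mathcal{G}(\theta,\Phi)=(g_{y,\omega})_{(y,\omega)\in\Lambda}$. For prototypes $\theta_1,\theta_2$, denote the systems by $(g^{[1]}_{y,\omega})$, $(g^{[2]}_{y,\omega})$ and define the mixed kernel $K_{\theta_1,\theta_2}((y,\omega),(z,\eta)):=\langle g^{[2]}_{z,\eta},g^{[1]}_{y,\omega}\rangle_{L^2}$. Kernel norms. For measurable $L:X\times X\to\mathbb{C}$ on a $\sigma$-finite measure space, $\|L\|_{\mathcal{A}_1(X)}=\max\{\operatorname{ess\,sup}_x\int|L(x,y)|dy,\ \operatorname{ess\,sup}_y\int|L(x,y)|dx\}$. For $K:\Lambda\times\Lambda\to\mathbb{C}$ measurable and $m$ symmetric, $\|K\|_{\mathcal{B}_m}:=\bigl\|(\omega,\eta)\mapsto\|(y,z)\mapsto (mK)((y,\omega),(z,\eta))\|_{\mathcal{A}_1(\mathbb{R}^d)}\bigr\|_{\mathcal{A}_1(D)}$.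 $\Phi$-compatibility. $m$ is $\Phi$-compatible with dominating weight $m^\Phi$ if $m^\Phi:\mathbb{R}^d\times\mathbb{R}^d\to(0,\infty)$ is continuous, $m((x,\Phi^{-1}(\sigma)),(y,\Phi^{-1}(\tau)))\le m^\Phi(x-y,\sigma-\tau)$ for all $x,y,\sigma,\tau\in\mathbb{R}^d$, and either $R_\Phi<\infty$ or there is a constant $c$ with $m^\Phi(x,\sigma)\le c\,m^\Phi(0,\sigma)$ for all $x,\sigma\in\mathbb{R}^d$. *)

theory Defs
  imports "HOL-Analysis.Analysis" "HOL-Probability.Essential_Supremum"
begin

text \<open>
  The space of dimension \<open>d\<close> is \<open>real^'n\<close> with \<open>d = CARD('n)\<close>. The index type is taken in
  the sort \<open>{finite, wellorder}\<close>, as in the change-of-variables part of HOL-Analysis: the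
  coordinates are totally ordered, like \<open>1, \<dots>, d\<close>. Every \<open>d \<ge> 1\<close> occurs (numeral types).
\<close>

subsection \<open>Partial derivatives and smoothness classes\<close>

definition partial_deriv ::
  "'n \<Rightarrow> (real^'n::finite \<Rightarrow> 'b::real_normed_vector) \<Rightarrow> real^'n \<Rightarrow> 'b" where
  "partial_deriv i f x = vector_derivative (\<lambda>t. f (x + t *\<^sub>R axis i 1)) (at 0)"

text \<open>
  The partial derivative for a multiindex; the coordinates are processed in their order, which
  is immaterial for functions that are \<open>|\<alpha>|\<close> times continuously differentiable.
\<close>
definition multi_deriv ::
  "('n::{finite,wellorder} \<Rightarrow> nat) \<Rightarrow> (real^'n::_ \<Rightarrow> 'b::real_normed_vector) \<Rightarrow> real^'n::_ \<Rightarrow> 'b" where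
  "multi_deriv \<alpha> f = foldr (\<lambda>i. partial_deriv i ^^ \<alpha> i) (sorted_list_of_set UNIV) f"

text \<open>\<open>C^k\<close> on a set \<open>S\<close>, intended for open \<open>S\<close>.\<close>
primrec C_k_on ::
  "nat \<Rightarrow> (real^'n::finite \<Rightarrow> 'b::real_normed_vector) \<Rightarrow> (real^'n) set \<Rightarrow> bool" where
  "C_k_on 0 f S \<longleftrightarrow> continuous_on S f"
| "C_k_on (Suc k) f S \<longleftrightarrow>
     (\<forall>x\<in>S. f differentiable (at x)) \<and> (\<forall>i. C_k_on k (partial_deriv i f) S)"

definition C_k_diffeo_onto_space ::
  "nat \<Rightarrow> (real^'n::finite \<Rightarrow> real^'n) \<Rightarrow> (real^'n) set \<Rightarrow> bool" where
  "C_k_diffeo_onto_space k \<Phi> D \<longleftrightarrow>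
     bij_betw \<Phi> D UNIV \<and> C_k_on k \<Phi> D \<and> C_k_on k (inv_into D \<Phi>) UNIV"

subsection \<open>Warping functions\<close>

definition matrix_opnorm :: "real^'n^'m \<Rightarrow> real" where
  "matrix_opnorm M = onorm (\<lambda>x. M *v x)"

definition submultiplicative :: "(real^'n::finite \<Rightarrow> real) \<Rightarrow> bool" where
  "submultiplicative v \<longleftrightarrow> (\<forall>\<sigma> \<tau>. v (\<sigma> + \<tau>) \<le> v \<sigma> * v \<tau>)"

definition radially_increasing :: "(real^'n::finite \<Rightarrow> real) \<Rightarrow> bool" where
  "radially_increasing v \<longleftrightarrow> (\<forall>\<sigma> \<tau>. norm \<sigma> \<le> norm \<tau> \<longrightarrow> v \<sigma> \<le> v \<tau>)"

definition warp_jac ::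
  "(real^'n::finite) set \<Rightarrow> (real^'n \<Rightarrow> real^'n) \<Rightarrow> real^'n \<Rightarrow> real^'n^'n" where
  "warp_jac D \<Phi> \<tau> = jacobian (inv_into D \<Phi>) (at \<tau>)"

definition warp_weight ::
  "(real^'n::finite) set \<Rightarrow> (real^'n \<Rightarrow> real^'n) \<Rightarrow> real^'n \<Rightarrow> real" where
  "warp_weight D \<Phi> \<tau> = det (warp_jac D \<Phi> \<tau>)"

definition warp_phi ::
  "(real^'n::finite) set \<Rightarrow> (real^'n \<Rightarrow> real^'n) \<Rightarrow> real^'n \<Rightarrow> real^'n \<Rightarrow> real^'n^'n" where
  "warp_phi D \<Phi> \<tau> \<upsilon> =
     transpose (warp_jac D \<Phi> (\<upsilon> + \<tau>)) ** transpose (matrix_inv (warp_jac D \<Phi> \<tau>))"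

definition admissible_warping ::
  "nat \<Rightarrow> (real^'n::{finite,wellorder}) set \<Rightarrow> (real^'n::_ \<Rightarrow> real^'n::_) \<Rightarrow> (real^'n::_ \<Rightarrow> real) \<Rightarrow> bool" where
  "admissible_warping k D \<Phi> v0 \<longleftrightarrow>
     (\<forall>\<upsilon>. 0 < v0 \<upsilon>) \<and> continuous_on UNIV v0 \<and> submultiplicative v0 \<and> radially_increasing v0 \<and>
     C_k_diffeo_onto_space (k + 1) \<Phi> D \<and>
     (\<forall>\<tau>. 0 < det (warp_jac D \<Phi> \<tau>)) \<and>
     (\<forall>\<tau> \<upsilon>. \<forall>\<alpha>. sum \<alpha> UNIV \<le> k \<longrightarrow>
        matrix_opnorm (multi_deriv \<alpha> (warp_phi D \<Phi> \<tau>) \<upsilon>) \<le> v0 \<upsilon>)"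

definition R_warp :: "(real^'n::finite) set \<Rightarrow> (real^'n \<Rightarrow> real^'n) \<Rightarrow> ennreal" where
  "R_warp D \<Phi> = (SUP \<xi>\<in>D. ennreal (matrix_opnorm (jacobian \<Phi> (at \<xi>))))"

subsection \<open>Weighted square-integrable functions and the inverse Fourier transform\<close>

definition L2w_norm ::
  "(real^'n::finite \<Rightarrow> real) \<Rightarrow> (real^'n \<Rightarrow> complex) \<Rightarrow> ennreal" where
  "L2w_norm v f =
     (let I = \<integral>\<^sup>+ x. (ennreal (norm (v x *\<^sub>R f x)))\<^sup>2 \<partial>lebesgue
      in if I = \<infinity> then \<infinity> else ennreal (sqrt (enn2real I)))"

definition L2w :: "(real^'n::finite \<Rightarrow> real) \<Rightarrow> (real^'n \<Rightarrow> complex) set" where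
  "L2w v = {f. f \<in> borel_measurable lebesgue \<and> L2w_norm v f < \<infinity>}"

definition inv_fourier_integral ::
  "(real^'n::finite \<Rightarrow> complex) \<Rightarrow> real^'n \<Rightarrow> complex" where
  "inv_fourier_integral f x = (LINT \<xi>|lebesgue. f \<xi> * cis (2 * pi * (x \<bullet> \<xi>)))"

text \<open>
  A representative of the inverse Fourier(-Plancherel) transform of a square-integrable \<open>f\<close>: the
  limit in \<open>L^2\<close>, as \<open>R\<close> tends to infinity, of the integrals over the balls of radius \<open>R\<close>. It
  is determined up to null sets, so the inner products below do not depend on the choice.
\<close>
definition inv_fourier ::
  "(real^'n::finite \<Rightarrow> complex) \<Rightarrow> real^'n \<Rightarrow> complex" where
  "inv_fourier f =
     (SOME g. g \<in> L2w (\<lambda>_. 1) \<and>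
        ((\<lambda>R. L2w_norm (\<lambda>_. 1)
           (\<lambda>x. inv_fourier_integral (\<lambda>\<xi>. indicator (ball 0 R) \<xi> * f \<xi>) x - g x))
         \<longlongrightarrow> 0) at_top)"

definition L2_inner :: "(real^'n::finite \<Rightarrow> complex) \<Rightarrow> (real^'n \<Rightarrow> complex) \<Rightarrow> complex" where
  "L2_inner f g = (LINT x|lebesgue. f x * cnj (g x))"

subsection \<open>Warped time-frequency systems\<close>

definition translate ::
  "real^'n::finite \<Rightarrow> (real^'n \<Rightarrow> complex) \<Rightarrow> real^'n \<Rightarrow> complex" where
  "translate x f y = f (y - x)"

definition warped_freq ::
  "(real^'n::finite) set \<Rightarrow> (real^'n \<Rightarrow> real^'n) \<Rightarrow> (real^'n \<Rightarrow> complex)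
    \<Rightarrow> real^'n \<Rightarrow> real^'n \<Rightarrow> complex" where
  "warped_freq D \<Phi> \<theta> \<omega> \<xi> =
     (if \<xi> \<in> D
      then of_real (warp_weight D \<Phi> (\<Phi> \<omega>) powr (- 1 / 2)) * translate (\<Phi> \<omega>) \<theta> (\<Phi> \<xi>)
      else 0)"

definition warped_system ::
  "(real^'n::finite) set \<Rightarrow> (real^'n \<Rightarrow> real^'n) \<Rightarrow> (real^'n \<Rightarrow> complex)
    \<Rightarrow> (real^'n) \<times> (real^'n) \<Rightarrow> real^'n \<Rightarrow> complex" where
  "warped_system D \<Phi> \<theta> = (\<lambda>(y, \<omega>). translate y (inv_fourier (warped_freq D \<Phi> \<theta> \<omega>)))"

definition mixed_kernel ::
  "(real^'n::finite) set \<Rightarrow> (real^'n \<Rightarrow> real^'n) \<Rightarrow> (real^'n \<Rightarrow> complex) \<Rightarrow> (real^'n \<Rightarrow> complex)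
    \<Rightarrow> ((real^'n) \<times> (real^'n)) \<times> ((real^'n) \<times> (real^'n)) \<Rightarrow> complex" where
  "mixed_kernel D \<Phi> \<theta>1 \<theta>2 =
     (\<lambda>(l, r). L2_inner (warped_system D \<Phi> \<theta>2 r) (warped_system D \<Phi> \<theta>1 l))"

subsection \<open>Kernel norms\<close>

text \<open>
  The first norm is a functional of the modulus of the kernel, given here as a function with
  values in \<open>[0, \<infinity>]\<close>: in the second norm it is applied to inner norms, which may be infinite.
\<close>
definition A1_norm :: "'a measure \<Rightarrow> ('a \<Rightarrow> 'a \<Rightarrow> ennreal) \<Rightarrow> ennreal" where
  "A1_norm M L = max (esssup M (\<lambda>x. \<integral>\<^sup>+ y. L x y \<partial>M)) (esssup M (\<lambda>y. \<integral>\<^sup>+ x. L x y \<partial>M))"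

definition B_norm ::
  "(real^'n::finite) set \<Rightarrow> (((real^'n) \<times> (real^'n)) \<times> ((real^'n) \<times> (real^'n)) \<Rightarrow> real)
    \<Rightarrow> (((real^'n) \<times> (real^'n)) \<times> ((real^'n) \<times> (real^'n)) \<Rightarrow> complex) \<Rightarrow> ennreal" where
  "B_norm D m K =
     A1_norm (lebesgue_on D) (\<lambda>\<omega> \<eta>.
       A1_norm lebesgue (\<lambda>y z. ennreal (norm (m ((y, \<omega>), (z, \<eta>)) *\<^sub>R K ((y, \<omega>), (z, \<eta>))))))"

subsection \<open>Weights on the phase space\<close>

definition symmetric_weight ::
  "(real^'n::finite) set \<Rightarrow> (((real^'n) \<times> (real^'n)) \<times> ((real^'n) \<times> (real^'n)) \<Rightarrow> real) \<Rightarrow> bool" where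
  "symmetric_weight D m \<longleftrightarrow>
     (let \<Lambda> = UNIV \<times> D in
       m \<in> borel_measurable (lebesgue_on (\<Lambda> \<times> \<Lambda>)) \<and>
       (\<forall>l\<in>\<Lambda>. \<forall>r\<in>\<Lambda>. 0 < m (l, r) \<and> m (l, r) = m (r, l)))"

definition warp_compatible ::
  "(real^'n::finite) set \<Rightarrow> (real^'n \<Rightarrow> real^'n)
    \<Rightarrow> (((real^'n) \<times> (real^'n)) \<times> ((real^'n) \<times> (real^'n)) \<Rightarrow> real)
    \<Rightarrow> ((real^'n) \<times> (real^'n) \<Rightarrow> real) \<Rightarrow> bool" where
  "warp_compatible D \<Phi> m M \<longleftrightarrow>
     (\<forall>z. 0 < M z) \<and> continuous_on UNIV M \<and>
     (\<forall>x y \<sigma> \<tau>. m ((x, inv_into D \<Phi> \<sigma>), (y, inv_into D \<Phi> \<tau>)) \<le> M (x - y, \<sigma> - \<tau>)) \<and>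
     (R_warp D \<Phi> < \<infinity> \<or> (\<exists>c. \<forall>x \<sigma>. M (x, \<sigma>) \<le> c * M (0, \<sigma>)))"

subsection \<open>The prototype weight and the prototype constants\<close>

definition w2_weight ::
  "nat \<Rightarrow> (real^'n::finite \<Rightarrow> real) \<Rightarrow> (real^'n \<Rightarrow> real) \<Rightarrow> real^'n \<Rightarrow> real" where
  "w2_weight p v0 v1 \<upsilon> =
     (1 + norm \<upsilon>) ^ (CARD('n) + 1) * v1 \<upsilon>
       * v0 \<upsilon> powr (9 * real CARD('n) / 2 + 3 * real p + 3)"

definition max_deriv_norm ::
  "nat \<Rightarrow> (real^'n::finite \<Rightarrow> real) \<Rightarrow> (real^'n \<Rightarrow> complex) \<Rightarrow> ennreal" where
  "max_deriv_norm N v \<theta> = (MAX j\<in>UNIV. MAX n\<in>{0..N}. L2w_norm v ((partial_deriv j ^^ n) \<theta>))"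

end

theory Submission
  imports Defs "HOL-Probability.Probability"
begin

text \<open>
  By Parseval's identity the kernel at \<open>((y, \<omega>), (z, \<eta>))\<close> is the integral over \<open>D\<close> of the product of the two
  frequency-side prototypes against \<open>cis (2 * pi * ((y - z) \<bullet> \<xi>))\<close>. Substituting \<open>\<xi> = \<Psi> (t + \<sigma>)\<close> with
  \<open>\<Psi> = \<Phi>\<^sup>-\<^sup>1\<close>, \<open>\<sigma> = \<Phi> \<omega>\<close>, \<open>h = \<Phi> \<eta> - \<Phi> \<omega>\<close> and \<open>x = A(\<sigma>)\<^sup>T (y - z)\<close> turns it into an oscillatory integral with
  amplitude \<open>det (\<phi> \<sigma> t) * \<theta>2 (t - h) * cnj (\<theta>1 t)\<close>, whose phase has the gradient \<open>\<phi> \<sigma> t *v x\<close>, of norm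
  between \<open>norm x / v0 t\<close> and \<open>v0 t * norm x\<close>. Each of \<open>N = d + p + 1\<close> integrations by parts gains a
  factor \<open>1 / norm x\<close> and costs \<open>v0 t ^ 3\<close>; the determinant costs \<open>v0 t ^ d\<close>. The resulting decay
  \<open>(1 + norm x) ^ -N\<close> absorbs the weight \<open>(1 + norm (y - z)) ^ p\<close> and leaves an integrable function of \<open>x\<close>.
  The remaining integral over \<open>h\<close>, with the factor \<open>(w \<rho> / w \<sigma>) powr (1 / 2) = O(v0 h powr (d / 2))\<close>, is a convolution
  that separates because \<open>v0\<close> and \<open>v1\<close> are submultiplicative and even. The exponents add up to
  \<open>d / 2 + d + 3 * N = 9 * d / 2 + 3 * p + 3\<close>, and Cauchy--Schwarz against \<open>(1 + norm t) ^ -(d + 1)\<close> bounds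
  the two factors by the weighted \<open>L\<^sup>2\<close> norms.
\<close>

subsection \<open>Symbol classes and integration by parts\<close>

text \<open>Only pure derivatives of the prototypes in one coordinate direction are controlled.
  Integration by parts along the full phase gradient would produce mixed derivatives, so the phase
  is treated one direction at a time, and a direction is usable only where its gradient component is
  comparable to the whole gradient. Of the cost \<open>v0 t ^ 3\<close> of one step,
  \<open>v0 t ^ 2\<close> is the price of a derivative relative to the gradient length
  \<open>r\<close>: derivatives of the gradient are at most \<open>v0 t * norm x\<close>, and
  \<open>norm x \<le> v0 t * r\<close>. The third factor comes from
  \<open>1 / r \<le> v0 t / norm x\<close>. The constant must not depend on the prototypes, so the
  symbol estimates run over a family whose parameter contains the prototypes themselves. On the
  Fourier side, \<open>D\<close> may have a boundary of positive measure and
  \<open>inv_fourier\<close> is a chosen \<open>L\<^sup>2\<close> limit. Plancherel's identity is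
  therefore obtained by Gaussian damping for functions continuous on \<open>D\<close> and zero
  elsewhere, and the chosen limit is identified almost everywhere with an absolutely convergent
  integral.\<close>

lemma lborel_integral_translate:
  fixes f :: "'a::euclidean_space \<Rightarrow> 'b::{banach,second_countable_topology}"
  assumes "f \<in> borel_measurable borel"
  shows "(LINT x|lborel. f (x + a)) = (LINT x|lborel. f x)"
proof -
  have "(LINT x|lborel. f x) = (LINT x|distr lborel borel ((+) a). f x)"
    by (simp add: lborel_distr_plus)
  also have "\<dots> = (LINT x|lborel. f (a + x))"
    using assms by (subst integral_distr) auto
  finally show ?thesis by (simp add: add.commute)
qed

lemma lborel_integrable_translate:
  fixes f :: "'a::euclidean_space \<Rightarrow> 'b::{banach,second_countable_topology}"
  assumes "integrable lborel f"
  shows "integrable lborel (\<lambda>x. f (x + a))"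
proof -
  have "integrable (distr lborel borel ((+) a)) f"
    using assms by (simp add: lborel_distr_plus)
  then have "integrable lborel (\<lambda>x. f (a + x))"
    using assms by (subst (asm) integrable_distr_eq) auto
  then show ?thesis by (simp add: add.commute)
qed

lemma lborel_nn_integral_translate:
  fixes f :: "'a::euclidean_space \<Rightarrow> ennreal"
  assumes "f \<in> borel_measurable borel"
  shows "(\<integral>\<^sup>+x. f (x + a) \<partial>lborel) = (\<integral>\<^sup>+x. f x \<partial>lborel)"
proof -
  have "(\<integral>\<^sup>+x. f x \<partial>lborel) = (\<integral>\<^sup>+x. f x \<partial>distr lborel borel ((+) a))"
    by (simp add: lborel_distr_plus)
  also have "\<dots> = (\<integral>\<^sup>+x. f (a + x) \<partial>lborel)"
    using assms by (subst nn_integral_distr) auto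
  finally show ?thesis by (simp add: add.commute)
qed

text \<open>A relation, so that a derivative can be supplied as an explicit formula. It asks for
  differentiability along lines parallel to one axis, which is what one-directional integration by
  parts uses.\<close>

definition dir_deriv ::
  "'n \<Rightarrow> (real^'n::finite \<Rightarrow> 'b::real_normed_vector) \<Rightarrow> (real^'n \<Rightarrow> 'b) \<Rightarrow> bool" where
  "dir_deriv j f f' \<longleftrightarrow>
     (\<forall>x. ((\<lambda>t. f (x + t *\<^sub>R axis j 1)) has_vector_derivative f' x) (at 0))"

text \<open>The definition differentiates at parameter 0; moving the base point along the line gives
  every other parameter, as the fundamental theorem on a segment requires.\<close>

lemma dir_deriv_at:
  assumes "dir_deriv j f f'"
  shows "((\<lambda>t. f (x + t *\<^sub>R axis j 1)) has_vector_derivative f' (x + s *\<^sub>R axis j 1)) (at s within S)"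
proof -
  have "((\<lambda>t. f ((x + s *\<^sub>R axis j 1) + t *\<^sub>R axis j 1)) has_vector_derivative f' (x + s *\<^sub>R axis j 1)) (at 0)"
    using assms by (simp add: dir_deriv_def)
  then have "((\<lambda>t. f ((x + s *\<^sub>R axis j 1) + t *\<^sub>R axis j 1)) has_vector_derivative f' (x + s *\<^sub>R axis j 1)) (at (s - s))"
    by simp
  then have "((\<lambda>t. f ((x + s *\<^sub>R axis j 1) + t *\<^sub>R axis j 1)) \<circ> (\<lambda>t. t - s) has_vector_derivative
      1 *\<^sub>R f' (x + s *\<^sub>R axis j 1)) (at s)"
    by (intro vector_diff_chain_at) (auto intro!: derivative_eq_intros simp: has_vector_derivative_def)
  moreover have "(\<lambda>t. f ((x + s *\<^sub>R axis j 1) + t *\<^sub>R axis j 1)) \<circ> (\<lambda>t. t - s) = (\<lambda>t. f (x + t *\<^sub>R axis j 1))"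
    by (auto simp: fun_eq_iff algebra_simps)
  ultimately show ?thesis
    by (simp add: has_vector_derivative_at_within)
qed

text \<open>The integral of \<open>f (x + axis j 1) - f x\<close> vanishes by translation invariance.\<close>
lemma integral_dir_deriv_zero:
  fixes f f' :: "real^'n::finite \<Rightarrow> complex"
  assumes d: "dir_deriv j f f'" and f: "integrable lborel f"
    and f': "integrable lborel f'" and c': "continuous_on UNIV f'"
  shows "(LINT x|lborel. f' x) = 0"
proof -
  let ?e = "axis j 1 :: real^'n"
  \<comment> \<open>Fubini in two orders: over \<open>u\<close> first, the fundamental theorem gives
    \<open>f (x + axis j 1) - f x\<close>; over \<open>x\<close> first, translation invariance gives
    the integral of \<open>f'\<close> for each \<open>u\<close> in the unit interval.\<close>
  define F where "F = (\<lambda>(u::real, x). indicator {0..1} u *\<^sub>R f' (x + u *\<^sub>R ?e))"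
  have mf': "f' \<in> borel_measurable borel" using c' by (rule borel_measurable_continuous_onI)
  have mF: "F \<in> borel_measurable (lborel \<Otimes>\<^sub>M lborel)"
  proof -
    have "(\<lambda>z::real \<times> (real^'n). f' (snd z + fst z *\<^sub>R ?e)) \<in> borel_measurable borel"
      by (intro borel_measurable_continuous_onI continuous_on_compose2[OF c'] continuous_intros) auto
    then have "(\<lambda>z::real \<times> (real^'n). f' (snd z + fst z *\<^sub>R ?e)) \<in> borel_measurable (lborel \<Otimes>\<^sub>M lborel)"
      by (simp add: lborel_prod)
    moreover have "(\<lambda>z::real \<times> (real^'n). indicator {0..1} (fst z) :: real) \<in> borel_measurable (lborel \<Otimes>\<^sub>M lborel)"
      by measurable
    ultimately show ?thesis unfolding F_def case_prod_beta by (rule borel_measurable_scaleR[rotated])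
  qed
  have nF: "(LINT x|lborel. norm (F (u, x))) = indicator {0..1} u *\<^sub>R (LINT x|lborel. norm (f' x))" for u
    using lborel_integral_translate[of "\<lambda>x. norm (f' x)"] mf' by (simp add: F_def)
  have iF: "integrable (lborel \<Otimes>\<^sub>M lborel) F"
  proof (rule lborel_pair.Fubini_integrable[OF mF])
    show "integrable lborel (\<lambda>x. LINT y|lborel. norm (F (x, y)))"
      unfolding nF by (intro integrable_scaleR_left integrable_real_indicator) auto
    show "AE x in lborel. integrable lborel (\<lambda>y. F (x, y))"
      using lborel_integrable_translate[OF f'] by (auto simp: F_def)
  qed
  have FTC: "(LINT u|lborel. F (u, x)) = f (x + ?e) - f x" for x
  proof -
    have "((\<lambda>u. f' (x + u *\<^sub>R ?e)) has_integral f (x + 1 *\<^sub>R ?e) - f (x + 0 *\<^sub>R ?e)) {0..1}"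
      by (rule fundamental_theorem_of_calculus) (auto intro: dir_deriv_at[OF d])
    moreover have "set_integrable lborel {0..1} (\<lambda>u. f' (x + u *\<^sub>R ?e))"
      by (intro borel_integrable_atLeastAtMost' continuous_on_compose2[OF c'] continuous_intros) auto
    ultimately show ?thesis
      using set_borel_integral_eq_integral(2)[of "{0..1}" "\<lambda>u. f' (x + u *\<^sub>R ?e)"]
      by (auto simp: F_def set_lebesgue_integral_def dest: integral_unique)
  qed
  have "(LINT x|lborel. LINT u|lborel. F (u, x)) = (LINT u|lborel. LINT x|lborel. F (u, x))"
    using lborel_pair.Fubini_integral[of "\<lambda>u x. F (u, x)"] iF by simp
  moreover have "(LINT x|lborel. LINT u|lborel. F (u, x)) = 0"
    unfolding FTC using f lborel_integrable_translate[OF f] lborel_integral_translate[of f ?e]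
    by (subst Bochner_Integration.integral_diff) auto
  moreover have "(LINT x|lborel. F (u, x)) = indicator {0..1} u *\<^sub>R (LINT x|lborel. f' x)" for u
    using lborel_integral_translate[of f'] mf' by (simp add: F_def)
  ultimately show ?thesis by simp
qed

text \<open>
  \<open>symb j I \<kappa> N b f\<close>: uniformly in the parameter \<open>i \<in> I\<close>, the derivative of order
  \<open>n \<le> N\<close> of \<open>f i\<close> in direction \<open>j\<close> is \<open>O(\<kappa> i ^ n * b i)\<close>.
\<close>
fun symb :: "'n \<Rightarrow> 'i set \<Rightarrow> ('i \<Rightarrow> real^'n::finite \<Rightarrow> real) \<Rightarrow> nat \<Rightarrow> ('i \<Rightarrow> real^'n \<Rightarrow> real)
    \<Rightarrow> ('i \<Rightarrow> real^'n \<Rightarrow> complex) \<Rightarrow> bool" where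
  "symb j I \<kappa> 0 b f \<longleftrightarrow>
     (\<exists>C\<ge>0. \<forall>i\<in>I. continuous_on UNIV (f i) \<and> (\<forall>x. norm (f i x) \<le> C * b i x))"
| "symb j I \<kappa> (Suc N) b f \<longleftrightarrow> symb j I \<kappa> 0 b f \<and>
     (\<exists>f'. (\<forall>i\<in>I. dir_deriv j (f i) (f' i)) \<and> symb j I \<kappa> N (\<lambda>i x. \<kappa> i x * b i x) f')"

declare symb.simps [simp del]

lemma symb_0:
  "symb j I \<kappa> N b f \<Longrightarrow> symb j I \<kappa> 0 b f"
  by (cases N) (auto simp: symb.simps)

lemma symb_SucD:
  "symb j I \<kappa> (Suc N) b f \<Longrightarrow> symb j I \<kappa> N b f"
proof (induction N arbitrary: b f)
  case (Suc N)
  then obtain f' where "\<forall>i\<in>I. dir_deriv j (f i) (f' i)" "symb j I \<kappa> (Suc N) (\<lambda>i x. \<kappa> i x * b i x) f'"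
    unfolding symb.simps(2)[of j I \<kappa> "Suc N"] by blast
  then show ?case using Suc.IH symb_0[OF Suc.prems] symb.simps(2) by blast
qed (rule symb_0)

lemma symb_mono:
  assumes "symb j I \<kappa> N b f" "\<And>i x. i \<in> I \<Longrightarrow> 0 \<le> \<kappa> i x" "\<And>i x. i \<in> I \<Longrightarrow> b i x \<le> b' i x"
  shows "symb j I \<kappa> N b' f"
  using assms
proof (induction N arbitrary: b b' f)
  case 0
  then show ?case by (auto simp: symb.simps) (meson mult_left_mono order_trans)
next
  case (Suc N)
  obtain f' where f': "\<forall>i\<in>I. dir_deriv j (f i) (f' i)" "symb j I \<kappa> N (\<lambda>i x. \<kappa> i x * b i x) f'"
    using Suc.prems(1) by (auto simp: symb.simps)
  have "symb j I \<kappa> N (\<lambda>i x. \<kappa> i x * b' i x) f'"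
    by (rule Suc.IH[OF f'(2)]) (use Suc.prems in \<open>auto intro!: mult_left_mono\<close>)
  moreover have "symb j I \<kappa> 0 b' f"
    using symb_0[OF Suc.prems(1)] Suc.prems(3) by (auto simp: symb.simps) (meson mult_left_mono order_trans)
  ultimately show ?case using f'(1) by (auto simp: symb.simps(2))
qed

lemma symb_add:
  assumes "symb j I \<kappa> N b f" "symb j I \<kappa> N b g"
  shows "symb j I \<kappa> N b (\<lambda>i x. f i x + g i x)"
  using assms
proof (induction N arbitrary: b f g)
  case 0
  then obtain C C' where "C \<ge> 0" "C' \<ge> 0"
    "\<forall>i\<in>I. continuous_on UNIV (f i) \<and> (\<forall>x. norm (f i x) \<le> C * b i x)"
    "\<forall>i\<in>I. continuous_on UNIV (g i) \<and> (\<forall>x. norm (g i x) \<le> C' * b i x)"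
    by (auto simp: symb.simps)
  then show ?case
    unfolding symb.simps
    by (intro exI[of _ "C + C'"]) (auto intro!: continuous_intros intro: norm_triangle_mono simp: distrib_right)
next
  case (Suc N)
  obtain f' where f': "\<forall>i\<in>I. dir_deriv j (f i) (f' i)" "symb j I \<kappa> N (\<lambda>i x. \<kappa> i x * b i x) f'"
    using Suc.prems(1) by (auto simp: symb.simps)
  obtain g' where g': "\<forall>i\<in>I. dir_deriv j (g i) (g' i)" "symb j I \<kappa> N (\<lambda>i x. \<kappa> i x * b i x) g'"
    using Suc.prems(2) by (auto simp: symb.simps)
  have "symb j I \<kappa> 0 b (\<lambda>i x. f i x + g i x)"
    using symb_0[OF Suc.IH[OF symb_SucD[OF Suc.prems(1)] symb_SucD[OF Suc.prems(2)]]] .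
  moreover have "\<forall>i\<in>I. dir_deriv j (\<lambda>x. f i x + g i x) (\<lambda>x. f' i x + g' i x)"
    using f'(1) g'(1) by (auto simp: dir_deriv_def intro!: derivative_eq_intros)
  ultimately show ?case
    using Suc.IH[OF f'(2) g'(2)] by (auto simp: symb.simps(2))
qed

text \<open>Leibniz rule: with the same \<open>\<kappa>\<close> for both factors, each of the two
  terms of the derivative has size \<open>\<kappa> * b * c\<close>, so the product again loses one
  \<open>\<kappa>\<close> per derivative.\<close>

lemma symb_mult:
  assumes "symb j I \<kappa> N b f" "symb j I \<kappa> N c g"
  shows "symb j I \<kappa> N (\<lambda>i x. b i x * c i x) (\<lambda>i x. f i x * g i x)"
  using assms
proof (induction N arbitrary: b c f g)
  case 0
  then obtain C C' where C: "C \<ge> 0" "C' \<ge> 0"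
    "\<forall>i\<in>I. continuous_on UNIV (f i) \<and> (\<forall>x. norm (f i x) \<le> C * b i x)"
    "\<forall>i\<in>I. continuous_on UNIV (g i) \<and> (\<forall>x. norm (g i x) \<le> C' * c i x)"
    by (auto simp: symb.simps)
  have "norm (f i x * g i x) \<le> C * C' * (b i x * c i x)" if "i \<in> I" for i x
  proof -
    have "norm (f i x) * norm (g i x) \<le> (C * b i x) * (C' * c i x)"
      using C(3,4) that norm_ge_zero[of "f i x"] by (intro mult_mono) (auto intro: order_trans[of 0 "norm (f i x)"])
    then show ?thesis by (simp add: norm_mult mult_ac)
  qed
  then show ?case
    unfolding symb.simps using C
    by (intro exI[of _ "C * C'"]) (auto intro!: continuous_intros)
next
  case (Suc N)
  obtain f' where f': "\<forall>i\<in>I. dir_deriv j (f i) (f' i)" "symb j I \<kappa> N (\<lambda>i x. \<kappa> i x * b i x) f'"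
    using Suc.prems(1) by (auto simp: symb.simps)
  obtain g' where g': "\<forall>i\<in>I. dir_deriv j (g i) (g' i)" "symb j I \<kappa> N (\<lambda>i x. \<kappa> i x * c i x) g'"
    using Suc.prems(2) by (auto simp: symb.simps)
  have "symb j I \<kappa> 0 (\<lambda>i x. b i x * c i x) (\<lambda>i x. f i x * g i x)"
    using symb_0[OF Suc.IH[OF symb_SucD[OF Suc.prems(1)] symb_SucD[OF Suc.prems(2)]]] by simp
  moreover have "\<forall>i\<in>I. dir_deriv j (\<lambda>x. f i x * g i x) (\<lambda>x. f i x * g' i x + f' i x * g i x)"
    unfolding dir_deriv_def
  proof (intro ballI allI)
    fix i x assume "i \<in> I"
    then show "((\<lambda>t. f i (x + t *\<^sub>R axis j 1) * g i (x + t *\<^sub>R axis j 1)) has_vector_derivative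
         f i x * g' i x + f' i x * g i x) (at 0)"
      using f'(1) g'(1) has_vector_derivative_mult[of "\<lambda>t. f i (x + t *\<^sub>R axis j 1)" "f' i x" 0 UNIV
        "\<lambda>t. g i (x + t *\<^sub>R axis j 1)" "g' i x"] by (auto simp: dir_deriv_def)
  qed
  moreover have "symb j I \<kappa> N (\<lambda>i x. \<kappa> i x * (b i x * c i x)) (\<lambda>i x. f i x * g' i x + f' i x * g i x)"
    using symb_add[OF Suc.IH[OF symb_SucD[OF Suc.prems(1)] g'(2), unfolded mult.left_commute[of "b _ _"]]
       Suc.IH[OF f'(2) symb_SucD[OF Suc.prems(2)], unfolded mult.assoc]] .
  ultimately show ?case
    by (auto simp: symb.simps(2))
qed

lemma dir_deriv_const: "dir_deriv j (\<lambda>x. c) (\<lambda>x. 0)"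
  by (simp add: dir_deriv_def)

lemma symb_zero: "(\<And>i x. i \<in> I \<Longrightarrow> 0 \<le> b i x) \<Longrightarrow> (\<And>i x. i \<in> I \<Longrightarrow> 0 \<le> \<kappa> i x) \<Longrightarrow> symb j I \<kappa> N b (\<lambda>i x. 0)"
  by (induction N arbitrary: b) (auto simp: symb.simps intro!: exI[of _ 0] exI[of _ "\<lambda>i x. 0"] dir_deriv_const)

lemma symb_const:
  assumes "\<And>i x. i \<in> I \<Longrightarrow> 0 \<le> \<kappa> i x"
  shows "symb j I \<kappa> N (\<lambda>i x. 1) (\<lambda>i x. c)"
proof (cases N)
  case 0
  then show ?thesis by (auto simp: symb.simps intro!: exI[of _ "norm c"])
next
  case (Suc n)
  then show ?thesis using assms
    by (auto simp: symb.simps intro!: exI[of _ "norm c"] exI[of _ "\<lambda>i x. 0"] dir_deriv_const symb_zero)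
qed

lemma symb_cmult:
  assumes "symb j I \<kappa> N b f" "\<And>i x. i \<in> I \<Longrightarrow> 0 \<le> \<kappa> i x"
  shows "symb j I \<kappa> N b (\<lambda>i x. c * f i x)"
  using symb_mult[OF symb_const assms(1), of c] assms(2) by simp

lemma symb_power:
  assumes "symb j I \<kappa> N b f" "\<And>i x. i \<in> I \<Longrightarrow> 0 \<le> \<kappa> i x"
  shows "symb j I \<kappa> N (\<lambda>i x. b i x ^ k) (\<lambda>i x. f i x ^ k)"
  by (induction k) (use assms in \<open>auto intro!: symb_const symb_mult[OF assms(1)]\<close>)

lemma symb_sum:
  assumes "finite S" "\<And>s. s \<in> S \<Longrightarrow> symb j I \<kappa> N b (f s)"
    "\<And>i x. i \<in> I \<Longrightarrow> 0 \<le> b i x" "\<And>i x. i \<in> I \<Longrightarrow> 0 \<le> \<kappa> i x"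
  shows "symb j I \<kappa> N b (\<lambda>i x. \<Sum>s\<in>S. f s i x)"
  using assms by (induction S rule: finite_induct) (auto intro!: symb_zero symb_add)

lemma symb_prod:
  assumes "finite S" "\<And>s. s \<in> S \<Longrightarrow> symb j I \<kappa> N (b s) (f s)"
    "\<And>i x. i \<in> I \<Longrightarrow> 0 \<le> \<kappa> i x"
  shows "symb j I \<kappa> N (\<lambda>i x. \<Prod>s\<in>S. b s i x) (\<lambda>i x. \<Prod>s\<in>S. f s i x)"
  using assms by (induction S rule: finite_induct) (auto intro!: symb_const symb_mult)

text \<open>The derivative of \<open>1 / f\<close> is \<open>- f' / f ^ 2\<close>, of size
  \<open>\<kappa> * b / b ^ 2 = \<kappa> / b\<close>. The lower bound on \<open>f\<close> thus keeps
  the price at one \<open>\<kappa>\<close> per derivative; the induction feeds the claim of lower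
  order for the same \<open>f\<close> into the product rule.\<close>

lemma symb_inverse:
  assumes "symb j I \<kappa> N b f" and c: "c > 0" "\<And>i x. i \<in> I \<Longrightarrow> c * b i x \<le> norm (f i x)"
    "\<And>i x. i \<in> I \<Longrightarrow> 0 < b i x" "\<And>i x. i \<in> I \<Longrightarrow> 0 \<le> \<kappa> i x"
  shows "symb j I \<kappa> N (\<lambda>i x. inverse (b i x)) (\<lambda>i x. inverse (f i x))"
  using assms(1)
proof (induction N)
  case 0
  have nz: "f i x \<noteq> 0" if "i \<in> I" for i x
    using c(1) c(2,3)[OF that, of x] by (metis mult_pos_pos norm_zero not_le)
  have "norm (inverse (f i x)) \<le> inverse c * inverse (b i x)" if "i \<in> I" for i x
  proof -
    have "inverse (norm (f i x)) \<le> inverse (c * b i x)"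
      using c(1) c(2,3)[OF that, of x] by (intro le_imp_inverse_le) auto
    then show ?thesis by (simp add: norm_inverse)
  qed
  then show ?case using 0 nz c(1)
    by (auto simp: symb.simps intro!: exI[of _ "inverse c"] continuous_intros)
next
  case (Suc N)
  have nz: "f i x \<noteq> 0" if "i \<in> I" for i x
    using c(1) c(2,3)[OF that, of x] by (metis mult_pos_pos norm_zero not_le)
  obtain f' where f': "\<forall>i\<in>I. dir_deriv j (f i) (f' i)" "symb j I \<kappa> N (\<lambda>i x. \<kappa> i x * b i x) f'"
    using Suc.prems(1) by (auto simp: symb.simps)
  have inv: "symb j I \<kappa> N (\<lambda>i x. inverse (b i x)) (\<lambda>i x. inverse (f i x))"
    using Suc.IH Suc.prems symb_SucD by blast
  have "\<forall>i\<in>I. dir_deriv j (\<lambda>x. inverse (f i x)) (\<lambda>x. (-1) * (f' i x * (inverse (f i x) * inverse (f i x))))"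
    unfolding dir_deriv_def
  proof (intro ballI allI)
    fix i x assume i: "i \<in> I"
    have "((\<lambda>t. f i (x + t *\<^sub>R axis j 1)) has_vector_derivative f' i x) (at 0)"
      using f'(1) i by (auto simp: dir_deriv_def)
    moreover have "(inverse has_field_derivative (- (inverse (f i x) * inverse (f i x)))) (at (f i (x + 0 *\<^sub>R axis j 1)))"
      using DERIV_inverse[OF nz[OF i, of x]] by (simp add: power2_eq_square)
    ultimately have "(inverse \<circ> (\<lambda>t. f i (x + t *\<^sub>R axis j 1)) has_vector_derivative
        f' i x * (- (inverse (f i x) * inverse (f i x)))) (at 0)"
      by (intro field_vector_diff_chain_at)
    then show "((\<lambda>t. inverse (f i (x + t *\<^sub>R axis j 1))) has_vector_derivative
         (-1) * (f' i x * (inverse (f i x) * inverse (f i x)))) (at 0)"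
      by (simp add: o_def)
  qed
  moreover have "symb j I \<kappa> N (\<lambda>i x. \<kappa> i x * inverse (b i x)) (\<lambda>i x. (-1) * (f' i x * (inverse (f i x) * inverse (f i x))))"
  proof (rule symb_cmult[OF symb_mono[OF symb_mult[OF f'(2) symb_mult[OF inv inv]]]])
    fix i x assume i: "i \<in> I"
    show "\<kappa> i x * b i x * (inverse (b i x) * inverse (b i x)) \<le> \<kappa> i x * inverse (b i x)"
      using c(3)[OF i, of x] by (simp add: field_simps)
  qed (use c in auto)
  ultimately show ?case
    using symb_0[OF inv] by (auto simp: symb.simps(2))
qed

lemma dir_deriv_mult:
  fixes f g :: "real^'n::finite \<Rightarrow> complex"
  assumes "dir_deriv j f f'" "dir_deriv j g g'"
  shows "dir_deriv j (\<lambda>x. f x * g x) (\<lambda>x. f x * g' x + f' x * g x)"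
  unfolding dir_deriv_def
proof
  fix x show "((\<lambda>t. f (x + t *\<^sub>R axis j 1) * g (x + t *\<^sub>R axis j 1)) has_vector_derivative
         f x * g' x + f' x * g x) (at 0)"
    using assms has_vector_derivative_mult[of "\<lambda>t. f (x + t *\<^sub>R axis j 1)" "f' x" 0 UNIV
        "\<lambda>t. g (x + t *\<^sub>R axis j 1)" "g' x"] by (auto simp: dir_deriv_def)
qed

lemma dir_deriv_power:
  fixes f :: "real^'n::finite \<Rightarrow> complex"
  assumes "dir_deriv j f f'"
  shows "dir_deriv j (\<lambda>x. f x ^ Suc k) (\<lambda>x. of_nat (Suc k) * f x ^ k * f' x)"
proof (induction k)
  case (Suc k)
  have "dir_deriv j (\<lambda>x. f x * f x ^ Suc k) (\<lambda>x. f x * (of_nat (Suc k) * f x ^ k * f' x) + f' x * f x ^ Suc k)"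
    by (rule dir_deriv_mult[OF assms Suc])
  then show ?case by (simp add: algebra_simps)
qed (use assms in simp)

text \<open>Since \<open>\<rho> * E\<close> is \<open>1 / c\<close> times the derivative of
  \<open>E\<close>, one step trades two powers of \<open>\<rho>\<close>: one is absorbed by
  \<open>E\<close>, the other is differentiated or stays as a factor of the new amplitude, which has
  size \<open>\<kappa> * r * b\<close>. A zero of order \<open>2 * m\<close> thus pays for
  \<open>m\<close> steps without dividing by \<open>\<rho>\<close>. After \<open>l\<close> steps the
  integrand has size \<open>\<kappa> ^ l * r ^ (2 * m - l) * b\<close>, and the function
  differentiated next has one \<open>r\<close> less; these are the two integrability
  conditions.\<close>

lemma symb_ibp:
  fixes \<rho> g E :: "'i \<Rightarrow> real^'n::finite \<Rightarrow> complex"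
  assumes \<rho>: "symb j I \<kappa> m r \<rho>" and g: "symb j I \<kappa> m b g"
    and \<kappa>: "\<And>i x. i \<in> I \<Longrightarrow> 0 \<le> \<kappa> i x"
    and E: "\<And>i x. i \<in> I \<Longrightarrow> norm (E i x) = 1" "\<And>i. i \<in> I \<Longrightarrow> continuous_on UNIV (E i)"
    and E': "\<And>i. i \<in> I \<Longrightarrow> dir_deriv j (E i) (\<lambda>x. c * \<rho> i x * E i x)" and c: "c \<noteq> 0"
  shows "\<exists>h. symb j I \<kappa> 0 (\<lambda>i x. (\<kappa> i x * r i x) ^ m * b i x) h \<and>
    (\<forall>i\<in>I. (\<forall>l\<le>m. integrable lborel (\<lambda>x. \<kappa> i x ^ l * r i x ^ (2 * m - l) * b i x)) \<longrightarrow>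
       (\<forall>l<m. integrable lborel (\<lambda>x. \<kappa> i x ^ l * r i x ^ (2 * m - l - 1) * b i x)) \<longrightarrow>
       (LINT x|lborel. \<rho> i x ^ (2 * m) * g i x * E i x) = (- 1 / c) ^ m * (LINT x|lborel. h i x * E i x))"
  using \<rho> g
proof (induction m arbitrary: b g)
  case 0
  then show ?case by (intro exI[of _ g]) simp
next
  case (Suc m)
  obtain \<rho>' where \<rho>': "\<forall>i\<in>I. dir_deriv j (\<rho> i) (\<rho>' i)" "symb j I \<kappa> m (\<lambda>i x. \<kappa> i x * r i x) \<rho>'"
    using Suc.prems(1) by (auto simp: symb.simps)
  obtain g' where g': "\<forall>i\<in>I. dir_deriv j (g i) (g' i)" "symb j I \<kappa> m (\<lambda>i x. \<kappa> i x * b i x) g'"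
    using Suc.prems(2) by (auto simp: symb.simps)
  have \<rho>m: "symb j I \<kappa> m r \<rho>" and gm: "symb j I \<kappa> m b g"
    using Suc.prems symb_SucD by blast+
  \<comment> \<open>The derivative of \<open>\<rho> ^ (2 * m + 1) * g\<close> after division by
    \<open>\<rho> ^ (2 * m)\<close>.\<close>
  define g1 where "g1 = (\<lambda>i x. of_nat (Suc (2 * m)) * (\<rho>' i x * g i x) + \<rho> i x * g' i x)"
  define b1 where "b1 = (\<lambda>i x. \<kappa> i x * r i x * b i x)"
  have g1: "symb j I \<kappa> m b1 g1"
    unfolding g1_def
  proof (intro symb_add symb_cmult)
    show "symb j I \<kappa> m b1 (\<lambda>i x. \<rho>' i x * g i x)"
      using symb_mult[OF \<rho>'(2) gm] by (simp add: b1_def)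
    have "(\<lambda>i x. r i x * (\<kappa> i x * b i x)) = b1"
      by (auto simp: b1_def fun_eq_iff)
    then show "symb j I \<kappa> m b1 (\<lambda>i x. \<rho> i x * g' i x)"
      using symb_mult[OF \<rho>m g'(2)] by simp
  qed (use \<kappa> in auto)
  obtain h where h: "symb j I \<kappa> 0 (\<lambda>i x. (\<kappa> i x * r i x) ^ m * b1 i x) h"
    and hI: "\<And>i. i \<in> I \<Longrightarrow> (\<forall>l\<le>m. integrable lborel (\<lambda>x. \<kappa> i x ^ l * r i x ^ (2 * m - l) * b1 i x)) \<Longrightarrow>
       (\<forall>l<m. integrable lborel (\<lambda>x. \<kappa> i x ^ l * r i x ^ (2 * m - l - 1) * b1 i x)) \<Longrightarrow>
       (LINT x|lborel. \<rho> i x ^ (2 * m) * g1 i x * E i x) = (- 1 / c) ^ m * (LINT x|lborel. h i x * E i x)"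
    using Suc.IH[OF \<rho>m g1] by blast
  have "(LINT x|lborel. \<rho> i x ^ (2 * Suc m) * g i x * E i x) = (- 1 / c) ^ Suc m * (LINT x|lborel. h i x * E i x)"
    if i: "i \<in> I" and i1: "\<forall>l\<le>Suc m. integrable lborel (\<lambda>x. \<kappa> i x ^ l * r i x ^ (2 * Suc m - l) * b i x)"
      and i2: "\<forall>l<Suc m. integrable lborel (\<lambda>x. \<kappa> i x ^ l * r i x ^ (2 * Suc m - l - 1) * b i x)" for i
  proof -
    have "integrable lborel (\<lambda>x. \<kappa> i x ^ l * r i x ^ (2 * m - l) * b1 i x)" if "l \<le> m" for l
    proof -
      have "(\<lambda>x. \<kappa> i x ^ l * r i x ^ (2 * m - l) * b1 i x) = (\<lambda>x. \<kappa> i x ^ Suc l * r i x ^ (2 * Suc m - Suc l) * b i x)"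
        using that by (auto simp: b1_def fun_eq_iff Suc_diff_le)
      then show ?thesis using i1[rule_format, of "Suc l"] that by (simp only: Suc_le_mono)
    qed
    moreover have "integrable lborel (\<lambda>x. \<kappa> i x ^ l * r i x ^ (2 * m - l - 1) * b1 i x)" if "l < m" for l
    proof -
      \<comment> \<open>\<open>l < m\<close> keeps the truncated subtraction exact; the factor
        \<open>r\<close> inside \<open>b1\<close> accounts for the successor.\<close>
      have "2 * Suc m - Suc l - 1 = Suc (2 * m - l - 1)" using that by simp
      then have "(\<lambda>x. \<kappa> i x ^ l * r i x ^ (2 * m - l - 1) * b1 i x) = (\<lambda>x. \<kappa> i x ^ Suc l * r i x ^ (2 * Suc m - Suc l - 1) * b i x)"
        by (auto simp: b1_def fun_eq_iff)
      then show ?thesis using i2[rule_format, of "Suc l"] that by (simp only: Suc_less_eq)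
    qed
    ultimately have IH: "(LINT x|lborel. \<rho> i x ^ (2 * m) * g1 i x * E i x) = (- 1 / c) ^ m * (LINT x|lborel. h i x * E i x)"
      using hI i by blast
    obtain R where R: "R \<ge> 0" "continuous_on UNIV (\<rho> i)" "\<And>x. norm (\<rho> i x) \<le> R * r i x"
      using symb_0[OF \<rho>m] i by (auto simp: symb.simps)
    obtain G where G: "G \<ge> 0" "continuous_on UNIV (g i)" "\<And>x. norm (g i x) \<le> G * b i x"
      using symb_0[OF gm] i by (auto simp: symb.simps)
    obtain G1 where G1: "G1 \<ge> 0" "continuous_on UNIV (g1 i)" "\<And>x. norm (g1 i x) \<le> G1 * b1 i x"
      using symb_0[OF g1] i by (auto simp: symb.simps)
    note Ec = E(2)[OF i]
    have bd: "norm (\<rho> i x ^ k * u * E i x) \<le> norm (R ^ k * C * (r i x ^ k * v))"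
      if "norm u \<le> C * v" for k u C v x
    proof -
      have "norm (\<rho> i x ^ k * u * E i x) = norm (\<rho> i x) ^ k * norm u"
        using E(1)[OF i] by (simp add: norm_mult norm_power)
      also have "\<dots> \<le> (R * r i x) ^ k * (C * v)"
        using R(3)[of x] that order_trans[OF norm_ge_zero R(3)[of x]]
        by (intro mult_mono power_mono zero_le_power) (auto intro: order_trans[OF norm_ge_zero])
      finally show ?thesis by (simp add: power_mult_distrib mult_ac)
    qed
    have int1: "integrable lborel (\<lambda>x. \<rho> i x ^ (2 * Suc m) * g i x * E i x)"
    proof (rule Bochner_Integration.integrable_bound)
      show "integrable lborel (\<lambda>x. R ^ (2 * Suc m) * G * (r i x ^ (2 * Suc m) * b i x))"
        using i1[rule_format, of 0] by (intro integrable_mult_right) simp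
      show "(\<lambda>x. \<rho> i x ^ (2 * Suc m) * g i x * E i x) \<in> borel_measurable lborel"
        using borel_measurable_continuous_onI[OF R(2)] borel_measurable_continuous_onI[OF G(2)]
          borel_measurable_continuous_onI[OF Ec] by measurable
      show "AE x in lborel. norm (\<rho> i x ^ (2 * Suc m) * g i x * E i x) \<le> norm (R ^ (2 * Suc m) * G * (r i x ^ (2 * Suc m) * b i x))"
        using bd[OF G(3)] by blast
    qed
    have int2: "integrable lborel (\<lambda>x. \<rho> i x ^ Suc (2 * m) * g i x * E i x)"
    proof (rule Bochner_Integration.integrable_bound)
      show "integrable lborel (\<lambda>x. R ^ Suc (2 * m) * G * (r i x ^ Suc (2 * m) * b i x))"
        using i2[rule_format, of 0] by (intro integrable_mult_right) simp
      show "(\<lambda>x. \<rho> i x ^ Suc (2 * m) * g i x * E i x) \<in> borel_measurable lborel"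
        using borel_measurable_continuous_onI[OF R(2)] borel_measurable_continuous_onI[OF G(2)]
          borel_measurable_continuous_onI[OF Ec] by measurable
      show "AE x in lborel. norm (\<rho> i x ^ Suc (2 * m) * g i x * E i x) \<le> norm (R ^ Suc (2 * m) * G * (r i x ^ Suc (2 * m) * b i x))"
        using bd[OF G(3)] by blast
    qed
    have int3: "integrable lborel (\<lambda>x. \<rho> i x ^ (2 * m) * g1 i x * E i x)"
    proof (rule Bochner_Integration.integrable_bound)
      have "(\<lambda>x. \<kappa> i x ^ 1 * r i x ^ (2 * Suc m - 1) * b i x) = (\<lambda>x. r i x ^ (2 * m) * b1 i x)"
        by (auto simp: b1_def fun_eq_iff)
      moreover have "integrable lborel (\<lambda>x. \<kappa> i x ^ 1 * r i x ^ (2 * Suc m - 1) * b i x)"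
        using i1[rule_format, of 1] by simp
      ultimately show "integrable lborel (\<lambda>x. R ^ (2 * m) * G1 * (r i x ^ (2 * m) * b1 i x))"
        by (intro integrable_mult_right) simp
      show "(\<lambda>x. \<rho> i x ^ (2 * m) * g1 i x * E i x) \<in> borel_measurable lborel"
        using borel_measurable_continuous_onI[OF R(2)] borel_measurable_continuous_onI[OF G1(2)]
          borel_measurable_continuous_onI[OF Ec] by measurable
      show "AE x in lborel. norm (\<rho> i x ^ (2 * m) * g1 i x * E i x) \<le> norm (R ^ (2 * m) * G1 * (r i x ^ (2 * m) * b1 i x))"
        using bd[OF G1(3)] by blast
    qed
    \<comment> \<open>The total derivative whose integral vanishes. The summand with factor
      \<open>c\<close> arises from differentiating \<open>E\<close> and is the integral to be
      reduced.\<close>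
    let ?F = "\<lambda>x. \<rho> i x ^ Suc (2 * m) * g i x * E i x"
    let ?F' = "\<lambda>x. \<rho> i x ^ (2 * m) * g1 i x * E i x + c * (\<rho> i x ^ (2 * Suc m) * g i x * E i x)"
    have "dir_deriv j ?F (\<lambda>x. \<rho> i x ^ Suc (2 * m) * g i x * (c * \<rho> i x * E i x) +
        (\<rho> i x ^ Suc (2 * m) * g' i x + of_nat (Suc (2 * m)) * \<rho> i x ^ (2 * m) * \<rho>' i x * g i x) * E i x)"
      using i \<rho>'(1) g'(1) by (intro dir_deriv_mult dir_deriv_power E') auto
    also have "(\<lambda>x. \<rho> i x ^ Suc (2 * m) * g i x * (c * \<rho> i x * E i x) +
        (\<rho> i x ^ Suc (2 * m) * g' i x + of_nat (Suc (2 * m)) * \<rho> i x ^ (2 * m) * \<rho>' i x * g i x) * E i x) = ?F'"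
      by (auto simp: g1_def fun_eq_iff algebra_simps)
    finally have "(LINT x|lborel. ?F' x) = 0"
      by (rule integral_dir_deriv_zero)
        (use int1 int2 int3 R(2) G(2) G1(2) Ec in \<open>auto intro!: continuous_intros\<close>)
    then have "(LINT x|lborel. \<rho> i x ^ (2 * m) * g1 i x * E i x) + c * (LINT x|lborel. \<rho> i x ^ (2 * Suc m) * g i x * E i x) = 0"
      using int1 int3 by (subst (asm) Bochner_Integration.integral_add) auto
    then have "(LINT x|lborel. \<rho> i x ^ (2 * Suc m) * g i x * E i x) = (- 1 / c) * (LINT x|lborel. \<rho> i x ^ (2 * m) * g1 i x * E i x)"
      using c by (simp add: field_simps eq_neg_iff_add_eq_0)
    then show ?thesis using IH by simp
  qed
  moreover have "(\<lambda>i x. (\<kappa> i x * r i x) ^ m * b1 i x) = (\<lambda>i x. (\<kappa> i x * r i x) ^ Suc m * b i x)"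
    by (auto simp: b1_def fun_eq_iff)
  ultimately show ?case using h by (intro exI[of _ h]) auto
qed

subsection \<open>Warping functions\<close>

lemma dir_deriv_partial_deriv:
  assumes "\<And>x. f differentiable (at x)"
  shows "dir_deriv j f (partial_deriv j f)"
  unfolding dir_deriv_def
proof
  fix x
  have "(\<lambda>t. f (x + t *\<^sub>R axis j 1)) differentiable (at (0::real))"
  proof (rule differentiable_compose[of f])
    show "f differentiable at (x + 0 *\<^sub>R axis j 1)" using assms by simp
  qed (auto intro!: derivative_intros)
  then show "((\<lambda>t. f (x + t *\<^sub>R axis j 1)) has_vector_derivative partial_deriv j f x) (at 0)"
    unfolding partial_deriv_def by (simp add: vector_derivative_works)
qed

lemma dir_deriv_unique:
  assumes "dir_deriv j f f'" shows "partial_deriv j f = f'"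
  using assms by (auto simp: dir_deriv_def partial_deriv_def fun_eq_iff intro: vector_derivative_at)

lemma dir_deriv_bounded_linear:
  assumes "bounded_linear L" "dir_deriv j f f'"
  shows "dir_deriv j (\<lambda>x. L (f (x + a))) (\<lambda>x. L (f' (x + a)))"
  unfolding dir_deriv_def
proof
  fix x
  have "((\<lambda>t. f ((x + a) + t *\<^sub>R axis j 1)) has_vector_derivative f' (x + a)) (at 0)"
    using assms(2) unfolding dir_deriv_def by blast
  then have "((\<lambda>t. L (f ((x + a) + t *\<^sub>R axis j 1))) has_vector_derivative L (f' (x + a))) (at 0)"
    by (rule bounded_linear.has_vector_derivative[OF assms(1)])
  then show "((\<lambda>t. L (f (x + t *\<^sub>R axis j 1 + a))) has_vector_derivative L (f' (x + a))) (at 0)"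
    by (simp add: add_ac)
qed

lemma dir_deriv_add:
  assumes "dir_deriv j f f'" "dir_deriv j g g'"
  shows "dir_deriv j (\<lambda>x. f x + g x) (\<lambda>x. f' x + g' x)"
  using assms by (auto simp: dir_deriv_def intro!: derivative_eq_intros)

section \<open>Iterated partial derivatives of functions of class \<open>C_k_on\<close>\<close>

lemma C_k_on_continuous: "C_k_on k f S \<Longrightarrow> continuous_on S f"
  by (cases k) (auto intro!: continuous_at_imp_continuous_on differentiable_imp_continuous_within)

lemma C_k_on_partial_deriv_iterate:
  "C_k_on k f S \<Longrightarrow> n \<le> k \<Longrightarrow> C_k_on (k - n) ((partial_deriv j ^^ n) f) S"
proof (induction n)
  case (Suc n)
  then have "C_k_on (Suc (k - Suc n)) ((partial_deriv j ^^ n) f) S"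
    by (simp add: Suc_diff_Suc)
  then show ?case by simp
qed simp

lemma C_k_on_continuous_iterate:
  "C_k_on k f S \<Longrightarrow> n \<le> k \<Longrightarrow> continuous_on S ((partial_deriv j ^^ n) f)"
  using C_k_on_partial_deriv_iterate C_k_on_continuous by blast

lemma C_k_on_dir_deriv_iterate:
  assumes "C_k_on k f UNIV" "n < k"
  shows "dir_deriv j ((partial_deriv j ^^ n) f) ((partial_deriv j ^^ Suc n) f)"
proof -
  have "C_k_on (Suc (k - Suc n)) ((partial_deriv j ^^ n) f) UNIV"
    using C_k_on_partial_deriv_iterate[OF assms(1), of n] assms(2) by (simp add: Suc_diff_Suc)
  then show ?thesis using dir_deriv_partial_deriv by auto
qed

lemma C_k_on_bounded_linear:
  assumes "bounded_linear L" "C_k_on k f UNIV"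
  shows "C_k_on k (\<lambda>x. L (f (x + a))) UNIV"
  using assms(2)
proof (induction k arbitrary: f)
  case 0
  then show ?case
    by (auto intro!: bounded_linear.continuous_on[OF assms(1)] continuous_on_compose2[of UNIV f] continuous_intros)
next
  case (Suc k)
  have d: "f differentiable (at x)" for x using Suc.prems by auto
  have "(\<lambda>x. L (f (x + a))) differentiable (at x)" for x
  proof -
    have "(\<lambda>x. f (x + a)) differentiable (at x)"
      by (rule differentiable_compose[of f _ _ UNIV, OF d]) (auto intro!: derivative_intros)
    then show ?thesis
      using bounded_linear.has_derivative[OF assms(1)] unfolding differentiable_def by blast
  qed
  moreover have "partial_deriv i (\<lambda>x. L (f (x + a))) = (\<lambda>x. L (partial_deriv i f (x + a)))" for i
    by (intro dir_deriv_unique dir_deriv_bounded_linear assms(1) dir_deriv_partial_deriv d)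
  ultimately show ?case using Suc by auto
qed

lemma C_k_on_add:
  assumes "C_k_on k f UNIV" "C_k_on k g UNIV"
  shows "C_k_on k (\<lambda>x. f x + g x) UNIV"
  using assms
proof (induction k arbitrary: f g)
  case (Suc k)
  have "partial_deriv i (\<lambda>x. f x + g x) = (\<lambda>x. partial_deriv i f x + partial_deriv i g x)" for i
    using Suc.prems by (intro dir_deriv_unique dir_deriv_add dir_deriv_partial_deriv) auto
  then show ?case using Suc by auto
qed (auto intro: continuous_intros)

lemma C_k_on_const: "C_k_on k (\<lambda>x::real^'n::finite. c) UNIV"
proof (induction k arbitrary: c)
  case (Suc k)
  have "partial_deriv i (\<lambda>x::real^'n. c) = (\<lambda>x. 0)" for i
    by (intro dir_deriv_unique dir_deriv_const)
  then show ?case using Suc by auto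
qed auto

lemma C_k_on_sum:
  assumes "finite S" "\<And>s. s \<in> S \<Longrightarrow> C_k_on k (f s) UNIV"
  shows "C_k_on k (\<lambda>x. \<Sum>s\<in>S. f s x) UNIV"
  using assms by (induction S rule: finite_induct) (auto intro: C_k_on_const C_k_on_add)

text \<open>Turns the multiindex bounds of admissibility into bounds for iterated derivatives in one
  direction, the form needed for \<open>symb\<close>.\<close>

lemma multi_deriv_single:
  "multi_deriv (\<lambda>i. if i = j then n else 0) f = (partial_deriv j ^^ n) f"
proof -
  have "foldr (\<lambda>i. partial_deriv i ^^ (if i = j then n else 0)) xs f =
      (if j \<in> set xs then (partial_deriv j ^^ n) f else f)" if "distinct xs" for xs
    using that by (induction xs) auto
  from this[of "sorted_list_of_set UNIV"] show ?thesis
    unfolding multi_deriv_def by simp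
qed

text \<open>The way concrete functions enter a symbol class: a list of explicit derivatives bounded
  with constant 1, hence uniformly in the parameter.\<close>

lemma symb_chain:
  assumes "\<And>i n. i \<in> I \<Longrightarrow> n < N \<Longrightarrow> dir_deriv j (F n i) (F (Suc n) i)"
    and "\<And>i n. i \<in> I \<Longrightarrow> n \<le> N \<Longrightarrow> continuous_on UNIV (F n i)"
    and "\<And>i n x. i \<in> I \<Longrightarrow> n \<le> N \<Longrightarrow> norm (F n i x) \<le> \<kappa> i x ^ n * b i x"
  shows "symb j I \<kappa> N b (F 0)"
  using assms
proof (induction N arbitrary: F b)
  case 0
  show ?case using "0"(2)[of _ 0] "0"(3)[of _ 0] by (auto simp: symb.simps intro!: exI[of _ 1])
next
  case (Suc N)
  have "symb j I \<kappa> N (\<lambda>i x. \<kappa> i x * b i x) (F (Suc 0))"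
  proof (rule Suc.IH[of "\<lambda>n. F (Suc n)"])
    show "norm (F (Suc n) i x) \<le> \<kappa> i x ^ n * (\<kappa> i x * b i x)" if "i \<in> I" "n \<le> N" for i n x
      using Suc.prems(3)[of i "Suc n" x] that by (simp add: mult_ac)
  qed (use Suc.prems in auto)
  moreover have "symb j I \<kappa> 0 b (F 0)"
    using Suc.prems(2)[of _ 0] Suc.prems(3)[of _ 0] by (auto simp: symb.simps intro!: exI[of _ 1])
  ultimately show ?case using Suc.prems(1)[of _ 0] by (auto simp: symb.simps(2))
qed

lemma matrix_opnorm_component: "\<bar>M $ k $ l\<bar> \<le> matrix_opnorm M"
  unfolding matrix_opnorm_def by (rule matrix_component_le_onorm)

lemma matrix_opnorm_vector: "norm (M *v x) \<le> matrix_opnorm M * norm x"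
  unfolding matrix_opnorm_def by (rule onorm) (simp add: matrix_vector_mul_bounded_linear)

text \<open>Each of the \<open>d!\<close> terms of the Leibniz expansion is at most
  \<open>B ^ d\<close>; this is the origin of the factorials in all later constants.\<close>

lemma abs_det_le:
  fixes M :: "real^'n::finite^'n"
  assumes "\<And>k l. \<bar>M $ k $ l\<bar> \<le> B"
  shows "\<bar>det M\<bar> \<le> fact CARD('n) * B ^ CARD('n)"
proof -
  have "\<bar>det M\<bar> \<le> (\<Sum>p | p permutes (UNIV::'n set). \<bar>of_int (sign p) * (\<Prod>i\<in>UNIV. M $ i $ p i)\<bar>)"
    unfolding det_def by (rule sum_abs)
  also have "\<dots> \<le> (\<Sum>p | p permutes (UNIV::'n set). B ^ CARD('n))"
  proof (rule sum_mono)
    fix p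
    have "\<bar>of_int (sign p) * (\<Prod>i\<in>UNIV. M $ i $ p i)\<bar> = (\<Prod>i\<in>UNIV. \<bar>M $ i $ p i\<bar>)"
      by (simp add: abs_mult abs_prod sign_def)
    also have "\<dots> \<le> (\<Prod>i\<in>(UNIV::'n set). B)" by (intro prod_mono) (use assms in auto)
    finally show "\<bar>of_int (sign p) * (\<Prod>i\<in>UNIV. M $ i $ p i)\<bar> \<le> B ^ CARD('n)" by simp
  qed
  finally show ?thesis by (simp add: card_permutations)
qed

section \<open>Consequences of admissibility, with the order \<open>N\<close> left free\<close>

locale warping =
  fixes N :: nat and D :: "(real^'n::{finite,wellorder}) set"
    and \<Phi> :: "real^'n::_ \<Rightarrow> real^'n::_" and v0 :: "real^'n::_ \<Rightarrow> real"
  assumes open_D: "open D" and admissible: "admissible_warping N D \<Phi> v0"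
begin

abbreviation "\<Psi> \<equiv> inv_into D \<Phi>"
abbreviation "A \<equiv> warp_jac D \<Phi>"
abbreviation "w \<equiv> warp_weight D \<Phi>"
abbreviation "\<phi> \<equiv> warp_phi D \<Phi>"

lemma v0_pos: "0 < v0 x" and v0_cont: "continuous_on UNIV v0"
  and v0_add: "v0 (x + y) \<le> v0 x * v0 y"
  and v0_radial: "norm x \<le> norm y \<Longrightarrow> v0 x \<le> v0 y"
  using admissible by (auto simp: admissible_warping_def submultiplicative_def radially_increasing_def)

text \<open>Submultiplicativity at the origin gives \<open>v0 0 \<le> v0 0 * v0 0\<close>, hence
  \<open>1 \<le> v0 0\<close>; radial growth extends this. It allows exponents of \<open>v0\<close>
  to be enlarged freely later on.\<close>

lemma v0_ge1: "1 \<le> v0 x"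
proof -
  have "v0 0 * 1 \<le> v0 0 * v0 0" using v0_add[of 0 0] by simp
  then have "1 \<le> v0 0" using v0_pos[of 0] by (subst (asm) mult_le_cancel_left_pos) auto
  also have "v0 0 \<le> v0 x" by (rule v0_radial) simp
  finally show ?thesis .
qed

lemma v0_minus: "v0 (- x) = v0 x"
  by (intro antisym v0_radial) auto

lemma bij: "bij_betw \<Phi> D UNIV"
  using admissible by (auto simp: admissible_warping_def C_k_diffeo_onto_space_def)

lemma \<Psi>_in: "\<Psi> \<tau> \<in> D" and \<Phi>_\<Psi> [simp]: "\<Phi> (\<Psi> \<tau>) = \<tau>" and \<Psi>_\<Phi>: "\<xi> \<in> D \<Longrightarrow> \<Psi> (\<Phi> \<xi>) = \<xi>"
  using bij by (auto simp: bij_betw_def inv_into_into f_inv_into_f)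

lemma range_\<Psi>: "range \<Psi> = D"
  using \<Psi>_in \<Psi>_\<Phi> by (metis image_eqI image_subsetI subsetI subset_antisym UNIV_I)

lemma inj_\<Psi>: "inj \<Psi>"
  by (metis \<Phi>_\<Psi> injI)

lemma C_\<Phi>: "C_k_on (Suc N) \<Phi> D" and C_\<Psi>: "C_k_on (Suc N) \<Psi> UNIV"
  using admissible by (auto simp: admissible_warping_def C_k_diffeo_onto_space_def)

lemma \<Phi>_differentiable: "\<xi> \<in> D \<Longrightarrow> \<Phi> differentiable (at \<xi>)"
  and \<Psi>_differentiable: "\<Psi> differentiable (at \<tau>)"
  using C_\<Phi> C_\<Psi> by auto

lemma \<Phi>_cont: "continuous_on D \<Phi>" and \<Psi>_cont: "continuous_on UNIV \<Psi>"
  using C_\<Phi> C_\<Psi> C_k_on_continuous by blast+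

lemma \<Psi>_deriv: "(\<Psi> has_derivative (\<lambda>h. A \<tau> *v h)) (at \<tau>)"
  using \<Psi>_differentiable by (simp add: jacobian_works warp_jac_def)

lemma w_pos: "0 < w \<tau>"
  using admissible by (auto simp: admissible_warping_def warp_weight_def)

lemma A_invertible: "invertible (A \<tau>)"
  using w_pos[of \<tau>] by (simp add: invertible_det_nz warp_weight_def)

lemma A_column: "A \<tau> *v axis j 1 = partial_deriv j \<Psi> \<tau>"
proof -
  have "((\<lambda>t. \<Psi> (\<tau> + t *\<^sub>R axis j 1)) has_derivative (\<lambda>t. A \<tau> *v (t *\<^sub>R axis j 1))) (at 0)"
    by (rule has_derivative_compose[where f="\<lambda>t. \<tau> + t *\<^sub>R axis j 1" and g=\<Psi>])
      (auto intro!: derivative_eq_intros \<Psi>_deriv)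
  then have "((\<lambda>t. \<Psi> (\<tau> + t *\<^sub>R axis j 1)) has_vector_derivative (A \<tau> *v axis j 1)) (at 0)"
    by (simp add: has_vector_derivative_def matrix_vector_mult_scaleR)
  then show ?thesis
    unfolding partial_deriv_def by (rule vector_derivative_at[symmetric])
qed

lemma A_entry: "A \<tau> $ i $ j = partial_deriv j \<Psi> \<tau> $ i"
  unfolding A_column[symmetric] by (simp add: matrix_vector_mul_component inner_axis row_def)

lemma C_A: "C_k_on N A UNIV"
proof -
  \<comment> \<open>\<open>L j\<close> puts a vector into column \<open>j\<close> of an otherwise
    zero matrix, so the Jacobian is a sum of linear images of the partial derivatives of
    \<open>\<Psi>\<close>. One order of smoothness is spent here.\<close>
  define L :: "'n \<Rightarrow> real^'n::_ \<Rightarrow> real^'n::_^'n::_" where "L = (\<lambda>j v. \<chi> i l. if l = j then v $ i else 0)"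
  have "bounded_linear (L j)" for j
    unfolding linear_conv_bounded_linear[symmetric]
    by (rule linearI) (auto simp: L_def vec_eq_iff)
  moreover have "C_k_on N (partial_deriv j \<Psi>) UNIV" for j using C_\<Psi> by auto
  ultimately have "C_k_on N (\<lambda>\<tau>. \<Sum>j\<in>UNIV. L j (partial_deriv j \<Psi> (\<tau> + 0))) UNIV"
    by (intro C_k_on_sum C_k_on_bounded_linear) auto
  moreover have "(\<lambda>\<tau>. \<Sum>j\<in>UNIV. L j (partial_deriv j \<Psi> (\<tau> + 0))) = A"
    by (auto simp: L_def vec_eq_iff fun_eq_iff A_entry sum.delta)
  ultimately show ?thesis by simp
qed

lemma A_cont: "continuous_on UNIV A"
  using C_A C_k_on_continuous by blast

lemma w_cont: "continuous_on UNIV w"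
  unfolding warp_weight_def det_def using A_cont by (intro continuous_intros) auto

lemma C_\<phi>: "C_k_on N (\<phi> \<sigma>) UNIV"
proof -
  have "bounded_linear (\<lambda>M. transpose M ** transpose (matrix_inv (A \<sigma>)))"
    unfolding linear_conv_bounded_linear[symmetric]
    by (rule linearI) (auto simp: transpose_def matrix_matrix_mult_def vec_eq_iff sum.distrib algebra_simps sum_distrib_left)
  from C_k_on_bounded_linear[OF this C_A, of \<sigma>] show ?thesis
    by (simp add: warp_phi_def[abs_def])
qed

lemma \<phi>_deriv_opnorm:
  assumes "n \<le> N" shows "matrix_opnorm ((partial_deriv j ^^ n) (\<phi> \<sigma>) t) \<le> v0 t"
proof -
  have "sum (\<lambda>i. if i = j then n else 0) (UNIV :: 'n set) \<le> N" using assms by (simp add: sum.delta)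
  then have "matrix_opnorm (multi_deriv (\<lambda>i. if i = j then n else 0) (\<phi> \<sigma>) t) \<le> v0 t"
    using admissible unfolding admissible_warping_def by blast
  then show ?thesis by (simp add: multi_deriv_single)
qed

lemma matrix_inv_A: "matrix_inv (A \<sigma>) ** A \<sigma> = mat 1" "A \<sigma> ** matrix_inv (A \<sigma>) = mat 1"
  using A_invertible[of \<sigma>] unfolding invertible_def matrix_inv_def
  by (metis (mono_tags, lifting) someI_ex)+

lemma \<phi>_mult: "\<phi> \<sigma> t ** transpose (A \<sigma>) = transpose (A (t + \<sigma>))"
proof -
  have "transpose (matrix_inv (A \<sigma>)) ** transpose (A \<sigma>) = mat 1"
    by (simp add: matrix_transpose_mul[symmetric] matrix_inv_A)
  then show ?thesis
    unfolding warp_phi_def by (simp add: matrix_mul_assoc[symmetric])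
qed

text \<open>Cocycle property: the matrix for the step \<open>- t\<close> from
  \<open>\<sigma> + t\<close> undoes the step \<open>t\<close> from \<open>\<sigma>\<close>.\<close>

lemma \<phi>_inverse: "\<phi> (\<sigma> + t) (- t) ** \<phi> \<sigma> t = mat 1"
proof -
  have "\<phi> (\<sigma> + t) (- t) ** \<phi> \<sigma> t =
      transpose (A \<sigma>) ** ((transpose (matrix_inv (A (\<sigma> + t))) ** transpose (A (t + \<sigma>))) ** transpose (matrix_inv (A \<sigma>)))"
    unfolding warp_phi_def by (simp add: matrix_mul_assoc)
  also have "\<dots> = mat 1"
    by (simp add: matrix_transpose_mul[symmetric] matrix_inv_A add.commute)
  finally show ?thesis .
qed

lemma \<phi>_norm_le: "norm (\<phi> \<sigma> t *v x) \<le> v0 t * norm x"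
  using matrix_opnorm_vector[of "\<phi> \<sigma> t" x] \<phi>_deriv_opnorm[where n=0 and \<sigma>=\<sigma> and t=t]
  by (simp add: mult_right_mono order_trans)

text \<open>The upper bound applied to the inverse matrix, together with
  \<open>v0 (- t) = v0 t\<close>. It shows that the phase gradient vanishes nowhere for
  \<open>x \<noteq> 0\<close>.\<close>

lemma \<phi>_norm_ge: "norm x \<le> v0 t * norm (\<phi> \<sigma> t *v x)"
proof -
  have "norm x = norm (\<phi> (\<sigma> + t) (- t) *v (\<phi> \<sigma> t *v x))"
    by (simp add: matrix_vector_mul_assoc \<phi>_inverse)
  also have "\<dots> \<le> v0 t * norm (\<phi> \<sigma> t *v x)"
    using \<phi>_norm_le[of "\<sigma> + t" "- t" "\<phi> \<sigma> t *v x"] by (simp add: v0_minus)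
  finally show ?thesis .
qed

lemma det_\<phi>: "w (t + \<sigma>) = det (\<phi> \<sigma> t) * w \<sigma>"
  unfolding warp_weight_def by (metis \<phi>_mult det_mul det_transpose)

lemma det_\<phi>_pos: "0 < det (\<phi> \<sigma> t)"
  using det_\<phi>[of t \<sigma>] w_pos[of "t + \<sigma>"] w_pos[of \<sigma>] by (simp add: zero_less_mult_iff)

lemma det_\<phi>_le: "det (\<phi> \<sigma> t) \<le> fact CARD('n) * v0 t ^ CARD('n)"
proof -
  have "\<bar>\<phi> \<sigma> t $ k $ l\<bar> \<le> v0 t" for k l
    using matrix_opnorm_component[of "\<phi> \<sigma> t" k l] \<phi>_deriv_opnorm[where n=0 and \<sigma>=\<sigma> and t=t] by simp
  from abs_det_le[OF this] show ?thesis by simp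
qed

text \<open>The density \<open>w\<close> varies between two points by at most a power of
  \<open>v0\<close> of their difference, which lets it be frozen at the centre of a
  prototype.\<close>

lemma w_ratio: "w \<rho> \<le> fact CARD('n) * v0 (\<rho> - \<sigma>) ^ CARD('n) * w \<sigma>"
  using det_\<phi>[of "\<rho> - \<sigma>" \<sigma>] det_\<phi>_le[of \<sigma> "\<rho> - \<sigma>"] w_pos[of \<sigma>] by simp

lemma \<phi>_cont: "continuous_on UNIV (\<phi> \<sigma>)"
  using C_\<phi> C_k_on_continuous by blast

text \<open>The size is measured against the gradient length itself. Order 0 is bounded by it
  directly; a higher derivative is at most \<open>v0 t * norm x\<close>, and \<open>norm x\<close>
  is at most \<open>v0 t\<close> times the gradient length. This forces
  \<open>\<kappa> = v0 ^ 2\<close>.\<close>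

lemma symb_\<phi>_vector:
  fixes \<sigma> x :: "'i \<Rightarrow> real^'n::_"
  shows "symb j I (\<lambda>i t. (v0 t)\<^sup>2) N (\<lambda>i t. norm (\<phi> (\<sigma> i) t *v x i))
    (\<lambda>i t. of_real ((\<phi> (\<sigma> i) t *v x i) $ k))"
proof -
  define F where "F n i t = complex_of_real (((partial_deriv j ^^ n) (\<phi> (\<sigma> i)) t *v x i) $ k)" for n i t
  have L: "bounded_linear (\<lambda>M::real^'n::_^'n::_. complex_of_real ((M *v y) $ k))" for y
    by (intro bounded_linear_compose[OF bounded_linear_of_real], unfold linear_conv_bounded_linear[symmetric], rule linearI)
      (auto simp: matrix_vector_mult_def sum.distrib algebra_simps sum_distrib_left)
  have "symb j I (\<lambda>i t. (v0 t)\<^sup>2) N (\<lambda>i t. norm (\<phi> (\<sigma> i) t *v x i)) (F 0)"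
  proof (rule symb_chain)
    fix i n assume n: "n < N"
    show "dir_deriv j (F n i) (F (Suc n) i)"
      using dir_deriv_bounded_linear[where a = 0, OF L[of "x i"] C_k_on_dir_deriv_iterate[OF C_\<phi> n]]
      by (simp add: F_def[abs_def])
  next
    fix i n assume "n \<le> N"
    then show "continuous_on UNIV (F n i)"
      unfolding F_def[abs_def] by (intro bounded_linear.continuous_on[OF L] C_k_on_continuous_iterate[OF C_\<phi>])
  next
    fix i n t assume n: "n \<le> N"
    show "norm (F n i t) \<le> ((v0 t)\<^sup>2) ^ n * norm (\<phi> (\<sigma> i) t *v x i)"
    proof (cases "n = 0")
      case True
      then show ?thesis using component_le_norm_cart by (simp add: F_def)
    next
      case False
      have "norm (F n i t) \<le> norm ((partial_deriv j ^^ n) (\<phi> (\<sigma> i)) t *v x i)"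
        using component_le_norm_cart by (simp add: F_def)
      also have "\<dots> \<le> v0 t * norm (x i)"
        using matrix_opnorm_vector \<phi>_deriv_opnorm[OF n] by (meson mult_right_mono norm_ge_zero order_trans)
      also have "\<dots> \<le> v0 t * (v0 t * norm (\<phi> (\<sigma> i) t *v x i))"
        using \<phi>_norm_ge v0_pos[of t] by (simp add: less_imp_le)
      also have "\<dots> = ((v0 t)\<^sup>2) ^ 1 * norm (\<phi> (\<sigma> i) t *v x i)" by (simp add: power2_eq_square)
      also have "\<dots> \<le> ((v0 t)\<^sup>2) ^ n * norm (\<phi> (\<sigma> i) t *v x i)"
        using False v0_ge1[of t] by (intro mult_right_mono power_increasing) (auto simp: one_le_power)
      finally show ?thesis .
    qed
  qed
  then show ?thesis by (simp add: F_def[abs_def])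
qed

lemma symb_\<phi>_entry:
  fixes \<sigma> :: "'i \<Rightarrow> real^'n::_"
  shows "symb j I (\<lambda>i t. (v0 t)\<^sup>2) N (\<lambda>i t. v0 t) (\<lambda>i t. of_real (\<phi> (\<sigma> i) t $ k $ l))"
proof -
  define F where "F n i t = complex_of_real ((partial_deriv j ^^ n) (\<phi> (\<sigma> i)) t $ k $ l)" for n i t
  have L: "bounded_linear (\<lambda>M::real^'n::_^'n::_. complex_of_real (M $ k $ l))"
    by (intro bounded_linear_compose[OF bounded_linear_of_real], unfold linear_conv_bounded_linear[symmetric], rule linearI)
      auto
  have "symb j I (\<lambda>i t. (v0 t)\<^sup>2) N (\<lambda>i t. v0 t) (F 0)"
  proof (rule symb_chain)
    fix i n assume n: "n < N"
    show "dir_deriv j (F n i) (F (Suc n) i)"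
      using dir_deriv_bounded_linear[where a = 0, OF L C_k_on_dir_deriv_iterate[OF C_\<phi> n]]
      by (simp add: F_def[abs_def])
  next
    fix i n assume "n \<le> N"
    then show "continuous_on UNIV (F n i)"
      unfolding F_def[abs_def] by (intro bounded_linear.continuous_on[OF L] C_k_on_continuous_iterate[OF C_\<phi>])
  next
    fix i n t assume n: "n \<le> N"
    have "norm (F n i t) \<le> v0 t"
      using order_trans[OF matrix_opnorm_component \<phi>_deriv_opnorm[OF n]] by (simp add: F_def)
    also have "\<dots> \<le> ((v0 t)\<^sup>2) ^ n * v0 t"
      using v0_ge1[of t] v0_pos[of t] by (simp add: one_le_power)
    finally show "norm (F n i t) \<le> ((v0 t)\<^sup>2) ^ n * v0 t" .
  qed
  then show ?thesis by (simp add: F_def[abs_def])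
qed

lemma symb_det_\<phi>:
  fixes \<sigma> :: "'i \<Rightarrow> real^'n::_"
  shows "symb j I (\<lambda>i t. (v0 t)\<^sup>2) N (\<lambda>i t. v0 t ^ CARD('n)) (\<lambda>i t. of_real (det (\<phi> (\<sigma> i) t)))"
proof -
  have "symb j I (\<lambda>i t. (v0 t)\<^sup>2) N (\<lambda>i t. v0 t ^ CARD('n))
      (\<lambda>i t. \<Sum>p | p permutes (UNIV::'n set). of_int (sign p) * (\<Prod>k\<in>UNIV. of_real (\<phi> (\<sigma> i) t $ k $ p k)))"
  proof (intro symb_sum symb_cmult)
    fix p
    show "symb j I (\<lambda>i t. (v0 t)\<^sup>2) N (\<lambda>i t. v0 t ^ CARD('n)) (\<lambda>i t. \<Prod>k\<in>UNIV. of_real (\<phi> (\<sigma> i) t $ k $ p k))"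
      (is "symb _ _ _ _ _ ?f")
    proof -
      have "symb j I (\<lambda>i t. (v0 t)\<^sup>2) N (\<lambda>i t. \<Prod>k\<in>(UNIV::'n set). v0 t) ?f"
        by (intro symb_prod symb_\<phi>_entry) auto
      then show ?thesis by simp
    qed
  qed (auto simp: finite_permutations less_imp_le v0_pos)
  then show ?thesis by (simp add: det_def)
qed

end

subsection \<open>Oscillatory integrals\<close>

text \<open>Sums over all directions, so that one majorant serves whichever direction is integrated
  by parts.\<close>

definition deriv_sum :: "nat \<Rightarrow> (real^'n::finite \<Rightarrow> complex) \<Rightarrow> real^'n \<Rightarrow> real" where
  "deriv_sum N \<theta> t = (\<Sum>j\<in>UNIV. \<Sum>n\<le>N. norm ((partial_deriv j ^^ n) \<theta> t))"

lemma deriv_sum_nonneg: "0 \<le> deriv_sum N \<theta> t"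
  unfolding deriv_sum_def by (intro sum_nonneg) auto

lemma norm_deriv_le_deriv_sum:
  assumes "n \<le> N"
  shows "norm ((partial_deriv j ^^ n) \<theta> t) \<le> deriv_sum N \<theta> t"
proof -
  have "norm ((partial_deriv j ^^ n) \<theta> t) \<le> (\<Sum>n\<le>N. norm ((partial_deriv j ^^ n) \<theta> t))"
    using assms by (intro member_le_sum) auto
  also have "\<dots> \<le> deriv_sum N \<theta> t"
    unfolding deriv_sum_def by (rule member_le_sum[of j]) (auto intro: sum_nonneg)
  finally show ?thesis .
qed

lemma norm_le_deriv_sum: "norm (\<theta> t) \<le> deriv_sum N \<theta> t"
  using norm_deriv_le_deriv_sum[of 0 N _ \<theta> t] by simp

lemma deriv_sum_cont: "C_k_on N \<theta> UNIV \<Longrightarrow> continuous_on UNIV (deriv_sum N \<theta>)"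
  unfolding deriv_sum_def by (intro continuous_intros C_k_on_continuous_iterate) auto

text \<open>\<open>L\<close> stands for the identity or for complex conjugation, and
  \<open>a\<close> for the shift of the second prototype.\<close>

lemma symb_deriv_sum:
  fixes \<theta> :: "'i \<Rightarrow> real^'n::finite \<Rightarrow> complex"
  assumes L: "bounded_linear L" "\<And>z. norm (L z) = norm (z :: complex)"
    and \<theta>: "\<And>i. i \<in> I \<Longrightarrow> C_k_on N (\<theta> i) UNIV" and \<kappa>: "\<And>i t. i \<in> I \<Longrightarrow> 1 \<le> \<kappa> i t"
  shows "symb j I \<kappa> N (\<lambda>i t. deriv_sum N (\<theta> i) (t + a i)) (\<lambda>i t. L (\<theta> i (t + a i)))"
proof -
  define F where "F n i t = L ((partial_deriv j ^^ n) (\<theta> i) (t + a i))" for n i t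
  have "symb j I \<kappa> N (\<lambda>i t. deriv_sum N (\<theta> i) (t + a i)) (F 0)"
  proof (rule symb_chain)
    fix i n assume "i \<in> I" "n < N"
    then show "dir_deriv j (F n i) (F (Suc n) i)"
      using dir_deriv_bounded_linear[where a = "a i", OF L(1) C_k_on_dir_deriv_iterate[OF \<theta>, of i n]]
      by (simp add: F_def[abs_def])
  next
    fix i n assume "i \<in> I" "n \<le> N"
    then show "continuous_on UNIV (F n i)"
      unfolding F_def[abs_def]
      by (intro bounded_linear.continuous_on[OF L(1)] continuous_on_compose2[OF C_k_on_continuous_iterate[OF \<theta>, of i n]]
          continuous_intros) auto
  next
    fix i n t assume i: "i \<in> I" "n \<le> N"
    have "norm (F n i t) \<le> deriv_sum N (\<theta> i) (t + a i)"
      using norm_deriv_le_deriv_sum[OF i(2)] by (simp add: F_def L(2))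
    also have "\<dots> \<le> \<kappa> i t ^ n * deriv_sum N (\<theta> i) (t + a i)"
      using \<kappa>[OF i(1), of t] deriv_sum_nonneg[of N "\<theta> i" "t + a i"]
        mult_right_mono[of 1 "\<kappa> i t ^ n" "deriv_sum N (\<theta> i) (t + a i)"] by (simp add: one_le_power)
    finally show "norm (F n i t) \<le> \<kappa> i t ^ n * deriv_sum N (\<theta> i) (t + a i)" .
  qed
  then show ?thesis by (simp add: F_def[abs_def])
qed

text \<open>The largest component satisfies
  \<open>(norm y)\<^sup>2 \<le> d * (y $ k0)\<^sup>2\<close>. This is the ellipticity that permits
  division by the sum of even powers of the gradient components.\<close>

lemma sum_even_power_ge:
  fixes y :: "real^'n::finite"
  shows "norm y ^ (2 * N) \<le> real CARD('n) ^ N * (\<Sum>k\<in>UNIV. (y $ k) ^ (2 * N))"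
proof -
  have "(norm y)\<^sup>2 = (\<Sum>k\<in>UNIV. (y $ k)\<^sup>2)"
    unfolding norm_vec_def L2_set_def by (simp add: sum_nonneg)
  define M where "M = Max (range (\<lambda>k. (y $ k)\<^sup>2))"
  have "M \<in> range (\<lambda>k. (y $ k)\<^sup>2)" unfolding M_def by (rule Max_in) auto
  then obtain k0 where k0: "M = (y $ k0)\<^sup>2" by auto
  have "(norm y)\<^sup>2 \<le> (\<Sum>k\<in>(UNIV::'n set). M)"
    unfolding \<open>(norm y)\<^sup>2 = _\<close> by (rule sum_mono) (auto simp: M_def)
  then have "(norm y)\<^sup>2 \<le> real CARD('n) * (y $ k0)\<^sup>2" by (simp add: k0)
  then have "((norm y)\<^sup>2) ^ N \<le> (real CARD('n) * (y $ k0)\<^sup>2) ^ N" by (intro power_mono) auto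
  also have "\<dots> = real CARD('n) ^ N * (y $ k0) ^ (2 * N)"
    by (simp add: power_mult_distrib power_mult)
  also have "\<dots> \<le> real CARD('n) ^ N * (\<Sum>k\<in>UNIV. (y $ k) ^ (2 * N))"
    by (intro mult_left_mono member_le_sum) (auto simp: power_mult)
  finally show ?thesis by (simp add: power_mult)
qed

context warping
begin

text \<open>The argument \<open>x\<close> is the rescaled displacement; the inverse transpose
  returns to the original one.\<close>

definition phase :: "real^'n::_ \<Rightarrow> real^'n::_ \<Rightarrow> real^'n::_ \<Rightarrow> complex" where
  "phase \<sigma> x t = cis (2 * pi * ((transpose (matrix_inv (A \<sigma>)) *v x) \<bullet> \<Psi> (t + \<sigma>)))"

text \<open>The gradient of \<open>y \<bullet> \<Psi> (t + \<sigma>)\<close> in \<open>t\<close> is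
  the transpose of \<open>A (t + \<sigma>)\<close> applied to \<open>y\<close>; with
  \<open>y\<close> the inverse transpose of \<open>A \<sigma>\<close> applied to \<open>x\<close>
  this is \<open>\<phi> \<sigma> t *v x\<close>. So the hypothesis on \<open>E\<close> in
  \<open>symb_ibp\<close> holds with \<open>c = 2 * pi * \<i>\<close>.\<close>

lemma dir_deriv_phase:
  "dir_deriv j (phase \<sigma> x) (\<lambda>t. (2 * pi * \<i>) * of_real ((\<phi> \<sigma> t *v x) $ j) * phase \<sigma> x t)"
  unfolding dir_deriv_def
proof
  fix t
  let ?y = "transpose (matrix_inv (A \<sigma>)) *v x"
  have "((\<lambda>s. \<Psi> (t + s *\<^sub>R axis j 1 + \<sigma>)) has_derivative (\<lambda>s. A (t + \<sigma>) *v (s *\<^sub>R axis j 1))) (at 0)"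
    by (rule has_derivative_compose[where f="\<lambda>s. t + s *\<^sub>R axis j 1 + \<sigma>" and g=\<Psi>])
      (auto intro!: derivative_eq_intros \<Psi>_deriv)
  then have "((\<lambda>s. 2 * pi * (?y \<bullet> \<Psi> (t + s *\<^sub>R axis j 1 + \<sigma>))) has_derivative
      (\<lambda>s. 2 * pi * (?y \<bullet> (A (t + \<sigma>) *v (s *\<^sub>R axis j 1))))) (at 0)"
    by (auto intro!: derivative_eq_intros)
  also have "(\<lambda>s. 2 * pi * (?y \<bullet> (A (t + \<sigma>) *v (s *\<^sub>R axis j 1)))) = (*) (2 * pi * (\<phi> \<sigma> t *v x) $ j)"
  proof
    fix s :: real
    have "?y \<bullet> (A (t + \<sigma>) *v axis j 1) = (transpose (A (t + \<sigma>)) *v ?y) \<bullet> axis j 1"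
      by (simp add: dot_lmul_matrix)
    also have "\<dots> = (\<phi> \<sigma> t *v x) $ j"
      by (simp only: warp_phi_def matrix_vector_mul_assoc inner_axis inner_real_def mult_1_right)
    finally show "2 * pi * (?y \<bullet> (A (t + \<sigma>) *v (s *\<^sub>R axis j 1))) = 2 * pi * (\<phi> \<sigma> t *v x) $ j * s"
      by (simp add: matrix_vector_mult_scaleR)
  qed
  finally have "((\<lambda>s. 2 * pi * (?y \<bullet> \<Psi> (t + s *\<^sub>R axis j 1 + \<sigma>))) has_real_derivative
      2 * pi * (\<phi> \<sigma> t *v x) $ j) (at 0)"
    by (simp add: has_field_derivative_def)
  then have d: "((\<lambda>s. complex_of_real (2 * pi * (?y \<bullet> \<Psi> (t + s *\<^sub>R axis j 1 + \<sigma>)))) has_vector_derivative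
      of_real (2 * pi * (\<phi> \<sigma> t *v x) $ j)) (at 0)"
    by (intro has_vector_derivative_of_real) (simp add: has_real_derivative_iff_has_vector_derivative)
  have "((\<lambda>z. exp (\<i> * z)) \<circ> (\<lambda>s. complex_of_real (2 * pi * (?y \<bullet> \<Psi> (t + s *\<^sub>R axis j 1 + \<sigma>)))) has_vector_derivative
      of_real (2 * pi * (\<phi> \<sigma> t *v x) $ j) * (\<i> * exp (\<i> * complex_of_real (2 * pi * (?y \<bullet> \<Psi> (t + 0 *\<^sub>R axis j 1 + \<sigma>)))))) (at 0)"
    by (rule field_vector_diff_chain_at[OF d]) (auto intro!: derivative_eq_intros)
  then show "((\<lambda>s. phase \<sigma> x (t + s *\<^sub>R axis j 1)) has_vector_derivative
      (2 * pi * \<i>) * of_real ((\<phi> \<sigma> t *v x) $ j) * phase \<sigma> x t) (at 0)"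
    by (simp only: o_def phase_def cis_conv_exp scaleR_zero_left add_0_right of_real_mult of_real_numeral mult_ac)
qed

lemma phase_cont: "continuous_on UNIV (phase \<sigma> x)"
  unfolding phase_def[abs_def] by (intro continuous_intros continuous_on_compose2[OF \<Psi>_cont]) auto

lemma norm_phase [simp]: "norm (phase \<sigma> x t) = 1"
  by (simp add: phase_def)

text \<open>
  In the region where the coordinate \<open>j\<close> of the phase gradient dominates, only derivatives in
  direction \<open>j\<close> are moved to the amplitude; the cut-off to this region is \<open>\<rho> j ^ (2 N) / S\<close>,
  whose zero of order \<open>2 N\<close> compensates for the divisions by \<open>\<rho> j\<close>.
\<close>
lemma oscillatory_decay:
  "\<exists>C\<ge>0. \<forall>\<sigma> x h \<theta>1 \<theta>2. C_k_on N \<theta>1 UNIV \<longrightarrow> C_k_on N \<theta>2 UNIV \<longrightarrow> x \<noteq> 0 \<longrightarrow>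
     integrable lborel (\<lambda>t. v0 t ^ (CARD('n) + 3 * N) * (deriv_sum N \<theta>2 (t - h) * deriv_sum N \<theta>1 t)) \<longrightarrow>
     norm (LINT t|lborel. of_real (det (\<phi> \<sigma> t)) * (\<theta>2 (t - h) * cnj (\<theta>1 t)) * phase \<sigma> x t) * norm x ^ N
       \<le> C * (LINT t|lborel. v0 t ^ (CARD('n) + 3 * N) * (deriv_sum N \<theta>2 (t - h) * deriv_sum N \<theta>1 t))"
proof -
  \<comment> \<open>Everything of which the constant must be independent is packed into the
    parameter of the symbol class.\<close>
  define I :: "((real^'n::_) \<times> (real^'n::_) \<times> (real^'n::_) \<times> (real^'n::_ \<Rightarrow> complex) \<times> (real^'n::_ \<Rightarrow> complex)) set"
    where "I = {(\<sigma>, x, h, \<theta>1, \<theta>2). x \<noteq> 0 \<and> C_k_on N \<theta>1 UNIV \<and> C_k_on N \<theta>2 UNIV}"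
  define sg where "sg i = fst i" for i :: "(real^'n::_) \<times> (real^'n::_) \<times> (real^'n::_) \<times> (real^'n::_ \<Rightarrow> complex) \<times> (real^'n::_ \<Rightarrow> complex)"
  define xx where "xx i = fst (snd i)" for i :: "(real^'n::_) \<times> (real^'n::_) \<times> (real^'n::_) \<times> (real^'n::_ \<Rightarrow> complex) \<times> (real^'n::_ \<Rightarrow> complex)"
  define hh where "hh i = fst (snd (snd i))" for i :: "(real^'n::_) \<times> (real^'n::_) \<times> (real^'n::_) \<times> (real^'n::_ \<Rightarrow> complex) \<times> (real^'n::_ \<Rightarrow> complex)"
  define t1 where "t1 i = fst (snd (snd (snd i)))" for i :: "(real^'n::_) \<times> (real^'n::_) \<times> (real^'n::_) \<times> (real^'n::_ \<Rightarrow> complex) \<times> (real^'n::_ \<Rightarrow> complex)"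
  define t2 where "t2 i = snd (snd (snd (snd i)))" for i :: "(real^'n::_) \<times> (real^'n::_) \<times> (real^'n::_) \<times> (real^'n::_ \<Rightarrow> complex) \<times> (real^'n::_ \<Rightarrow> complex)"
  note cdefs = sg_def xx_def hh_def t1_def t2_def
  have I: "xx i \<noteq> 0" "C_k_on N (t1 i) UNIV" "C_k_on N (t2 i) UNIV" if "i \<in> I" for i
    using that by (auto simp: I_def cdefs)
  define \<rho> where "\<rho> = (\<lambda>j i t. complex_of_real ((\<phi> (sg i) t *v xx i) $ j))"
  define r where "r = (\<lambda>i t. norm (\<phi> (sg i) t *v xx i))"
  define S where "S = (\<lambda>i t. \<Sum>k\<in>UNIV. \<rho> k i t ^ (2 * N))"
  define \<kappa> where "\<kappa> = (\<lambda>(i :: (real^'n::_) \<times> (real^'n::_) \<times> (real^'n::_) \<times> (real^'n::_ \<Rightarrow> complex) \<times> (real^'n::_ \<Rightarrow> complex)) t. (v0 t)\<^sup>2)"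
  define P where "P = (\<lambda>i t. deriv_sum N (t2 i) (t - hh i) * deriv_sum N (t1 i) t)"
  define a where "a = (\<lambda>i t. of_real (det (\<phi> (sg i) t)) * (t2 i (t - hh i) * cnj (t1 i t)))"
  \<comment> \<open>The amplitude divided by the denominator of the cut-offs; the numerators
    \<open>\<rho> j ^ (2 * N)\<close> are the powers that \<open>symb_ibp\<close> consumes.\<close>
  define g where "g = (\<lambda>i t. inverse (S i t) * a i t)"
  define b where "b = (\<lambda>i t. inverse (r i t ^ (2 * N)) * (v0 t ^ CARD('n) * P i t))"
  define E where "E = (\<lambda>i. phase (sg i) (xx i))"
  define W where "W = (\<lambda>i t. v0 t ^ (CARD('n) + 3 * N) * P i t)"
  have \<kappa>1: "1 \<le> \<kappa> i t" for i t
    using v0_ge1[of t] by (simp add: \<kappa>_def one_le_power)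
  then have \<kappa>0: "0 \<le> \<kappa> i t" for i t by (rule order_trans[OF zero_le_one])
  have P0: "0 \<le> P i t" for i t by (simp add: P_def deriv_sum_nonneg)
  have rge: "norm (xx i) \<le> v0 t * r i t" for i t
    unfolding r_def by (rule \<phi>_norm_ge)
  have rpos: "0 < r i t" if "i \<in> I" for i t
  proof -
    have "0 < v0 t * r i t" using rge[of i t] I(1)[OF that] by (smt (verit) zero_less_norm_iff)
    then show ?thesis using v0_pos[of t] by (simp add: zero_less_mult_iff)
  qed
  have s\<rho>: "symb j I \<kappa> N r (\<rho> k)" for j k
    unfolding \<kappa>_def r_def \<rho>_def by (rule symb_\<phi>_vector)
  have sS: "symb j I \<kappa> N (\<lambda>i t. r i t ^ (2 * N)) S" for j
    unfolding S_def by (intro symb_sum symb_power s\<rho>) (auto simp: \<kappa>0 r_def)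
  have S_eq: "S i t = of_real (\<Sum>k\<in>UNIV. ((\<phi> (sg i) t *v xx i) $ k) ^ (2 * N))" for i t
    by (simp add: S_def \<rho>_def)
  have S_ge: "inverse (real CARD('n) ^ N) * r i t ^ (2 * N) \<le> norm (S i t)" for i t
  proof -
    have "r i t ^ (2 * N) \<le> real CARD('n) ^ N * (\<Sum>k\<in>UNIV. ((\<phi> (sg i) t *v xx i) $ k) ^ (2 * N))"
      unfolding r_def by (rule sum_even_power_ge)
    also have "\<dots> \<le> real CARD('n) ^ N * norm (S i t)"
      unfolding S_eq norm_of_real by (intro mult_left_mono) auto
    finally show ?thesis by (simp add: field_simps)
  qed
  have sa: "symb j I \<kappa> N (\<lambda>i t. v0 t ^ CARD('n) * P i t) a" for j
    unfolding a_def P_def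
  proof (intro symb_mult)
    show "symb j I \<kappa> N (\<lambda>i t. v0 t ^ CARD('n)) (\<lambda>i t. of_real (det (\<phi> (sg i) t)))"
      unfolding \<kappa>_def by (rule symb_det_\<phi>)
    show "symb j I \<kappa> N (\<lambda>i t. deriv_sum N (t2 i) (t - hh i)) (\<lambda>i t. t2 i (t - hh i))"
      using symb_deriv_sum[of "\<lambda>z. z" I N t2 \<kappa> j "\<lambda>i. - hh i"] I \<kappa>1 by (simp add: bounded_linear_ident)
    show "symb j I \<kappa> N (\<lambda>i. deriv_sum N (t1 i)) (\<lambda>i t. cnj (t1 i t))"
      using symb_deriv_sum[of cnj I N t1 \<kappa> j "\<lambda>i. 0"] I \<kappa>1 by (simp add: bounded_linear_cnj)
  qed
  have sg: "symb j I \<kappa> N b g" for j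
    unfolding b_def g_def
    by (intro symb_mult sa symb_inverse[OF sS, of "inverse (real CARD('n) ^ N)"]) (auto simp: S_ge rpos \<kappa>0)
  have E': "dir_deriv j (E i) (\<lambda>t. (2 * pi * \<i>) * \<rho> j i t * E i t)" for i j
    unfolding E_def \<rho>_def by (rule dir_deriv_phase)
  \<comment> \<open>One application of \<open>symb_ibp\<close> per direction. Naming the conclusion
    allows a choice of the resulting amplitude families over the finitely many directions before
    constants are extracted.\<close>
  define Q where "Q = (\<lambda>j h. symb j I \<kappa> 0 (\<lambda>i t. (\<kappa> i t * r i t) ^ N * b i t) h \<and>
    (\<forall>i\<in>I. (\<forall>l\<le>N. integrable lborel (\<lambda>t. \<kappa> i t ^ l * r i t ^ (2 * N - l) * b i t)) \<longrightarrow>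
       (\<forall>l<N. integrable lborel (\<lambda>t. \<kappa> i t ^ l * r i t ^ (2 * N - l - 1) * b i t)) \<longrightarrow>
       (LINT t|lborel. \<rho> j i t ^ (2 * N) * g i t * E i t) = (- 1 / (2 * pi * \<i>)) ^ N * (LINT t|lborel. h i t * E i t)))"
  have "\<exists>h. Q j h" for j
    unfolding Q_def by (rule symb_ibp[OF s\<rho> sg \<kappa>0 _ _ E']) (simp_all add: E_def phase_cont)
  then have "\<exists>H. \<forall>j. Q j (H j)" by (intro choice allI)
  then obtain H where Q: "\<And>j. Q j (H j)" by blast
  have H: "symb j I \<kappa> 0 (\<lambda>i t. (\<kappa> i t * r i t) ^ N * b i t) (H j)" for j
    using Q[of j] by (simp only: Q_def)
  have HI: "(LINT t|lborel. \<rho> j i t ^ (2 * N) * g i t * E i t) = (- 1 / (2 * pi * \<i>)) ^ N * (LINT t|lborel. H j i t * E i t)"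
    if "i \<in> I" "\<And>l. l\<le>N \<Longrightarrow> integrable lborel (\<lambda>t. \<kappa> i t ^ l * r i t ^ (2 * N - l) * b i t)"
       "\<And>l. l<N \<Longrightarrow> integrable lborel (\<lambda>t. \<kappa> i t ^ l * r i t ^ (2 * N - l - 1) * b i t)" for i j
    using Q[of j] that unfolding Q_def by blast
  have "\<forall>j. \<exists>C\<ge>0. \<forall>i\<in>I. continuous_on UNIV (H j i) \<and> (\<forall>t. norm (H j i t) \<le> C * ((\<kappa> i t * r i t) ^ N * b i t))"
    using H unfolding symb.simps by blast
  then obtain C where C: "\<And>j. C j \<ge> 0" "\<And>j i. i \<in> I \<Longrightarrow> continuous_on UNIV (H j i)"
    "\<And>j i t. i \<in> I \<Longrightarrow> norm (H j i t) \<le> C j * ((\<kappa> i t * r i t) ^ N * b i t)"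
    by metis
  \<comment> \<open>\<open>\<kappa> ^ l\<close> costs \<open>v0 t ^ (2 * l)\<close>, and
    \<open>k\<close> missing powers of \<open>r\<close> cost
    \<open>(v0 t / norm (xx i)) ^ k\<close>. Enlarging both exponents to \<open>N\<close> gives the
    single majorant \<open>W\<close>. The cases \<open>k = l\<close> and \<open>k = Suc l\<close>
    are the two integrability conditions of \<open>symb_ibp\<close>; \<open>l = k = N\<close> is the
    final bound.\<close>
  have key: "\<kappa> i t ^ l * r i t ^ (2 * N - k) * b i t * norm (xx i) ^ k \<le> W i t" if i: "i \<in> I" and "l \<le> k" "k \<le> N" for i t l k
  proof -
    have "r i t ^ (2 * N) = r i t ^ (2 * N - k) * r i t ^ k"
      using \<open>k \<le> N\<close> by (simp flip: power_add)
    then have "\<kappa> i t ^ l * r i t ^ (2 * N - k) * b i t * norm (xx i) ^ k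
        = v0 t ^ (2 * l) * (norm (xx i) / r i t) ^ k * v0 t ^ CARD('n) * P i t"
      using rpos[OF i, of t] by (simp add: b_def \<kappa>_def power_mult[of "v0 t" 2 l, symmetric] power_divide field_simps)
    also have "\<dots> \<le> v0 t ^ (2 * N) * v0 t ^ N * v0 t ^ CARD('n) * P i t"
    proof (intro mult_right_mono mult_mono)
      show "v0 t ^ (2 * l) \<le> v0 t ^ (2 * N)" using that v0_ge1[of t] by (intro power_increasing) auto
      have "(norm (xx i) / r i t) ^ k \<le> v0 t ^ k"
        using rpos[OF i, of t] rge[of i t] by (intro power_mono) (auto simp: field_simps)
      also have "\<dots> \<le> v0 t ^ N" using that v0_ge1[of t] by (intro power_increasing) auto
      finally show "(norm (xx i) / r i t) ^ k \<le> v0 t ^ N" .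
    qed (use rpos[OF i, of t] v0_pos[of t] P0 in auto)
    also have "\<dots> = W i t"
      by (simp add: W_def power_add power_mult mult_ac flip: power_mult_distrib)
         (simp add: power_mult [symmetric] power_add [symmetric] numeral_3_eq_3)
    finally show ?thesis .
  qed
  have rcont: "continuous_on UNIV (r i)" for i
    unfolding r_def by (intro continuous_intros continuous_on_norm) (auto intro!: continuous_intros \<phi>_cont continuous_on_subset[OF \<phi>_cont] simp: matrix_vector_mult_def)
  have Pcont: "continuous_on UNIV (P i)" if "i \<in> I" for i
    unfolding P_def
    by (intro continuous_intros continuous_on_compose2[OF deriv_sum_cont[OF I(3)[OF that]]] continuous_on_compose2[OF deriv_sum_cont[OF I(2)[OF that]]]) auto
  have bnn: "0 \<le> b i t" for i t
    using P0 v0_pos[of t] by (simp add: b_def r_def)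
  have int: "integrable lborel (\<lambda>t. \<kappa> i t ^ l * r i t ^ (2 * N - k) * b i t)"
    if i: "i \<in> I" "integrable lborel (W i)" "l \<le> k" "k \<le> N" for i l k
  proof (rule Bochner_Integration.integrable_bound)
    show "integrable lborel (\<lambda>t. inverse (norm (xx i) ^ k) * W i t)"
      using i(2) by simp
    have "r i t \<noteq> 0" for t using rpos[OF i(1), of t] by simp
    then have "continuous_on UNIV (\<lambda>t. \<kappa> i t ^ l * r i t ^ (2 * N - k) * b i t)"
      unfolding b_def \<kappa>_def by (intro continuous_intros rcont v0_cont Pcont[OF i(1)]) auto
    then show "(\<lambda>t. \<kappa> i t ^ l * r i t ^ (2 * N - k) * b i t) \<in> borel_measurable lborel"
      using borel_measurable_continuous_onI by simp
    have "\<kappa> i t ^ l * r i t ^ (2 * N - k) * b i t \<le> inverse (norm (xx i) ^ k) * W i t" for t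
      using key[OF i(1,3,4), of t] I(1)[OF i(1)] by (simp add: field_simps)
    moreover have "0 \<le> \<kappa> i t ^ l * r i t ^ (2 * N - k) * b i t" for t
      using bnn \<kappa>0 by (simp add: r_def)
    ultimately show "AE t in lborel. norm (\<kappa> i t ^ l * r i t ^ (2 * N - k) * b i t) \<le> norm (inverse (norm (xx i) ^ k) * W i t)"
      by (auto intro!: AE_I2 simp del: inverse_mult_distrib) (smt (verit))
  qed
  have bound: "norm (LINT t|lborel. a i t * E i t) * norm (xx i) ^ N \<le> (\<Sum>j\<in>UNIV. C j) * (LINT t|lborel. W i t)"
    if i: "i \<in> I" and W: "integrable lborel (W i)" for i
  proof -
    have nS: "S i t \<noteq> 0" for t
      using S_ge[of i t] rpos[OF i, of t] by (auto simp: field_simps) (smt (verit) zero_less_power)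
    \<comment> \<open>The cut-offs \<open>\<rho> j ^ (2 * N) / S\<close> add up to 1, so the
      splitting into directions is exact.\<close>
    have aE: "a i t * E i t = (\<Sum>j\<in>UNIV. \<rho> j i t ^ (2 * N) * g i t * E i t)" for t
    proof -
      have "(\<Sum>j\<in>UNIV. \<rho> j i t ^ (2 * N) * g i t * E i t) = S i t * g i t * E i t"
        by (simp only: S_def sum_distrib_right)
      then show ?thesis using nS[of t] by (simp add: g_def)
    qed
    have i\<rho>: "integrable lborel (\<lambda>t. \<rho> j i t ^ (2 * N) * g i t * E i t)" for j
    proof -
      obtain R where R: "R \<ge> 0" "continuous_on UNIV (\<rho> j i)" "\<And>x. norm (\<rho> j i x) \<le> R * r i x"
        using symb_0[OF s\<rho>[of j j]] i by (auto simp: symb.simps)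
      obtain G where G: "G \<ge> 0" "continuous_on UNIV (g i)" "\<And>x. norm (g i x) \<le> G * b i x"
        using symb_0[OF sg[of j]] i by (auto simp: symb.simps)
      show ?thesis
      proof (rule Bochner_Integration.integrable_bound)
        show "integrable lborel (\<lambda>t. R ^ (2 * N) * G * (r i t ^ (2 * N) * b i t))"
          using int[OF i W, of 0 0] by (intro integrable_mult_right) simp
        have "continuous_on UNIV (\<lambda>t. \<rho> j i t ^ (2 * N) * g i t * E i t)"
          unfolding E_def by (intro continuous_intros R(2) G(2) phase_cont)
        then show "(\<lambda>t. \<rho> j i t ^ (2 * N) * g i t * E i t) \<in> borel_measurable lborel"
          using borel_measurable_continuous_onI by simp
        have "norm (\<rho> j i t ^ (2 * N) * g i t * E i t) \<le> (R * r i t) ^ (2 * N) * (G * b i t)" for t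
          unfolding norm_mult norm_power using R G bnn[of i t]
          by (auto simp: E_def r_def intro!: mult_mono power_mono)
        then show "AE t in lborel. norm (\<rho> j i t ^ (2 * N) * g i t * E i t) \<le> norm (R ^ (2 * N) * G * (r i t ^ (2 * N) * b i t))"
          by (intro AE_I2 order_trans[OF _ abs_ge_self[THEN order_trans, OF eq_refl[OF real_norm_def[symmetric]]]]) (simp add: power_mult_distrib mult_ac)
      qed
    qed
    have Hb: "norm (LINT t|lborel. H j i t * E i t) * norm (xx i) ^ N \<le> C j * (LINT t|lborel. W i t)" for j
    proof -
      \<comment> \<open>The power of \<open>norm (xx i)\<close> is moved under the integral so that
        \<open>key\<close> applies pointwise.\<close>
      have "norm (LINT t|lborel. norm (xx i) ^ N *\<^sub>R (H j i t * E i t)) \<le> (LINT t|lborel. C j * W i t)"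
      proof (rule Bochner_Integration.integral_norm_bound_integral)
        have nb: "norm (norm (xx i) ^ N *\<^sub>R (H j i t * E i t)) \<le> C j * W i t" for t
        proof -
          have "norm (norm (xx i) ^ N *\<^sub>R (H j i t * E i t)) = norm (H j i t) * norm (xx i) ^ N"
            by (simp add: norm_mult E_def mult_ac)
          also have "\<dots> \<le> C j * ((\<kappa> i t * r i t) ^ N * b i t) * norm (xx i) ^ N"
            by (intro mult_right_mono C i) auto
          also have "\<dots> = C j * (\<kappa> i t ^ N * r i t ^ (2 * N - N) * b i t * norm (xx i) ^ N)"
            by (simp add: power_mult_distrib mult_ac)
          also have "\<dots> \<le> C j * W i t" by (intro mult_left_mono C key i) auto
          finally show ?thesis .
        qed
        show "integrable lborel (\<lambda>t. C j * W i t)" using W by simp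
        then show "integrable lborel (\<lambda>t. norm (xx i) ^ N *\<^sub>R (H j i t * E i t))"
        proof (rule Bochner_Integration.integrable_bound)
          have "continuous_on UNIV (\<lambda>t. norm (xx i) ^ N *\<^sub>R (H j i t * E i t))"
            unfolding E_def by (intro continuous_intros C i phase_cont)
          then show "(\<lambda>t. norm (xx i) ^ N *\<^sub>R (H j i t * E i t)) \<in> borel_measurable lborel"
            using borel_measurable_continuous_onI by simp
        qed (use nb in \<open>auto intro!: AE_I2 intro: order_trans[OF _ abs_ge_self]\<close>)
        show "norm (norm (xx i) ^ N *\<^sub>R (H j i t * E i t)) \<le> C j * W i t" for t by (rule nb)
      qed
      then show ?thesis by (simp add: mult_ac)
    qed
    have Hj: "(LINT t|lborel. \<rho> j i t ^ (2 * N) * g i t * E i t) = (- 1 / (2 * pi * \<i>)) ^ N * (LINT t|lborel. H j i t * E i t)" for j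
    proof (rule HI[OF i])
      show "integrable lborel (\<lambda>t. \<kappa> i t ^ l * r i t ^ (2 * N - l - 1) * b i t)" if "l < N" for l
        using int[OF i W, of l "Suc l"] that by simp
    qed (rule int[OF i W order_refl])
    have "(LINT t|lborel. a i t * E i t) = (\<Sum>j\<in>UNIV. (- 1 / (2 * pi * \<i>)) ^ N * (LINT t|lborel. H j i t * E i t))"
      unfolding aE using i\<rho>
      by (subst Bochner_Integration.integral_sum) (simp_all only: Hj)
    also have "norm \<dots> \<le> (\<Sum>j\<in>UNIV. norm ((- 1 / (2 * pi * \<i>)) ^ N * (LINT t|lborel. H j i t * E i t)))"
      by (rule norm_sum)
    also have "\<dots> \<le> (\<Sum>j\<in>UNIV. norm (LINT t|lborel. H j i t * E i t))"
    proof (rule sum_mono)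
      fix j
      have "norm ((- 1 / (2 * pi * \<i>)) ^ N) \<le> 1"
        using pi_gt3 by (simp add: norm_power norm_divide norm_mult power_le_one)
      then show "norm ((- 1 / (2 * pi * \<i>)) ^ N * (LINT t|lborel. H j i t * E i t)) \<le> norm (LINT t|lborel. H j i t * E i t)"
        unfolding norm_mult by (rule mult_left_le_one_le[rotated 2]) auto
    qed
    finally have "norm (LINT t|lborel. a i t * E i t) * norm (xx i) ^ N \<le> (\<Sum>j\<in>UNIV. norm (LINT t|lborel. H j i t * E i t) * norm (xx i) ^ N)"
      by (subst sum_distrib_right[symmetric]) (rule mult_right_mono, auto)
    also have "\<dots> \<le> (\<Sum>j\<in>UNIV. C j * (LINT t|lborel. W i t))"
      by (intro sum_mono Hb)
    finally show ?thesis by (simp add: sum_distrib_right)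
  qed
  show ?thesis
  proof (intro exI[of _ "\<Sum>j\<in>UNIV. C j"] conjI allI impI)
    show "0 \<le> (\<Sum>j\<in>UNIV. C j)" by (intro sum_nonneg C)
    fix \<sigma> x h \<theta>1 \<theta>2
    assume "C_k_on N \<theta>1 UNIV" "C_k_on N \<theta>2 UNIV" "x \<noteq> (0 :: real^'n::_)"
      and *: "integrable lborel (\<lambda>t. v0 t ^ (CARD('n) + 3 * N) * (deriv_sum N \<theta>2 (t - h) * deriv_sum N \<theta>1 t))"
    then have "(\<sigma>, x, h, \<theta>1, \<theta>2) \<in> I" by (simp add: I_def)
    from bound[OF this] * show "norm (LINT t|lborel. of_real (det (\<phi> \<sigma> t)) * (\<theta>2 (t - h) * cnj (\<theta>1 t)) * phase \<sigma> x t) * norm x ^ N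
       \<le> (\<Sum>j\<in>UNIV. C j) * (LINT t|lborel. v0 t ^ (CARD('n) + 3 * N) * (deriv_sum N \<theta>2 (t - h) * deriv_sum N \<theta>1 t))"
      by (simp add: W_def P_def a_def E_def cdefs)
  qed
qed

end

context warping
begin

text \<open>The bound without oscillation. The exponent of \<open>v0\<close> is raised to match the
  majorant of \<open>oscillatory_decay\<close>, so both regimes of \<open>x\<close> end with the
  same integral.\<close>

lemma norm_det_prototypes_le:
  "norm (of_real (det (\<phi> \<sigma> t)) * (\<theta>2 (t - h) * cnj (\<theta>1 t)) * phase \<sigma> x t)
     \<le> fact CARD('n) * (v0 t ^ (CARD('n) + 3 * N) * (deriv_sum N \<theta>2 (t - h) * deriv_sum N \<theta>1 t))"
proof -
  have "det (\<phi> \<sigma> t) \<le> fact CARD('n) * v0 t ^ CARD('n)" by (rule det_\<phi>_le)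
  also have "\<dots> \<le> fact CARD('n) * v0 t ^ (CARD('n) + 3 * N)"
    using v0_ge1[of t] by (intro mult_left_mono power_increasing) auto
  finally have "det (\<phi> \<sigma> t) \<le> fact CARD('n) * v0 t ^ (CARD('n) + 3 * N)" .
  moreover have "norm (\<theta>2 (t - h)) * norm (\<theta>1 t) \<le> deriv_sum N \<theta>2 (t - h) * deriv_sum N \<theta>1 t"
    by (intro mult_mono norm_le_deriv_sum deriv_sum_nonneg) auto
  ultimately have "det (\<phi> \<sigma> t) * (norm (\<theta>2 (t - h)) * norm (\<theta>1 t))
      \<le> (fact CARD('n) * v0 t ^ (CARD('n) + 3 * N)) * (deriv_sum N \<theta>2 (t - h) * deriv_sum N \<theta>1 t)"
    using v0_pos[of t] by - (rule mult_mono, auto simp: less_imp_le)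
  then show ?thesis
    using det_\<phi>_pos[of \<sigma> t] by (simp add: norm_mult mult_ac)
qed

text \<open>Decay for large \<open>x\<close> and the trivial bound for small \<open>x\<close>
  combine to \<open>1 + norm x\<close>. The right side is a nonnegative integral, so that the
  estimate makes sense before integrability for a particular \<open>h\<close> is known.\<close>

lemma oscillatory_uniform:
  "\<exists>C>0. \<forall>\<sigma> x h \<theta>1 \<theta>2. C_k_on N \<theta>1 UNIV \<longrightarrow> C_k_on N \<theta>2 UNIV \<longrightarrow>
     ennreal (norm (LINT t|lborel. of_real (det (\<phi> \<sigma> t)) * (\<theta>2 (t - h) * cnj (\<theta>1 t)) * phase \<sigma> x t) * (1 + norm x) ^ N)
       \<le> ennreal C * (\<integral>\<^sup>+t. ennreal (v0 t ^ (CARD('n) + 3 * N) * (deriv_sum N \<theta>2 (t - h) * deriv_sum N \<theta>1 t)) \<partial>lborel)"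
proof -
  obtain C where C0: "C \<ge> 0" and C: "\<And>\<sigma> x h \<theta>1 \<theta>2. C_k_on N \<theta>1 UNIV \<Longrightarrow> C_k_on N \<theta>2 UNIV \<Longrightarrow> x \<noteq> 0 \<Longrightarrow>
     integrable lborel (\<lambda>t. v0 t ^ (CARD('n) + 3 * N) * (deriv_sum N \<theta>2 (t - h) * deriv_sum N \<theta>1 t)) \<Longrightarrow>
     norm (LINT t|lborel. of_real (det (\<phi> \<sigma> t)) * (\<theta>2 (t - h) * cnj (\<theta>1 t)) * phase \<sigma> x t) * norm x ^ N
       \<le> C * (LINT t|lborel. v0 t ^ (CARD('n) + 3 * N) * (deriv_sum N \<theta>2 (t - h) * deriv_sum N \<theta>1 t))"
    using oscillatory_decay by blast
  \<comment> \<open>\<open>2 ^ N\<close> comes from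
    \<open>1 + norm x \<le> 2 * max 1 (norm x)\<close>; the sum covers both regimes and is positive
    even if \<open>C = 0\<close>.\<close>
  define C' where "C' = 2 ^ N * (C + fact CARD('n))"
  have C'pos: "C' > 0" using C0 by (simp add: C'_def add_nonneg_pos)
  show ?thesis
  proof (intro exI[of _ C'] conjI C'pos allI impI)
    fix \<sigma> x h \<theta>1 \<theta>2
    assume \<theta>: "C_k_on N (\<theta>1 :: real^'n::_ \<Rightarrow> complex) UNIV" "C_k_on N (\<theta>2 :: real^'n::_ \<Rightarrow> complex) UNIV"
    define W where "W t = v0 t ^ (CARD('n) + 3 * N) * (deriv_sum N \<theta>2 (t - h) * deriv_sum N \<theta>1 t)" for t
    define a where "a t = of_real (det (\<phi> \<sigma> t)) * (\<theta>2 (t - h) * cnj (\<theta>1 t)) * phase \<sigma> x t" for t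
    have W0: "0 \<le> W t" for t
      using v0_pos[of t] by (simp add: W_def deriv_sum_nonneg)
    have Wc: "continuous_on UNIV W"
      unfolding W_def
      by (intro continuous_intros v0_cont continuous_on_compose2[OF deriv_sum_cont[OF \<theta>(2)]] deriv_sum_cont[OF \<theta>(1)]) auto
    have "ennreal (norm (LINT t|lborel. a t) * (1 + norm x) ^ N) \<le> ennreal C' * (\<integral>\<^sup>+t. ennreal (W t) \<partial>lborel)"
    proof (cases "(\<integral>\<^sup>+t. ennreal (W t) \<partial>lborel) = \<infinity>")
      case True
      then show ?thesis using C'pos by (simp add: ennreal_mult_top)
    next
      case False
      have iW: "integrable lborel W"
        using False W0 borel_measurable_continuous_onI[OF Wc] by (intro integrableI_nonneg) (auto simp: top.not_eq_extremum)
      have nn: "(\<integral>\<^sup>+t. ennreal (W t) \<partial>lborel) = ennreal (LINT t|lborel. W t)"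
        using iW W0 by (intro nn_integral_eq_integral) auto
      have ac: "continuous_on UNIV a"
        unfolding a_def det_def
        by (intro continuous_intros phase_cont \<phi>_cont continuous_on_compose2[OF C_k_on_continuous[OF \<theta>(2)]]
            C_k_on_continuous[OF \<theta>(1)]) auto
      have na: "norm (a t) \<le> fact CARD('n) * W t" for t
        unfolding a_def W_def by (rule norm_det_prototypes_le)
      have ia: "integrable lborel a"
      proof (rule Bochner_Integration.integrable_bound)
        show "integrable lborel (\<lambda>t. fact CARD('n) * W t)" using iW by simp
      qed (use borel_measurable_continuous_onI[OF ac] na in \<open>auto intro!: AE_I2 intro: order_trans[OF _ abs_ge_self]\<close>)
      have triv: "norm (LINT t|lborel. a t) \<le> fact CARD('n) * (LINT t|lborel. W t)"
        using Bochner_Integration.integral_norm_bound_integral[OF ia _ na] iW by simp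
      have LW: "0 \<le> (LINT t|lborel. W t)" using W0 by (rule Bochner_Integration.integral_nonneg)
      have "norm (LINT t|lborel. a t) * (1 + norm x) ^ N \<le> C' * (LINT t|lborel. W t)"
      proof (cases "norm x \<le> 1")
        case True
        have "(1 + norm x) ^ N \<le> 2 ^ N" using True by (intro power_mono) auto
        then have "norm (LINT t|lborel. a t) * (1 + norm x) ^ N \<le> (fact CARD('n) * (LINT t|lborel. W t)) * 2 ^ N"
          using LW by (intro mult_mono triv) auto
        also have "\<dots> \<le> C' * (LINT t|lborel. W t)"
          using C0 LW by (simp add: C'_def algebra_simps)
        finally show ?thesis .
      next
        case False
        then have x: "x \<noteq> 0" by auto
        have "(1 + norm x) ^ N \<le> (2 * norm x) ^ N" using False by (intro power_mono) auto
        then have "norm (LINT t|lborel. a t) * (1 + norm x) ^ N \<le> 2 ^ N * (norm (LINT t|lborel. a t) * norm x ^ N)"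
          by (simp add: power_mult_distrib mult.left_commute mult_left_mono)
        also have "\<dots> \<le> 2 ^ N * (C * (LINT t|lborel. W t))"
          using C[OF \<theta> x, of h \<sigma>] iW unfolding W_def[symmetric] a_def[symmetric] by (intro mult_left_mono) auto
        also have "\<dots> \<le> C' * (LINT t|lborel. W t)"
          using LW by (simp add: C'_def algebra_simps)
        finally show ?thesis .
      qed
      then show ?thesis unfolding nn using C'pos by (simp add: ennreal_mult'[symmetric] ennreal_leI)
    qed
    then show "ennreal (norm (LINT t|lborel. of_real (det (\<phi> \<sigma> t)) * (\<theta>2 (t - h) * cnj (\<theta>1 t)) * phase \<sigma> x t) * (1 + norm x) ^ N)
       \<le> ennreal C' * (\<integral>\<^sup>+t. ennreal (v0 t ^ (CARD('n) + 3 * N) * (deriv_sum N \<theta>2 (t - h) * deriv_sum N \<theta>1 t)) \<partial>lborel)"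
      by (simp add: a_def[abs_def] W_def[abs_def])
  qed
qed

end

subsection \<open>Change of variables for measures\<close>

lemma distr_diffeo:
  fixes g :: "real^'n::{finite,wellorder} \<Rightarrow> real^'n::_" and J :: "real^'n::_ \<Rightarrow> real^'n::_^'n::_"
  assumes der: "\<And>x. (g has_derivative (\<lambda>h. J x *v h)) (at x)" and inj: "inj g"
    and J: "continuous_on UNIV J" and ran: "range g \<in> sets borel"
  shows "density lborel (indicator (range g)) = distr (density lborel (\<lambda>x. ennreal \<bar>det (J x)\<bar>)) borel g"
proof (rule measure_eqI)
  have gc: "continuous_on UNIV g"
    using der by (auto intro!: continuous_at_imp_continuous_on has_derivative_continuous)
  have mg[measurable]: "g \<in> borel_measurable borel"
    by (rule borel_measurable_continuous_onI[OF gc])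
  have "continuous_on UNIV (\<lambda>x. \<bar>det (J x)\<bar>)"
    unfolding det_def by (intro continuous_intros J)
  then have mJ[measurable]: "(\<lambda>x. \<bar>det (J x)\<bar>) \<in> borel_measurable borel"
    by (rule borel_measurable_continuous_onI)
  fix B assume "B \<in> sets (density lborel (indicator (range g) :: _ \<Rightarrow> ennreal))"
  then have B[measurable]: "B \<in> sets borel" by simp
  define S where "S = g -` B"
  have S[measurable]: "S \<in> sets borel"
    using measurable_sets[OF mg B] by (simp add: S_def)
  have gS: "g ` S = B \<inter> range g" by (auto simp: S_def)
  have im: "g ` S \<in> sets borel" unfolding gS using B ran by auto
  have dS: "\<And>x. x \<in> S \<Longrightarrow> (g has_derivative (\<lambda>h. J x *v h)) (at x within S)"
    using der has_derivative_at_withinI by blast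
  have "inj_on g S" using inj by (rule inj_on_subset) auto
  note im_iff = has_measure_differentiable_image[OF _ dS this, simplified matrix_of_matrix_vector_mul]
  have Sl: "S \<in> sets lebesgue" using S by (simp add: sets_completionI_sets)
  have nnS: "(\<integral>\<^sup>+x. ennreal \<bar>det (J x)\<bar> * indicator S x \<partial>lborel) = ennreal m"
    if "((\<lambda>x. \<bar>det (J x)\<bar>) has_integral m) S" for m
  proof -
    have "((\<lambda>x. indicator S x * \<bar>det (J x)\<bar>) has_integral m) UNIV"
    proof -
      have "(\<lambda>x. indicator S x * \<bar>det (J x)\<bar>) = (\<lambda>x. if x \<in> S then \<bar>det (J x)\<bar> else 0)"
        by (auto simp: indicator_def fun_eq_iff)
      then show ?thesis using that has_integral_restrict_UNIV[of S "\<lambda>x. \<bar>det (J x)\<bar>" m] by simp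
    qed
    then have "(\<integral>\<^sup>+x. ennreal (indicator S x * \<bar>det (J x)\<bar>) \<partial>lborel) = ennreal m"
      by (intro nn_integral_has_integral_lborel) auto
    then show ?thesis by (simp add: ennreal_mult' ennreal_indicator mult.commute)
  qed
  have "emeasure lborel (g ` S) = (\<integral>\<^sup>+x. ennreal \<bar>det (J x)\<bar> * indicator S x \<partial>lborel)"
  \<comment> \<open>\<open>im_iff\<close> is an equivalence between finite quantities. If the
    integral is infinite, a finite measure of the image would contradict it; otherwise it gives the
    value.\<close>
  proof (cases "(\<integral>\<^sup>+x. ennreal \<bar>det (J x)\<bar> * indicator S x \<partial>lborel) = \<infinity>")
    case True
    show ?thesis
    proof (rule ccontr)
      assume "emeasure lborel (g ` S) \<noteq> (\<integral>\<^sup>+x. ennreal \<bar>det (J x)\<bar> * indicator S x \<partial>lborel)"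
      then have "g ` S \<in> lmeasurable"
        using True im by (auto simp: fmeasurable_def top.not_eq_extremum emeasure_completion main_part_sets sets_completionI_sets)
      then have hi: "((\<lambda>x. \<bar>det (J x)\<bar>) has_integral measure lebesgue (g ` S)) S"
        using im_iff[OF Sl] by blast
      then show False using True nnS[OF hi] by simp
    qed
  next
    case False
    have "integrable lborel (\<lambda>x. indicator S x *\<^sub>R \<bar>det (J x)\<bar>)"
    proof (rule integrableI_nonneg)
      show "(\<integral>\<^sup>+ x. ennreal (indicator S x *\<^sub>R \<bar>det (J x)\<bar>) \<partial>lborel) < \<infinity>"
        using False by (simp add: ennreal_mult' ennreal_indicator mult.commute top.not_eq_extremum)
    qed auto
    then have si: "set_integrable lborel S (\<lambda>x. \<bar>det (J x)\<bar>)"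
      by (simp add: set_integrable_def)
    define m where "m = integral S (\<lambda>x. \<bar>det (J x)\<bar>)"
    have hi: "((\<lambda>x. \<bar>det (J x)\<bar>) has_integral m) S"
      unfolding m_def using set_borel_integral_eq_integral(1)[OF si] by (rule integrable_integral)
    then have "g ` S \<in> lmeasurable" "measure lebesgue (g ` S) = m"
      using im_iff[OF Sl] by blast+
    then have "emeasure lborel (g ` S) = ennreal m"
      using im emeasure_eq_measure2[of "g ` S" lebesgue] by (simp add: fmeasurable_def)
    then show ?thesis using nnS[OF hi] by simp
  qed
  moreover have "emeasure (density lborel (indicator (range g))) B = emeasure lborel (g ` S)"
  proof -
    have "emeasure (density lborel (indicator (range g))) B = (\<integral>\<^sup>+x. indicator (range g) x * indicator B x \<partial>lborel)"
      using ran B by (intro emeasure_density) auto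
    also have "\<dots> = emeasure lborel (range g \<inter> B)"
      unfolding indicator_inter_arith[symmetric] using ran B by (intro nn_integral_indicator) auto
    finally show ?thesis by (simp add: gS Int_commute)
  qed
  moreover have "emeasure (distr (density lborel (\<lambda>x. ennreal \<bar>det (J x)\<bar>)) borel g) B
      = (\<integral>\<^sup>+x. ennreal \<bar>det (J x)\<bar> * indicator S x \<partial>lborel)"
    using B S by (subst emeasure_distr) (auto simp: S_def emeasure_density)
  ultimately show "emeasure (density lborel (indicator (range g))) B = emeasure (distr (density lborel (\<lambda>x. ennreal \<bar>det (J x)\<bar>)) borel g) B"
    by simp
qed simp

text \<open>The standard normal density of the whole space, written as a product so that integrals
  against it reduce to one dimension; \<open>gauss_eq\<close> is the radial form.\<close>

definition gauss :: "'a::euclidean_space \<Rightarrow> real" where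
  "gauss v = (\<Prod>b\<in>Basis. std_normal_density (v \<bullet> b))"

subsection \<open>Plancherel's theorem\<close>

lemma norm_sq_Basis: "(norm (v::'a::euclidean_space))\<^sup>2 = (\<Sum>b\<in>Basis. (v \<bullet> b)\<^sup>2)"
proof -
  have "(norm v)\<^sup>2 = v \<bullet> v" by (rule power2_norm_eq_inner)
  also have "\<dots> = (\<Sum>b\<in>Basis. (v \<bullet> b) * (v \<bullet> b))" by (rule euclidean_inner)
  finally show ?thesis by (simp add: power2_eq_square)
qed

lemma gauss_eq: "gauss (v::'a::euclidean_space) = (1 / sqrt (2 * pi)) ^ DIM('a) * exp (- (norm v)\<^sup>2 / 2)"
proof -
  have "exp (- (norm v)\<^sup>2 / 2) = (\<Prod>b\<in>Basis. exp (- (v \<bullet> b)\<^sup>2 / 2))"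
    by (simp add: norm_sq_Basis exp_sum[symmetric] sum_negf sum_divide_distrib)
  then show ?thesis
    unfolding gauss_def std_normal_density_def prod.distrib by simp
qed

lemma gauss_pos: "0 < gauss v"
  by (simp add: gauss_eq)

lemma gauss_measurable [measurable]: "gauss \<in> borel_measurable borel"
  unfolding gauss_def by measurable

lemma integral_std_normal_cis:
  "(LINT t|lborel. std_normal_density t *\<^sub>R cis (t * a)) = of_real (exp (- a\<^sup>2 / 2))"
proof -
  have "(LINT t|lborel. std_normal_density t *\<^sub>R cis (t * a)) = (LINT t|lborel. std_normal_density t *\<^sub>R iexp (a * t))"
    by (simp add: cis_conv_exp mult_ac)
  also have "\<dots> = char std_normal_distribution a"
    unfolding char_def by (subst integral_density) auto
  finally show ?thesis by (simp add: char_std_normal_distribution)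
qed

text \<open>Lebesgue measure is the image of a product measure and the integrand factorises, so the
  value is a product of one-dimensional characteristic functions of the normal distribution.\<close>

lemma integral_gauss_cis:
  fixes s :: "'a::euclidean_space"
  shows "integrable lborel (\<lambda>v. gauss v *\<^sub>R cis (v \<bullet> s))"
    and "(LINT v|lborel. gauss v *\<^sub>R cis (v \<bullet> s)) = of_real (exp (- (norm s)\<^sup>2 / 2))"
proof -
  interpret product_sigma_finite "\<lambda>b::'a. lborel :: real measure" ..
  define h where "h b t = std_normal_density t *\<^sub>R cis (t * (s \<bullet> b))" for b t
  define T where "T f = (\<Sum>b\<in>Basis. f b *\<^sub>R b)" for f :: "'a \<Rightarrow> real"
  have T: "T \<in> (\<Pi>\<^sub>M b\<in>Basis. lborel) \<rightarrow>\<^sub>M borel"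
    unfolding T_def by measurable
  have hi: "integrable lborel (h b)" for b
    unfolding h_def
  proof (rule Bochner_Integration.integrable_bound)
    show "integrable lborel std_normal_density" by simp
  qed (auto simp: cis_conv_exp)
  have eq: "gauss (T f) *\<^sub>R cis (T f \<bullet> s) = (\<Prod>b\<in>Basis. h b (f b))" for f
  proof -
    have Tb: "T f \<bullet> b = f b" if "b \<in> Basis" for b
      using that by (simp add: T_def inner_sum_left inner_Basis if_distrib sum.delta cong: if_cong)
    have "T f \<bullet> s = (\<Sum>b\<in>Basis. f b * (s \<bullet> b))"
      by (simp add: T_def inner_sum_left) (simp add: inner_commute)
    then have "cis (T f \<bullet> s) = (\<Prod>b\<in>Basis. cis (f b * (s \<bullet> b)))"
      by (simp add: cis_conv_exp exp_sum[symmetric] sum_distrib_left)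
    then show ?thesis
      by (simp add: gauss_def h_def Tb scaleR_conv_of_real prod.distrib)
  qed
  have m: "(\<lambda>v. gauss v *\<^sub>R cis (v \<bullet> s)) \<in> borel_measurable borel"
    by (simp add: cis_conv_exp)
  show "integrable lborel (\<lambda>v. gauss v *\<^sub>R cis (v \<bullet> s))"
    unfolding lborel_eq[where 'a='a] T_def[symmetric, abs_def]
    by (subst integrable_distr_eq[OF T m]) (simp add: eq product_integrable_prod hi)
  have "(LINT v|lborel. gauss v *\<^sub>R cis (v \<bullet> s)) = (LINT f|(\<Pi>\<^sub>M b\<in>Basis. lborel). (\<Prod>b\<in>Basis. h b (f b)))"
    unfolding lborel_eq[where 'a='a] T_def[symmetric, abs_def]
    by (subst integral_distr[OF T m]) (simp add: eq)
  also have "\<dots> = (\<Prod>b\<in>Basis. LINT t|lborel. h b t)"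
    by (rule product_integral_prod[OF finite_Basis hi])
  also have "\<dots> = (\<Prod>b\<in>Basis. of_real (exp (- (s \<bullet> b)\<^sup>2 / 2)))"
    by (simp add: h_def integral_std_normal_cis)
  also have "\<dots> = of_real (exp (\<Sum>b\<in>Basis. - (s \<bullet> b)\<^sup>2 / 2))"
    by (simp only: exp_sum[OF finite_Basis] of_real_prod)
  also have "(\<Sum>b\<in>Basis. - (s \<bullet> b)\<^sup>2 / 2) = - (norm s)\<^sup>2 / 2"
    by (simp add: norm_sq_Basis sum_negf sum_divide_distrib)
  finally show "(LINT v|lborel. gauss v *\<^sub>R cis (v \<bullet> s)) = of_real (exp (- (norm s)\<^sup>2 / 2))" .
qed

lemma integrable_gauss [simp]: "integrable lborel (gauss :: 'a::euclidean_space \<Rightarrow> real)"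
  and integral_gauss: "(LINT v|lborel. gauss (v::'a::euclidean_space)) = 1"
proof -
  have "integrable lborel (\<lambda>v::'a. of_real (gauss v) :: complex)"
    using integral_gauss_cis(1)[of "0::'a"] by (simp add: scaleR_conv_of_real)
  from integrable_Re[OF this] show "integrable lborel (gauss :: 'a::euclidean_space \<Rightarrow> real)"
    by simp
  have "of_real (LINT v|lborel. gauss (v::'a)) = (1::complex)"
    using integral_gauss_cis(2)[of "0::'a"] by (simp add: scaleR_conv_of_real)
  then show "(LINT v|lborel. gauss (v::'a::euclidean_space)) = 1"
    using of_real_eq_1_iff by blast
qed

lemma lborel_integral_affine:
  fixes f :: "'a::euclidean_space \<Rightarrow> 'b::{banach,second_countable_topology}"
  assumes f: "f \<in> borel_measurable borel" and c: "c \<noteq> 0"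
  shows "(LINT x|lborel. f x) = \<bar>c\<bar> ^ DIM('a) *\<^sub>R (LINT x|lborel. f (t + c *\<^sub>R x))"
  using f by (subst lborel_affine[OF c, of t]) (simp add: integral_density integral_distr)

lemma lborel_integrable_affine:
  fixes f :: "'a::euclidean_space \<Rightarrow> 'b::{banach,second_countable_topology}"
  assumes f: "integrable lborel f" and c: "c \<noteq> 0"
  shows "integrable lborel (\<lambda>x. f (t + c *\<^sub>R x))"
proof -
  have m: "f \<in> borel_measurable borel" using f by auto
  have "integrable (density (distr lborel borel (\<lambda>x. t + c *\<^sub>R x)) (\<lambda>_. \<bar>c\<bar> ^ DIM('a))) f"
    using f lborel_affine[OF c, of t] by simp
  then have "integrable lborel (\<lambda>x. \<bar>c\<bar> ^ DIM('a) *\<^sub>R f (t + c *\<^sub>R x))"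
    using m by (subst (asm) integrable_density) (auto simp: integrable_distr_eq)
  from integrable_scaleR_right[OF this, of "inverse (\<bar>c\<bar> ^ DIM('a))"] show ?thesis using c by simp
qed

text \<open>The formula of \<open>inv_fourier_integral\<close> over \<open>lborel\<close>, where
  Fubini is at hand; for Borel functions the two agree.\<close>

definition ift :: "('a::euclidean_space \<Rightarrow> complex) \<Rightarrow> 'a \<Rightarrow> complex" where
  "ift f x = (LINT \<xi>|lborel. f \<xi> * cis (2 * pi * (x \<bullet> \<xi>)))"

lemma cis_measurable [measurable]: "cis \<in> borel_measurable borel"
  by (intro borel_measurable_continuous_onI continuous_intros)

lemma integrable_mult_cis:
  assumes "integrable lborel (f :: 'a::euclidean_space \<Rightarrow> complex)"
  shows "integrable lborel (\<lambda>\<xi>. f \<xi> * cis (2 * pi * (x \<bullet> \<xi>)))"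
proof (rule Bochner_Integration.integrable_bound[OF assms])
  have [measurable]: "f \<in> borel_measurable borel" using assms by auto
  show "(\<lambda>\<xi>. f \<xi> * cis (2 * pi * (x \<bullet> \<xi>))) \<in> borel_measurable lborel" by measurable
qed (auto simp: norm_mult)

lemma norm_ift_le: "norm (ift f x) \<le> (LINT \<xi>|lborel. norm (f \<xi>))"
proof -
  have "norm (ift f x) \<le> (LINT \<xi>|lborel. norm (f \<xi> * cis (2 * pi * (x \<bullet> \<xi>))))"
    unfolding ift_def by (rule integral_norm_bound)
  then show ?thesis by (simp add: norm_mult)
qed

lemma ift_cont:
  assumes f: "integrable lborel (f :: 'a::euclidean_space \<Rightarrow> complex)"
  shows "continuous_on UNIV (ift f)"
proof (intro continuous_at_imp_continuous_on ballI continuous_at_sequentiallyI)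
  fix x and u :: "nat \<Rightarrow> 'a" assume u: "u \<longlonglongrightarrow> x"
  have [measurable]: "f \<in> borel_measurable borel" using f by auto
  show "(\<lambda>n. ift f (u n)) \<longlonglongrightarrow> ift f x"
    unfolding ift_def
  proof (rule integral_dominated_convergence)
    show "integrable lborel (\<lambda>\<xi>. norm (f \<xi>))" using f by simp
    have "(\<lambda>n. cis (2 * pi * (u n \<bullet> \<xi>))) \<longlonglongrightarrow> cis (2 * pi * (x \<bullet> \<xi>))" for \<xi>
      using u unfolding cis_conv_exp by (intro tendsto_intros)
    then show "AE \<xi> in lborel. (\<lambda>n. f \<xi> * cis (2 * pi * (u n \<bullet> \<xi>))) \<longlonglongrightarrow> f \<xi> * cis (2 * pi * (x \<bullet> \<xi>))"
      by (intro AE_I2 tendsto_mult_left)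
  qed (auto simp: norm_mult)
qed

lemma ift_measurable:
  assumes "integrable lborel (f :: 'a::euclidean_space \<Rightarrow> complex)"
  shows "ift f \<in> borel_measurable borel"
  by (rule borel_measurable_continuous_onI[OF ift_cont[OF assms]])

text \<open>Multiplication formula: both sides are iterated integrals of
  \<open>g x * f \<xi> * cis (2 * pi * (x \<bullet> \<xi>))\<close>, and the kernel is
  symmetric.\<close>

lemma integral_ift_mult:
  fixes f g :: "'a::euclidean_space \<Rightarrow> complex"
  assumes f: "integrable lborel f" and g: "integrable lborel g"
  shows "(LINT x|lborel. ift f x * g x) = (LINT \<xi>|lborel. f \<xi> * ift g \<xi>)"
proof -
  have [measurable]: "f \<in> borel_measurable borel" "g \<in> borel_measurable borel" using f g by auto
  define F where "F = (\<lambda>(x, \<xi>). g x * (f \<xi> * cis (2 * pi * (x \<bullet> \<xi>))))"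
  have mF: "F \<in> borel_measurable (lborel \<Otimes>\<^sub>M lborel)"
    unfolding F_def by measurable
  have iF: "integrable (lborel \<Otimes>\<^sub>M lborel) F"
  proof (rule lborel_pair.Fubini_integrable[OF mF])
    show "integrable lborel (\<lambda>x. LINT y|lborel. norm (F (x, y)))"
      using g by (simp add: F_def norm_mult)
    show "AE x in lborel. integrable lborel (\<lambda>y. F (x, y))"
      using integrable_mult_cis[OF f] by (simp add: F_def)
  qed
  have "(LINT x|lborel. LINT \<xi>|lborel. F (x, \<xi>)) = (LINT \<xi>|lborel. LINT x|lborel. F (x, \<xi>))"
    using lborel_pair.Fubini_integral[of "\<lambda>x \<xi>. F (x, \<xi>)"] iF by simp
  moreover have "(LINT \<xi>|lborel. F (x, \<xi>)) = ift f x * g x" for x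
    by (simp add: F_def ift_def mult.commute)
  moreover have "(LINT x|lborel. F (x, \<xi>)) = f \<xi> * ift g \<xi>" for \<xi>
  proof -
    have "(LINT x|lborel. F (x, \<xi>)) = (LINT x|lborel. f \<xi> * (g x * cis (2 * pi * (\<xi> \<bullet> x))))"
      by (intro Bochner_Integration.integral_cong) (auto simp: F_def inner_commute)
    then show ?thesis by (simp add: ift_def)
  qed
  ultimately show ?thesis by simp
qed

text \<open>A Gaussian tending to 1 as \<open>\<delta>\<close> tends to 0, normalised so that its
  transform is the standard normal density at scale \<open>\<delta>\<close>.\<close>

definition damp :: "real \<Rightarrow> 'a::euclidean_space \<Rightarrow> real" where
  "damp \<delta> x = exp (- (norm ((2 * pi * \<delta>) *\<^sub>R x))\<^sup>2 / 2)"

lemma damp_measurable [measurable]: "damp \<delta> \<in> borel_measurable borel"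
  unfolding damp_def by measurable

lemma damp_le1: "damp \<delta> x \<le> 1" and damp_pos: "0 < damp \<delta> x"
  by (auto simp: damp_def)

lemma damp_gauss: "damp \<delta> (x::'a::euclidean_space) = sqrt (2 * pi) ^ DIM('a) * gauss ((2 * pi * \<delta>) *\<^sub>R x)"
  by (simp add: damp_def gauss_eq power_one_over)

lemma integrable_damp:
  assumes "\<delta> > 0" shows "integrable lborel (damp \<delta> :: 'a::euclidean_space \<Rightarrow> real)"
  using lborel_integrable_affine[OF integrable_gauss, of "2 * pi * \<delta>" "0::'a"] assms
  by (simp add: damp_gauss[abs_def])

lemma ift_damp:
  assumes \<delta>: "\<delta> > 0"
  shows "ift (\<lambda>x. of_real (damp \<delta> x)) (u::'a::euclidean_space) = of_real (gauss ((1 / \<delta>) *\<^sub>R u) / \<delta> ^ DIM('a))"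
proof -
  let ?c = "2 * pi * \<delta>"
  define G where "G v = gauss v *\<^sub>R cis (v \<bullet> ((1 / \<delta>) *\<^sub>R u))" for v :: 'a
  have mG: "G \<in> borel_measurable borel"
    unfolding G_def by measurable
  have c: "?c > 0" using \<delta> by simp
  have "of_real (exp (- (norm ((1 / \<delta>) *\<^sub>R u))\<^sup>2 / 2)) = (LINT v|lborel. G v)"
    unfolding G_def integral_gauss_cis(2) ..
  \<comment> \<open>The substitution \<open>v = ?c *\<^sub>R x\<close> turns \<open>gauss\<close>
    into a multiple of \<open>damp \<delta>\<close>.\<close>
  also have "\<dots> = ?c ^ DIM('a) *\<^sub>R (LINT x|lborel. G (0 + ?c *\<^sub>R x))"
    using lborel_integral_affine[OF mG less_imp_neq[OF c, symmetric], of 0] by (simp only: abs_of_pos[OF c])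
  also have "(LINT x|lborel. G (0 + ?c *\<^sub>R x)) = (LINT x|lborel. of_real (1 / sqrt (2 * pi) ^ DIM('a)) * (of_real (damp \<delta> x) * cis (2 * pi * (u \<bullet> x))))"
    using \<delta> by (intro Bochner_Integration.integral_cong) (auto simp: G_def damp_gauss scaleR_conv_of_real inner_commute mult.assoc)
  also have "\<dots> = of_real (1 / sqrt (2 * pi) ^ DIM('a)) * ift (\<lambda>x. of_real (damp \<delta> x)) u"
    by (simp add: ift_def)
  finally have e: "of_real (exp (- (norm ((1 / \<delta>) *\<^sub>R u))\<^sup>2 / 2)) =
      of_real (?c ^ DIM('a) / sqrt (2 * pi) ^ DIM('a)) * ift (\<lambda>x. of_real (damp \<delta> x)) u"
    by (simp add: scaleR_conv_of_real)
  have "?c ^ DIM('a) / sqrt (2 * pi) ^ DIM('a) = (sqrt (2 * pi) * \<delta>) ^ DIM('a)"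
    unfolding power_divide[symmetric]
    by (rule arg_cong[where f = "\<lambda>z. z ^ DIM('a)"]) (simp add: field_simps)
  note e' = e[unfolded this]
  have solve: "z = of_real (E / Q)" if "of_real E = of_real Q * z" "Q \<noteq> 0" for z :: complex and E Q
    using that by (simp add: nonzero_eq_divide_eq mult.commute)
  have "ift (\<lambda>x. of_real (damp \<delta> x)) u = of_real (exp (- (norm ((1 / \<delta>) *\<^sub>R u))\<^sup>2 / 2) / (sqrt (2 * pi) * \<delta>) ^ DIM('a))"
    using \<delta> by (intro solve[OF e']) simp
  also have "exp (- (norm ((1 / \<delta>) *\<^sub>R u))\<^sup>2 / 2) / (sqrt (2 * pi) * \<delta>) ^ DIM('a) = gauss ((1 / \<delta>) *\<^sub>R u) / \<delta> ^ DIM('a)"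
    by (simp add: gauss_eq power_mult_distrib power_one_over)
  finally show ?thesis .
qed

section \<open>Gaussian damping and the limit of the autocorrelation\<close>

abbreviation sq_integrable :: "('a::euclidean_space \<Rightarrow> complex) \<Rightarrow> bool" where
  "sq_integrable f \<equiv> integrable lborel (\<lambda>x. (norm (f x))\<^sup>2)"

text \<open>The inner product of \<open>f\<close> with its translate by
  \<open>\<delta> *\<^sub>R v\<close>. Scale and direction are separate because \<open>v\<close> is
  averaged against \<open>gauss\<close> while \<open>\<delta>\<close> tends to 0.\<close>

definition autocorr :: "('a::euclidean_space \<Rightarrow> complex) \<Rightarrow> real \<Rightarrow> 'a \<Rightarrow> complex" where
  "autocorr f \<delta> v = (LINT \<xi>|lborel. f \<xi> * cnj (f (\<xi> - \<delta> *\<^sub>R v)))"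

lemma norm_mult_cnj_le: "norm (a * cnj b) \<le> ((norm a)\<^sup>2 + (norm b)\<^sup>2) / 2"
  using sum_squares_bound[of "norm a" "norm b"] by (simp add: norm_mult)

lemma cnj_measurable [measurable]: "cnj \<in> borel_measurable borel"
  by (intro borel_measurable_continuous_onI continuous_intros)

context
  fixes f :: "'a::euclidean_space \<Rightarrow> complex"
  assumes f: "f \<in> borel_measurable borel" and f2: "sq_integrable f"
begin

lemma sq_integrable_shift: "sq_integrable (\<lambda>\<xi>. f (\<xi> - h))"
  using lborel_integrable_translate[OF f2, of "- h"] by simp

lemma integral_sq_shift: "(LINT \<xi>|lborel. (norm (f (\<xi> - h)))\<^sup>2) = (LINT \<xi>|lborel. (norm (f \<xi>))\<^sup>2)"
  using lborel_integral_translate[of "\<lambda>\<xi>. (norm (f \<xi>))\<^sup>2" "- h"] f by simp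

lemma integrable_mult_cnj_shift: "integrable lborel (\<lambda>\<xi>. f \<xi> * cnj (f (\<xi> - h)))"
proof (rule Bochner_Integration.integrable_bound)
  show "integrable lborel (\<lambda>\<xi>. ((norm (f \<xi>))\<^sup>2 + (norm (f (\<xi> - h)))\<^sup>2) / 2)"
    using f2 sq_integrable_shift by simp
  have [measurable]: "f \<in> borel_measurable borel" by (rule f)
  show "(\<lambda>\<xi>. f \<xi> * cnj (f (\<xi> - h))) \<in> borel_measurable lborel" by measurable
  show "AE \<xi> in lborel. norm (f \<xi> * cnj (f (\<xi> - h))) \<le> norm (((norm (f \<xi>))\<^sup>2 + (norm (f (\<xi> - h)))\<^sup>2) / 2)"
    using norm_mult_cnj_le by (auto intro!: AE_I2 intro: order_trans[OF _ abs_ge_self])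
qed

text \<open>Half the sum of the two squares, whose integrals agree by translation. The bound does
  not depend on the shift and so serves for domination.\<close>

lemma integral_norm_mult_cnj_shift_le:
  "(LINT \<xi>|lborel. norm (f \<xi> * cnj (f (\<xi> - h)))) \<le> (LINT \<xi>|lborel. (norm (f \<xi>))\<^sup>2)"
proof -
  have "(LINT \<xi>|lborel. norm (f \<xi> * cnj (f (\<xi> - h)))) \<le> (LINT \<xi>|lborel. ((norm (f \<xi>))\<^sup>2 + (norm (f (\<xi> - h)))\<^sup>2) / 2)"
    using integrable_mult_cnj_shift f2 sq_integrable_shift
    by (intro integral_mono norm_mult_cnj_le) auto
  also have "\<dots> = (LINT \<xi>|lborel. (norm (f \<xi>))\<^sup>2)"
    using f2 sq_integrable_shift by (simp add: integral_sq_shift)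
  finally show ?thesis .
qed

lemma norm_autocorr_le: "norm (autocorr f \<delta> v) \<le> (LINT \<xi>|lborel. (norm (f \<xi>))\<^sup>2)"
  unfolding autocorr_def by (rule order_trans[OF integral_norm_bound integral_norm_mult_cnj_shift_le])

lemma integrable_gauss_corr:
  "integrable (lborel \<Otimes>\<^sub>M lborel) (\<lambda>(v, \<xi>). of_real (gauss v) * (f \<xi> * cnj (f (\<xi> - \<delta> *\<^sub>R v))))"
    (is "integrable _ ?F")
proof (rule lborel_pair.Fubini_integrable)
  have [measurable]: "f \<in> borel_measurable borel" by (rule f)
  show mF: "?F \<in> borel_measurable (lborel \<Otimes>\<^sub>M lborel)" by measurable
  show "integrable lborel (\<lambda>v. LINT \<xi>|lborel. norm (?F (v, \<xi>)))"
  proof (rule Bochner_Integration.integrable_bound)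
    show "integrable lborel (\<lambda>v. gauss (v::'a) * (LINT \<xi>|lborel. (norm (f \<xi>))\<^sup>2))" by simp
    show "(\<lambda>v. LINT \<xi>|lborel. norm (?F (v, \<xi>))) \<in> borel_measurable lborel"
      using mF by (intro lborel.borel_measurable_lebesgue_integral) simp
    show "AE v in lborel. norm (LINT \<xi>|lborel. norm (?F (v, \<xi>))) \<le> norm (gauss (v::'a) * (LINT \<xi>|lborel. (norm (f \<xi>))\<^sup>2))"
    proof (intro AE_I2)
      fix v :: 'a
      have "(LINT \<xi>|lborel. norm (?F (v, \<xi>))) = gauss v * (LINT \<xi>|lborel. norm (f \<xi> * cnj (f (\<xi> - \<delta> *\<^sub>R v))))"
        using gauss_pos[of v] by (simp add: norm_mult)
      also have "\<dots> \<le> gauss v * (LINT \<xi>|lborel. (norm (f \<xi>))\<^sup>2)"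
        using gauss_pos[of v] integral_norm_mult_cnj_shift_le by (intro mult_left_mono) auto
      finally show "norm (LINT \<xi>|lborel. norm (?F (v, \<xi>))) \<le> norm (gauss v * (LINT \<xi>|lborel. (norm (f \<xi>))\<^sup>2))"
        by simp
    qed
  qed
  show "AE v in lborel. integrable lborel (\<lambda>\<xi>. ?F (v, \<xi>))"
    using integrable_mult_cnj_shift by auto
qed

lemma autocorr_measurable: "autocorr f \<delta> \<in> borel_measurable borel"
proof -
  have [measurable]: "f \<in> borel_measurable borel" by (rule f)
  have "(\<lambda>(v, \<xi>). f \<xi> * cnj (f (\<xi> - \<delta> *\<^sub>R v))) \<in> borel_measurable (lborel \<Otimes>\<^sub>M lborel)" by measurable
  from lborel.borel_measurable_lebesgue_integral[OF this] show ?thesis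
    by (simp add: autocorr_def[abs_def])
qed

text \<open>The multiplication formula is applied to \<open>f\<close> and to the damped conjugate of
  its transform. The transform of the latter averages translates of \<open>cnj f\<close> against a
  Gaussian, and exchanging the integrals leaves an average of autocorrelations.\<close>

lemma damped_plancherel:
  assumes f1: "integrable lborel f" and \<delta>: "\<delta> > 0"
  shows "(LINT x|lborel. damp \<delta> x * (norm (ift f x))\<^sup>2) = (LINT v|lborel. gauss v * Re (autocorr f \<delta> v))"
proof -
  have [measurable]: "f \<in> borel_measurable borel" by (rule f)
  note mi[measurable] = ift_measurable[OF f1]
  define g where "g x = of_real (damp \<delta> x) * cnj (ift f x)" for x
  have idamp: "integrable lborel (\<lambda>x::'a. of_real (damp \<delta> x) :: complex)"
    using integrable_damp[OF \<delta>] by (rule integrable_of_real)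
  have ig: "integrable lborel g"
  proof (rule Bochner_Integration.integrable_bound)
    show "integrable lborel (\<lambda>x::'a. damp \<delta> x * (LINT \<xi>|lborel. norm (f \<xi>)))"
      by (intro integrable_mult_left integrable_damp[OF \<delta>])
    show "g \<in> borel_measurable lborel" unfolding g_def by measurable
    show "AE x in lborel. norm (g x) \<le> norm (damp \<delta> x * (LINT \<xi>|lborel. norm (f \<xi>)))"
      using norm_ift_le[of f] damp_pos[of \<delta>] by (auto intro!: AE_I2 mult_mono simp: g_def norm_mult abs_mult intro: less_imp_le order_trans[OF _ abs_ge_self])
  qed
  \<comment> \<open>Reflection and conjugation, chosen so that the transform of \<open>fs\<close> is
    the conjugate of that of \<open>f\<close>.\<close>
  define fs where "fs \<eta> = cnj (f (- \<eta>))" for \<eta>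
  have ifs: "integrable lborel fs"
    using lborel_integrable_affine[OF f1, of "-1" 0] by (simp add: fs_def[abs_def])
  have ift_fs: "ift fs x = cnj (ift f x)" for x
  proof -
    have "ift fs x = (LINT \<eta>|lborel. cnj (f (0 + (-1) *\<^sub>R \<eta>) * cis (2 * pi * (x \<bullet> (0 + (-1) *\<^sub>R \<eta>)))))"
      by (simp add: ift_def fs_def cis_cnj)
    also have "\<dots> = (LINT \<eta>|lborel. cnj (f \<eta> * cis (2 * pi * (x \<bullet> \<eta>))))"
      using lborel_integral_affine[of "\<lambda>\<eta>. cnj (f \<eta> * cis (2 * pi * (x \<bullet> \<eta>)))" "-1" 0] by simp
    also have "\<dots> = cnj (ift f x)" unfolding ift_def by (rule Bochner_Integration.integral_cnj)
    finally show ?thesis .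
  qed
  have ift_g: "ift g \<xi> = (LINT v|lborel. of_real (gauss v) * cnj (f (\<xi> - \<delta> *\<^sub>R v)))" for \<xi>
  proof -
    \<comment> \<open>A damped character, whose transform is a Gaussian in
      \<open>\<xi> + \<eta>\<close>; a second use of the multiplication formula, now with
      \<open>fs\<close>, then gives \<open>ift g \<xi>\<close>.\<close>
    define h where "h x = of_real (damp \<delta> x) * cis (2 * pi * (\<xi> \<bullet> x))" for x
    have ih: "integrable lborel h"
      unfolding h_def by (rule integrable_mult_cis[OF idamp])
    have ift_h: "ift h \<eta> = of_real (gauss ((1 / \<delta>) *\<^sub>R (\<xi> + \<eta>)) / \<delta> ^ DIM('a))" for \<eta>
    proof -
      have "ift h \<eta> = ift (\<lambda>x. of_real (damp \<delta> x)) (\<xi> + \<eta>)"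
        unfolding ift_def h_def
        by (intro Bochner_Integration.integral_cong) (auto simp: inner_add_left cis_mult distrib_left)
      then show ?thesis by (simp add: ift_damp[OF \<delta>])
    qed
    have "ift g \<xi> = (LINT x|lborel. ift fs x * h x)"
      unfolding ift_def[of g] by (simp add: g_def h_def ift_fs mult_ac)
    also have "\<dots> = (LINT \<eta>|lborel. fs \<eta> * ift h \<eta>)"
      by (rule integral_ift_mult[OF ifs ih])
    also have "\<dots> = (LINT \<eta>|lborel. cnj (f (- \<eta>)) * of_real (gauss ((1 / \<delta>) *\<^sub>R (\<xi> + \<eta>)) / \<delta> ^ DIM('a)))"
      by (simp add: fs_def ift_h)
    also have "\<dots> = \<bar>\<delta>\<bar> ^ DIM('a) *\<^sub>R (LINT v|lborel. cnj (f (- (- \<xi> + \<delta> *\<^sub>R v))) * of_real (gauss ((1 / \<delta>) *\<^sub>R (\<xi> + (- \<xi> + \<delta> *\<^sub>R v))) / \<delta> ^ DIM('a)))"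
      using \<delta> by (intro lborel_integral_affine) auto
    also have "\<dots> = (LINT v|lborel. of_real (gauss v) * cnj (f (\<xi> - \<delta> *\<^sub>R v)))"
      unfolding integral_scaleR_right[symmetric] using \<delta>
      by (intro Bochner_Integration.integral_cong) (auto simp: scaleR_conv_of_real)
    finally show ?thesis .
  qed
  have "of_real (LINT x|lborel. damp \<delta> x * (norm (ift f x))\<^sup>2) = (LINT x|lborel. ift f x * g x)"
    unfolding integral_complex_of_real[symmetric]
    by (intro Bochner_Integration.integral_cong) (auto simp: g_def complex_norm_square[symmetric] mult.left_commute)
  also have "\<dots> = (LINT \<xi>|lborel. f \<xi> * ift g \<xi>)"
    by (rule integral_ift_mult[OF f1 ig])
  also have "\<dots> = (LINT \<xi>|lborel. LINT v|lborel. of_real (gauss v) * (f \<xi> * cnj (f (\<xi> - \<delta> *\<^sub>R v))))"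
    by (simp add: ift_g mult.left_commute flip: integral_mult_right_zero)
  also have "\<dots> = (LINT v|lborel. LINT \<xi>|lborel. of_real (gauss v) * (f \<xi> * cnj (f (\<xi> - \<delta> *\<^sub>R v))))"
    by (rule lborel_pair.Fubini_integral[OF integrable_gauss_corr])
  also have "\<dots> = (LINT v|lborel. of_real (gauss v) * autocorr f \<delta> v)"
    by (simp add: autocorr_def)
  finally have eq: "of_real (LINT x|lborel. damp \<delta> x * (norm (ift f x))\<^sup>2) = (LINT v|lborel. of_real (gauss v) * autocorr f \<delta> v)" .
  have "integrable lborel (\<lambda>v. of_real (gauss v) * autocorr f \<delta> v)"
  proof (rule Bochner_Integration.integrable_bound)
    show "integrable lborel (\<lambda>v::'a. gauss v * (LINT \<xi>|lborel. (norm (f \<xi>))\<^sup>2))" by simp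
    have [measurable]: "autocorr f \<delta> \<in> borel_measurable borel" by (rule autocorr_measurable)
    show "(\<lambda>v. of_real (gauss v) * autocorr f \<delta> v) \<in> borel_measurable lborel" by measurable
    show "AE v in lborel. norm (of_real (gauss v) * autocorr f \<delta> v) \<le> norm (gauss v * (LINT \<xi>|lborel. (norm (f \<xi>))\<^sup>2))"
      using norm_autocorr_le by (auto intro!: AE_I2 mult_mono simp: norm_mult abs_mult intro: order_trans[OF _ abs_ge_self])
  qed
  from integral_Re[OF this] show ?thesis
    using arg_cong[OF eq, of Re] by simp
qed

text \<open>
  Off \<open>D\<close> the factor \<open>f \<xi>\<close> vanishes, so continuity on \<open>D\<close> is enough for pointwise convergence of the
  integrand, even when the boundary of \<open>D\<close> has positive measure. The lower bound is Fatou's lemma for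
  \<open>(norm (f \<xi> + f (\<xi> - \<delta> *\<^sub>R v)))\<^sup>2\<close>.
\<close>
lemma autocorr_tendsto:
  assumes D: "open D" "continuous_on D f" "\<And>x. x \<notin> D \<Longrightarrow> f x = 0"
  shows "(\<lambda>n. Re (autocorr f (inverse (real (Suc n))) v)) \<longlonglongrightarrow> (LINT \<xi>|lborel. (norm (f \<xi>))\<^sup>2)"
proof -
  have [measurable]: "f \<in> borel_measurable borel" by (rule f)
  define d where "d n = inverse (real (Suc n))" for n
  define A where "A = (LINT \<xi>|lborel. (norm (f \<xi>))\<^sup>2)"
  have d0: "d \<longlonglongrightarrow> 0" unfolding d_def by (rule LIMSEQ_inverse_real_of_nat)
  have A0: "0 \<le> A" unfolding A_def by simp
  have nnA: "(\<integral>\<^sup>+\<xi>. ennreal ((norm (f \<xi>))\<^sup>2) \<partial>lborel) = ennreal A"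
    unfolding A_def using f2 by (intro nn_integral_eq_integral) auto
  \<comment> \<open>Expanding the square makes convergence of the autocorrelation to
    \<open>A\<close> equivalent to convergence of the integrals of these squares to
    \<open>4 * A\<close>.\<close>
  have ex: "(norm (f \<xi> + f (\<xi> - h)))\<^sup>2 = (norm (f \<xi>))\<^sup>2 + (norm (f (\<xi> - h)))\<^sup>2 + 2 * Re (f \<xi> * cnj (f (\<xi> - h)))" for \<xi> h
    unfolding cmod_power2 by (simp add: power2_eq_square algebra_simps)
  have nn: "(\<integral>\<^sup>+\<xi>. ennreal ((norm (f \<xi> + f (\<xi> - d n *\<^sub>R v)))\<^sup>2) \<partial>lborel) = ennreal (2 * A + 2 * Re (autocorr f (d n) v))" for n
  proof -
    have i: "integrable lborel (\<lambda>\<xi>. Re (f \<xi> * cnj (f (\<xi> - d n *\<^sub>R v))))"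
      by (rule integrable_Re[OF integrable_mult_cnj_shift])
    have "(\<integral>\<^sup>+\<xi>. ennreal ((norm (f \<xi> + f (\<xi> - d n *\<^sub>R v)))\<^sup>2) \<partial>lborel) = ennreal (LINT \<xi>|lborel. (norm (f \<xi> + f (\<xi> - d n *\<^sub>R v)))\<^sup>2)"
      unfolding ex using f2 sq_integrable_shift i
      by (intro nn_integral_eq_integral Bochner_Integration.integrable_add integrable_mult_right) (auto simp: ex[symmetric] simp del: Re_complex_of_real times_complex.sel)
    also have "(LINT \<xi>|lborel. (norm (f \<xi> + f (\<xi> - d n *\<^sub>R v)))\<^sup>2) = A + A + 2 * (LINT \<xi>|lborel. Re (f \<xi> * cnj (f (\<xi> - d n *\<^sub>R v))))"
      unfolding ex using f2 sq_integrable_shift i integral_sq_shift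
      by (simp add: A_def del: times_complex.sel)
    also have "(LINT \<xi>|lborel. Re (f \<xi> * cnj (f (\<xi> - d n *\<^sub>R v)))) = Re (autocorr f (d n) v)"
      unfolding autocorr_def by (rule integral_Re[OF integrable_mult_cnj_shift])
    finally show ?thesis by simp
  qed
  have "ennreal (4 * A) = (\<integral>\<^sup>+\<xi>. ennreal (4 * (norm (f \<xi>))\<^sup>2) \<partial>lborel)"
    using A0 by (simp add: ennreal_mult' nn_integral_cmult nnA)
  also have "\<dots> \<le> (\<integral>\<^sup>+\<xi>. liminf (\<lambda>n. ennreal ((norm (f \<xi> + f (\<xi> - d n *\<^sub>R v)))\<^sup>2)) \<partial>lborel)"
  proof (rule nn_integral_mono)
    fix \<xi>
    show "ennreal (4 * (norm (f \<xi>))\<^sup>2) \<le> liminf (\<lambda>n. ennreal ((norm (f \<xi> + f (\<xi> - d n *\<^sub>R v)))\<^sup>2))"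
    proof (cases "\<xi> \<in> D")
      case True
      have "isCont f \<xi>" using D True by (simp add: continuous_on_eq_continuous_at)
      moreover have "(\<lambda>n. \<xi> - d n *\<^sub>R v) \<longlonglongrightarrow> \<xi> - 0 *\<^sub>R v"
        by (intro tendsto_intros d0)
      ultimately have "(\<lambda>n. f (\<xi> - d n *\<^sub>R v)) \<longlonglongrightarrow> f \<xi>"
        using isCont_tendsto_compose[of \<xi> f "\<lambda>n. \<xi> - d n *\<^sub>R v" sequentially] by simp
      then have "(\<lambda>n. ennreal ((norm (f \<xi> + f (\<xi> - d n *\<^sub>R v)))\<^sup>2)) \<longlonglongrightarrow> ennreal ((norm (f \<xi> + f \<xi>))\<^sup>2)"
        by (intro tendsto_ennrealI tendsto_intros)
      from lim_imp_Liminf[OF sequentially_bot this]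
      have "liminf (\<lambda>n. ennreal ((norm (f \<xi> + f (\<xi> - d n *\<^sub>R v)))\<^sup>2)) = ennreal ((norm (f \<xi> + f \<xi>))\<^sup>2)" .
      moreover have "(norm (f \<xi> + f \<xi>))\<^sup>2 = 4 * (norm (f \<xi>))\<^sup>2"
        by (metis mult_2 norm_mult norm_numeral power2_eq_square power_mult_distrib four_x_squared)
      ultimately show ?thesis by simp
    qed (simp add: D)
  qed
  also have "\<dots> \<le> liminf (\<lambda>n. \<integral>\<^sup>+\<xi>. ennreal ((norm (f \<xi> + f (\<xi> - d n *\<^sub>R v)))\<^sup>2) \<partial>lborel)"
    by (rule nn_integral_liminf) measurable
  finally have lo: "ennreal (4 * A) \<le> liminf (\<lambda>n. ennreal (2 * A + 2 * Re (autocorr f (d n) v)))"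
    unfolding nn .
  have le: "\<bar>Re (autocorr f (d n) v)\<bar> \<le> A" for n
    unfolding A_def by (rule order_trans[OF abs_Re_le_cmod norm_autocorr_le])
  \<comment> \<open>The matching upper bound: the real part of the autocorrelation never exceeds
    \<open>A\<close>, so lower and upper limit coincide.\<close>
  have "limsup (\<lambda>n. ennreal (2 * A + 2 * Re (autocorr f (d n) v))) \<le> ennreal (4 * A)"
    using le by (intro Limsup_bounded always_eventually allI ennreal_leI) (smt (verit))
  then have "limsup (\<lambda>n. ennreal (2 * A + 2 * Re (autocorr f (d n) v))) = ennreal (4 * A)"
    "liminf (\<lambda>n. ennreal (2 * A + 2 * Re (autocorr f (d n) v))) = ennreal (4 * A)"
    using lo Liminf_le_Limsup[OF sequentially_bot, of "\<lambda>n. ennreal (2 * A + 2 * Re (autocorr f (d n) v))"] by auto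
  then have "(\<lambda>n. ennreal (2 * A + 2 * Re (autocorr f (d n) v))) \<longlonglongrightarrow> ennreal (4 * A)"
    by (intro iffD2[OF tendsto_iff_Liminf_eq_Limsup]) auto
  then have "(\<lambda>n. 2 * A + 2 * Re (autocorr f (d n) v)) \<longlonglongrightarrow> 4 * A"
  proof (subst (asm) tendsto_ennreal_iff)
    show "\<forall>\<^sub>F n in sequentially. 0 \<le> 2 * A + 2 * Re (autocorr f (d n) v)"
      using le by (intro always_eventually allI) (smt (verit))
  qed (use A0 in auto)
  then have "(\<lambda>n. ((2 * A + 2 * Re (autocorr f (d n) v)) - 2 * A) / 2) \<longlonglongrightarrow> (4 * A - 2 * A) / 2"
    by (intro tendsto_intros) auto
  then show ?thesis by (simp add: A_def d_def)
qed

text \<open>Let the damping disappear. The Gaussian average of autocorrelations converges by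
  domination; on the other side Fatou's lemma gives one inequality, and \<open>damp \<le> 1\<close>
  the other.\<close>

lemma plancherel:
  assumes f1: "integrable lborel f"
    and D: "open D" "continuous_on D f" "\<And>x. x \<notin> D \<Longrightarrow> f x = 0"
  shows "sq_integrable (ift f)" "(LINT x|lborel. (norm (ift f x))\<^sup>2) = (LINT \<xi>|lborel. (norm (f \<xi>))\<^sup>2)"
proof -
  define d where "d n = inverse (real (Suc n))" for n
  define A where "A = (LINT \<xi>|lborel. (norm (f \<xi>))\<^sup>2)"
  define c where "c n = (LINT x|lborel. damp (d n) x * (norm (ift f x))\<^sup>2)" for n
  have d0: "d \<longlonglongrightarrow> 0" unfolding d_def by (rule LIMSEQ_inverse_real_of_nat)
  have dpos: "d n > 0" for n by (simp add: d_def)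
  note mi[measurable] = ift_measurable[OF f1]
  have [measurable]: "autocorr f \<delta> \<in> borel_measurable borel" for \<delta> by (rule autocorr_measurable)
  have "c \<longlonglongrightarrow> (LINT v|lborel. gauss (v::'a) * A)"
    unfolding c_def damped_plancherel[OF f1 dpos]
  proof (rule integral_dominated_convergence)
    show "integrable lborel (\<lambda>v::'a. gauss v * A)" by simp
    show "AE v in lborel. (\<lambda>n. gauss v * Re (autocorr f (d n) v)) \<longlonglongrightarrow> gauss v * A"
      using autocorr_tendsto[OF D] by (auto intro!: AE_I2 tendsto_intros simp: A_def d_def)
    show "AE v in lborel. norm (gauss v * Re (autocorr f (d n) v)) \<le> gauss v * A" for n
      using order_trans[OF abs_Re_le_cmod norm_autocorr_le]
      by (auto intro!: AE_I2 mult_mono simp: abs_mult A_def less_imp_le[OF gauss_pos])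
  qed measurable
  then have c: "c \<longlonglongrightarrow> A" by (simp add: integral_gauss)
  have nnc: "(\<integral>\<^sup>+x. ennreal (damp (d n) x * (norm (ift f x))\<^sup>2) \<partial>lborel) = ennreal (c n)" for n
    unfolding c_def
  proof (rule nn_integral_eq_integral)
    show "integrable lborel (\<lambda>x. damp (d n) x * (norm (ift f x))\<^sup>2)"
    proof (rule Bochner_Integration.integrable_bound)
      show "integrable lborel (\<lambda>x::'a. damp (d n) x * (LINT \<xi>|lborel. norm (f \<xi>))\<^sup>2)"
        by (intro integrable_mult_left integrable_damp[OF dpos])
      show "AE x in lborel. norm (damp (d n) x * (norm (ift f x))\<^sup>2) \<le> norm (damp (d n) x * (LINT \<xi>|lborel. norm (f \<xi>))\<^sup>2)"
        using norm_ift_le[of f] by (auto intro!: AE_I2 mult_left_mono power_mono simp: abs_mult)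
    qed measurable
  qed (use damp_pos in \<open>auto intro!: AE_I2 mult_nonneg_nonneg intro: less_imp_le\<close>)
  have "(\<integral>\<^sup>+x. ennreal ((norm (ift f x))\<^sup>2) \<partial>lborel) = (\<integral>\<^sup>+x. liminf (\<lambda>n. ennreal (damp (d n) x * (norm (ift f x))\<^sup>2)) \<partial>lborel)"
  proof (rule nn_integral_cong)
    fix x :: 'a
    have "(\<lambda>n. damp (d n) x) \<longlonglongrightarrow> exp (- (norm ((2 * pi * 0) *\<^sub>R x))\<^sup>2 / 2)"
      unfolding damp_def by (intro tendsto_intros d0) auto
    then have "(\<lambda>n. ennreal (damp (d n) x * (norm (ift f x))\<^sup>2)) \<longlonglongrightarrow> ennreal (1 * (norm (ift f x))\<^sup>2)"
      by (intro tendsto_ennrealI tendsto_intros) simp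
    from lim_imp_Liminf[OF sequentially_bot this]
    show "ennreal ((norm (ift f x))\<^sup>2) = liminf (\<lambda>n. ennreal (damp (d n) x * (norm (ift f x))\<^sup>2))"
      by simp
  qed
  also have "\<dots> \<le> liminf (\<lambda>n. \<integral>\<^sup>+x. ennreal (damp (d n) x * (norm (ift f x))\<^sup>2) \<partial>lborel)"
    by (rule nn_integral_liminf) measurable
  also have "\<dots> = ennreal A"
    unfolding nnc using c by (intro lim_imp_Liminf tendsto_ennrealI) auto
  finally have le: "(\<integral>\<^sup>+x. ennreal ((norm (ift f x))\<^sup>2) \<partial>lborel) \<le> ennreal A" .
  show i2: "sq_integrable (ift f)"
    using le by (intro integrableI_nonneg) (auto intro: le_less_trans)
  have "c n \<le> (LINT x|lborel. (norm (ift f x))\<^sup>2)" for n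
  proof -
    have "ennreal (c n) \<le> (\<integral>\<^sup>+x. ennreal ((norm (ift f x))\<^sup>2) \<partial>lborel)"
      unfolding nnc[symmetric] by (intro nn_integral_mono ennreal_leI mult_left_le_one_le)
        (auto simp: damp_le1 less_imp_le[OF damp_pos])
    also have "\<dots> = ennreal (LINT x|lborel. (norm (ift f x))\<^sup>2)"
      using i2 by (intro nn_integral_eq_integral) auto
    finally show ?thesis by (simp add: ennreal_le_iff)
  qed
  then have "A \<le> (LINT x|lborel. (norm (ift f x))\<^sup>2)"
    by (intro LIMSEQ_le_const2[OF c]) auto
  moreover have "(LINT x|lborel. (norm (ift f x))\<^sup>2) \<le> A"
    using le i2 by (subst (asm) nn_integral_eq_integral) (auto simp: A_def ennreal_le_iff)
  ultimately show "(LINT x|lborel. (norm (ift f x))\<^sup>2) = (LINT \<xi>|lborel. (norm (f \<xi>))\<^sup>2)"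
    by (simp add: A_def)
qed

end

section \<open>Parseval's identity and the chosen inverse Fourier transform\<close>

lemma AE_lebesgue_iff: "(AE x in lebesgue. P x) \<longleftrightarrow> (AE x in lborel. P x)"
proof
  assume "AE x in lebesgue. P x"
  then obtain N where "N \<in> null_sets lebesgue" "{x. \<not> P x} \<subseteq> N"
    unfolding eventually_ae_filter by auto
  then show "AE x in lborel. P x"
    unfolding eventually_ae_filter using null_sets_completion_iff2[of N lborel] by auto
qed (rule AE_completion)

lemma AE_lborel_translate:
  assumes "AE x in lborel. P (x :: 'a::euclidean_space)"
  shows "AE x in lborel. P (x - z)"
proof -
  have "AE x in distr lborel borel ((+) (- z)). P x"
    unfolding lborel_distr_plus by (rule assms)
  from AE_distrD[OF _ this] show ?thesis by simp
qed

text \<open>The functions covered by \<open>plancherel\<close>. For fixed \<open>D\<close> the class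
  is closed under linear combinations and modulation, which polarization and translation of the
  transforms require.\<close>

definition fourier_class :: "'a::euclidean_space set \<Rightarrow> ('a \<Rightarrow> complex) \<Rightarrow> bool" where
  "fourier_class D f \<longleftrightarrow> open D \<and> integrable lborel f \<and> sq_integrable f \<and> continuous_on D f \<and> (\<forall>x. x \<notin> D \<longrightarrow> f x = 0)"

lemma fourier_classD:
  assumes "fourier_class D f"
  shows "open D" "integrable lborel f" "f \<in> borel_measurable borel" "sq_integrable f"
    "continuous_on D f" "\<And>x. x \<notin> D \<Longrightarrow> f x = 0"
  using assms by (auto simp: fourier_class_def)

lemma norm_add_sq_le: "(norm (a + b))\<^sup>2 \<le> 2 * (norm a)\<^sup>2 + 2 * (norm (b :: complex))\<^sup>2"
proof -
  have "(norm (a + b))\<^sup>2 \<le> (norm a + norm b)\<^sup>2"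
    by (intro power_mono norm_triangle_ineq) auto
  also have "\<dots> \<le> 2 * (norm a)\<^sup>2 + 2 * (norm b)\<^sup>2"
    using sum_squares_bound[of "norm a" "norm b"] by (simp add: power2_sum)
  finally show ?thesis .
qed

lemma sq_integrable_add:
  assumes "sq_integrable f" "sq_integrable g" and [measurable]: "f \<in> borel_measurable borel" "g \<in> borel_measurable borel"
  shows "sq_integrable (\<lambda>x. f x + g x)"
proof (rule Bochner_Integration.integrable_bound)
  show "integrable lborel (\<lambda>x. 2 * (norm (f x))\<^sup>2 + 2 * (norm (g x))\<^sup>2)" using assms by simp
qed (use norm_add_sq_le in \<open>auto intro!: AE_I2\<close>)

lemma sq_integrable_cmult: "sq_integrable f \<Longrightarrow> sq_integrable (\<lambda>x. c * f x)"
  by (simp add: norm_mult power_mult_distrib)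

lemma fourier_class_add_cmult:
  assumes "fourier_class D f" "fourier_class D g"
  shows "fourier_class D (\<lambda>x. f x + c * g x)"
  using fourier_classD[OF assms(1)] fourier_classD[OF assms(2)]
  unfolding fourier_class_def
  by (intro conjI sq_integrable_add sq_integrable_cmult continuous_intros Bochner_Integration.integrable_add
      integrable_mult_right) (auto)

lemma fourier_class_modulate:
  assumes "fourier_class D f"
  shows "fourier_class D (\<lambda>\<xi>. f \<xi> * cis (2 * pi * (z \<bullet> \<xi>)))"
  using fourier_classD[OF assms]
  unfolding fourier_class_def
  by (intro conjI integrable_mult_cis continuous_intros) (auto simp: norm_mult)

lemma ift_add_cmult:
  assumes "integrable lborel f" "integrable lborel g"
  shows "ift (\<lambda>x. f x + c * g x) x = ift f x + c * ift g x"
  using integrable_mult_cis[OF assms(1), of x] integrable_mult_cis[OF assms(2), of x]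
  by (simp add: ift_def distrib_right mult.assoc)

lemma ift_modulate: "ift (\<lambda>\<xi>. f \<xi> * cis (2 * pi * (z \<bullet> \<xi>))) x = ift f (x + z)"
  unfolding ift_def by (intro Bochner_Integration.integral_cong) (auto simp: inner_add_left distrib_left cis_mult mult.assoc add.commute)

text \<open>Writes an inner product through four norms, so that Parseval's identity follows from
  Plancherel's for \<open>f + u * g\<close> with \<open>u\<close> a fourth root of unity.\<close>

lemma integral_mult_cnj_polarization:
  fixes f g :: "'a::euclidean_space \<Rightarrow> complex"
  assumes f: "sq_integrable f" and g: "sq_integrable g"
    and m: "f \<in> borel_measurable borel" "g \<in> borel_measurable borel"
  defines "Q \<equiv> \<lambda>u. complex_of_real (LINT x|lborel. (norm (f x + u * g x))\<^sup>2)"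
  shows "4 * (LINT x|lborel. f x * cnj (g x)) = Q 1 - Q (- 1) + \<i> * Q \<i> - \<i> * Q (- \<i>)"
proof -
  have i: "integrable lborel (\<lambda>x. complex_of_real ((norm (f x + u * g x))\<^sup>2))" for u
    using m by (intro integrable_of_real sq_integrable_add f sq_integrable_cmult g) auto
  have Q: "Q u = (LINT x|lborel. complex_of_real ((norm (f x + u * g x))\<^sup>2))" for u
    unfolding Q_def by (rule integral_complex_of_real[symmetric])
  have "4 * (a * cnj b) = of_real ((norm (a + 1 * b))\<^sup>2) - of_real ((norm (a + (- 1) * b))\<^sup>2)
      + \<i> * of_real ((norm (a + \<i> * b))\<^sup>2) - \<i> * of_real ((norm (a + (- \<i>) * b))\<^sup>2)" for a b :: complex
    unfolding cmod_power2 by (simp add: complex_eq_iff power2_eq_square algebra_simps)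
  then have "4 * (LINT x|lborel. f x * cnj (g x)) = (LINT x|lborel. of_real ((norm (f x + 1 * g x))\<^sup>2) - of_real ((norm (f x + (- 1) * g x))\<^sup>2)
      + \<i> * of_real ((norm (f x + \<i> * g x))\<^sup>2) - \<i> * of_real ((norm (f x + (- \<i>) * g x))\<^sup>2))"
    by (simp only: integral_mult_right_zero[symmetric])
  also have "\<dots> = Q 1 - Q (- 1) + \<i> * Q \<i> - \<i> * Q (- \<i>)"
    unfolding Q
    by (subst Bochner_Integration.integral_diff Bochner_Integration.integral_add integral_mult_right_zero;
        (intro Bochner_Integration.integrable_add Bochner_Integration.integrable_diff integrable_mult_right i)?)+
      (rule refl)
  finally show ?thesis .
qed

lemma parseval:
  assumes f: "fourier_class D f" and g: "fourier_class D g"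
  shows "(LINT x|lborel. ift f x * cnj (ift g x)) = (LINT \<xi>|lborel. f \<xi> * cnj (g \<xi>))"
proof -
  note F = fourier_classD[OF f] and G = fourier_classD[OF g]
  have pl: "sq_integrable (ift h)" "(LINT x|lborel. (norm (ift h x))\<^sup>2) = (LINT \<xi>|lborel. (norm (h \<xi>))\<^sup>2)"
    if "fourier_class D h" for h
    using plancherel fourier_classD[OF that] by blast+
  have eq: "(LINT x|lborel. (norm (ift f x + u * ift g x))\<^sup>2) = (LINT \<xi>|lborel. (norm (f \<xi> + u * g \<xi>))\<^sup>2)" for u
    using pl(2)[OF fourier_class_add_cmult[OF f g, of u]] by (simp add: ift_add_cmult F G)
  have "4 * (LINT x|lborel. ift f x * cnj (ift g x)) = 4 * (LINT \<xi>|lborel. f \<xi> * cnj (g \<xi>))"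
    by (simp only: eq integral_mult_cnj_polarization[OF F(4) G(4) F(3) G(3)]
        integral_mult_cnj_polarization[OF pl(1)[OF f] pl(1)[OF g] ift_measurable[OF F(2)] ift_measurable[OF G(2)]])
  then show ?thesis by simp
qed

lemma L2w_norm_sq: "(L2w_norm v f)\<^sup>2 = (\<integral>\<^sup>+x. (ennreal (norm (v x *\<^sub>R f x)))\<^sup>2 \<partial>lebesgue)"
proof -
  define J where "J = (\<integral>\<^sup>+x. (ennreal (norm (v x *\<^sub>R f x)))\<^sup>2 \<partial>lebesgue)"
  have "L2w_norm v f = (if J = \<infinity> then \<infinity> else ennreal (sqrt (enn2real J)))"
    by (simp only: L2w_norm_def Let_def J_def)
  then have "(L2w_norm v f)\<^sup>2 = J"
    by (cases J rule: ennreal_cases) (auto simp: ennreal_power)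
  then show ?thesis by (simp only: J_def)
qed

lemma inv_fourier_integral_eq:
  assumes "f \<in> borel_measurable borel"
  shows "inv_fourier_integral f x = ift f x"
  unfolding inv_fourier_integral_def ift_def using assms by (intro integral_completion) auto

lemma sphere_null: "AE x in lborel. norm (x::'a::euclidean_space) \<noteq> R"
proof -
  have "sphere (0::'a) R \<in> null_sets lebesgue"
    using negligible_sphere negligible_iff_null_sets by blast
  then have "sphere (0::'a) R \<in> null_sets lborel"
    by (simp add: null_sets_completion_iff)
  from AE_not_in[OF this] show ?thesis by (simp add: dist_norm)
qed

text \<open>The part of \<open>f\<close> cut off by the ball is continuous on the complement of the closed ball in \<open>D\<close>.\<close>
lemma ift_truncation:
  fixes f :: "'a::euclidean_space \<Rightarrow> complex"
  assumes f: "fourier_class D f"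
  shows "(\<integral>\<^sup>+x. (ennreal (norm (ift (\<lambda>\<xi>. indicator (ball 0 R) \<xi> * f \<xi>) x - ift f x)))\<^sup>2 \<partial>lborel)
    = ennreal (LINT \<xi>|lborel. indicator (- cball 0 R) \<xi> * (norm (f \<xi>))\<^sup>2)"
proof -
  note F = fourier_classD[OF f]
  note [measurable] = F(3)
  define h where "h \<xi> = indicator (- cball 0 R) \<xi> * f \<xi>" for \<xi>
  have nh: "(norm (h \<xi>))\<^sup>2 = indicator (- cball 0 R) \<xi> * (norm (f \<xi>))\<^sup>2" for \<xi>
    by (simp add: h_def norm_mult indicator_def)
  have c: "fourier_class (D - cball 0 R) h"
    unfolding fourier_class_def
  proof (intro conjI allI impI)
    show "integrable lborel h"
      by (rule Bochner_Integration.integrable_bound[OF F(2)]) (auto simp: h_def[abs_def] norm_mult indicator_def intro!: AE_I2)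
    show "sq_integrable h"
      by (rule Bochner_Integration.integrable_bound[OF F(4)]) (auto simp: h_def[abs_def] norm_mult indicator_def intro!: AE_I2)
    have "continuous_on (D - cball 0 R) f" using F(5) by (rule continuous_on_subset) auto
    then show "continuous_on (D - cball 0 R) h"
      by (rule continuous_on_eq) (auto simp: h_def)
  qed (use F in \<open>auto simp: h_def open_Diff\<close>)
  have d: "ift (\<lambda>\<xi>. indicator (ball 0 R) \<xi> * f \<xi>) x - ift f x = - ift h x" for x
  proof -
    have i: "integrable lborel (\<lambda>\<xi>. indicator (ball 0 R) \<xi> * f \<xi>)"
      by (rule Bochner_Integration.integrable_bound[OF F(2)]) (auto simp: norm_mult indicator_def intro!: AE_I2)
    \<comment> \<open>The open ball and the complement of the closed ball miss the sphere, so the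
      two pieces add up to \<open>f\<close> only almost everywhere.\<close>
    have "ift f x = ift (\<lambda>\<xi>. indicator (ball 0 R) \<xi> * f \<xi> + 1 * h \<xi>) x"
      unfolding ift_def
    proof (rule integral_cong_AE)
      show "AE \<xi> in lborel. f \<xi> * cis (2 * pi * (x \<bullet> \<xi>)) = (indicator (ball 0 R) \<xi> * f \<xi> + 1 * h \<xi>) * cis (2 * pi * (x \<bullet> \<xi>))"
        using sphere_null[of R] by eventually_elim (auto simp: h_def indicator_def)
    next
      have [measurable]: "ball (0::'a) R \<in> sets borel" "- cball (0::'a) R \<in> sets borel" by auto
      show "(\<lambda>\<xi>. (indicator (ball 0 R) \<xi> * f \<xi> + 1 * h \<xi>) * cis (2 * pi * (x \<bullet> \<xi>))) \<in> borel_measurable lborel"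
        unfolding h_def by measurable
    qed auto
    also have "\<dots> = ift (\<lambda>\<xi>. indicator (ball 0 R) \<xi> * f \<xi>) x + 1 * ift h x"
      by (rule ift_add_cmult[OF i fourier_classD(2)[OF c]])
    finally show ?thesis by simp
  qed
  have "(\<integral>\<^sup>+x. (ennreal (norm (ift (\<lambda>\<xi>. indicator (ball 0 R) \<xi> * f \<xi>) x - ift f x)))\<^sup>2 \<partial>lborel)
      = (\<integral>\<^sup>+x. ennreal ((norm (ift h x))\<^sup>2) \<partial>lborel)"
    by (simp add: d ennreal_power)
  also have "\<dots> = ennreal (LINT x|lborel. (norm (ift h x))\<^sup>2)"
    using plancherel(1)[OF fourier_classD(3,4,2,1,5,6)[OF c]] by (intro nn_integral_eq_integral) auto
  also have "(LINT x|lborel. (norm (ift h x))\<^sup>2) = (LINT \<xi>|lborel. (norm (h \<xi>))\<^sup>2)"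
    by (rule plancherel(2)[OF fourier_classD(3,4,2,1,5,6)[OF c]])
  finally show ?thesis by (simp add: nh)
qed

text \<open>\<open>ift f\<close> has the property by which \<open>inv_fourier f\<close> is selected.
  Any other function with this property is an \<open>L\<^sup>2\<close> limit of the same truncated
  integrals and hence agrees with it almost everywhere.\<close>

lemma inv_fourier_AE:
  fixes f :: "real^'n::finite \<Rightarrow> complex"
  assumes f: "fourier_class D f"
  shows "AE x in lebesgue. inv_fourier f x = ift f x" "inv_fourier f \<in> borel_measurable lebesgue"
proof -
  note F = fourier_classD[OF f]
  note [measurable] = F(3)
  define FR where "FR R x = inv_fourier_integral (\<lambda>\<xi>. indicator (ball 0 R) \<xi> * f \<xi>) x" for R x
  have FR: "FR R x = ift (\<lambda>\<xi>. indicator (ball 0 R) \<xi> * f \<xi>) x" for R x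
    unfolding FR_def by (rule inv_fourier_integral_eq) (intro borel_measurable_times borel_measurable_indicator F(3), simp)
  have iR: "integrable lborel (\<lambda>\<xi>. indicator (ball 0 R) \<xi> * f \<xi>)" for R
    by (rule Bochner_Integration.integrable_bound[OF F(2)]) (auto simp: norm_mult indicator_def intro!: AE_I2)
  have mFR: "FR R \<in> borel_measurable borel" for R
    unfolding FR[abs_def] by (rule ift_measurable[OF iR])
  note mi = ift_measurable[OF F(2)]
  define P where "P g \<longleftrightarrow> g \<in> L2w (\<lambda>_. 1) \<and> ((\<lambda>R. L2w_norm (\<lambda>_. 1) (\<lambda>x. FR R x - g x)) \<longlongrightarrow> 0) at_top" for g
  have nP: "(L2w_norm (\<lambda>_. 1) h)\<^sup>2 = (\<integral>\<^sup>+x. (ennreal (norm (h x)))\<^sup>2 \<partial>lebesgue)" for h :: "real^'n \<Rightarrow> complex"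
    by (simp add: L2w_norm_sq)
  have Pi: "P (ift f)"
    unfolding P_def
  proof
    have "(\<integral>\<^sup>+x. (ennreal (norm (ift f x)))\<^sup>2 \<partial>lebesgue) < \<infinity>"
      using plancherel(1)[OF F(3,4,2,1,5,6)] mi
      by (simp add: nn_integral_completion ennreal_power integrable_iff_bounded)
    then show "ift f \<in> L2w (\<lambda>_. 1)"
      using mi by (auto simp: L2w_def L2w_norm_def Let_def measurable_completion)
    define a where "a R = (LINT \<xi>|lborel. indicator (- cball 0 R) \<xi> * (norm (f \<xi>))\<^sup>2)" for R
    have a: "(a \<longlongrightarrow> (LINT \<xi>::real^'n|lborel. 0)) at_top"
      unfolding a_def
    proof (rule integral_dominated_convergence_at_top[OF _ _ F(4)])
      show "\<forall>\<^sub>F R in at_top. AE \<xi> in lborel. norm (indicator (- cball 0 R) \<xi> * (norm (f \<xi>))\<^sup>2) \<le> (norm (f \<xi>))\<^sup>2"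
        by (intro always_eventually allI AE_I2) (auto simp: indicator_def)
      show "AE \<xi> in lborel. ((\<lambda>R. indicator (- cball 0 R) \<xi> * (norm (f \<xi>))\<^sup>2) \<longlongrightarrow> 0) at_top"
      proof (intro AE_I2 tendsto_eventually)
        fix \<xi> :: "real^'n"
        show "\<forall>\<^sub>F R in at_top. indicator (- cball 0 R) \<xi> * (norm (f \<xi>))\<^sup>2 = 0"
          using eventually_ge_at_top[of "norm \<xi>"] by eventually_elim (auto simp: indicator_def)
      qed
    qed auto
    have eq: "L2w_norm (\<lambda>_. 1) (\<lambda>x. FR R x - ift f x) = ennreal (sqrt (a R))" for R
    proof -
      have "(\<integral>\<^sup>+x. (ennreal (norm (FR R x - ift f x)))\<^sup>2 \<partial>lebesgue) = (\<integral>\<^sup>+x. (ennreal (norm (FR R x - ift f x)))\<^sup>2 \<partial>lborel)"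
        by (rule nn_integral_completion)
      also have "\<dots> = ennreal (a R)" unfolding FR a_def by (rule ift_truncation[OF f])
      moreover have "0 \<le> a R" unfolding a_def by (intro Bochner_Integration.integral_nonneg) auto
      ultimately show ?thesis by (simp add: L2w_norm_def)
    qed
    have "((\<lambda>R. ennreal (sqrt (a R))) \<longlongrightarrow> ennreal (sqrt 0)) at_top"
      using a by (intro tendsto_ennrealI tendsto_intros) simp
    then show "((\<lambda>R. L2w_norm (\<lambda>_. 1) (\<lambda>x. FR R x - ift f x)) \<longlongrightarrow> 0) at_top"
      by (simp add: eq)
  qed
  define g where "g = inv_fourier f"
  have "g = (SOME g. P g)" unfolding g_def inv_fourier_def P_def FR_def ..
  then have Pg: "P g" using someI[of P, OF Pi] by simp
  have mg: "g \<in> borel_measurable lebesgue" using Pg by (auto simp: P_def L2w_def)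
  then show "inv_fourier f \<in> borel_measurable lebesgue" by (simp add: g_def)
  have mil: "ift f \<in> borel_measurable lebesgue" using mi by (simp add: measurable_completion)
  have mFRl: "FR R \<in> borel_measurable lebesgue" for R using mFR by (simp add: measurable_completion)
  have "(\<integral>\<^sup>+x. (ennreal (norm (g x - ift f x)))\<^sup>2 \<partial>lebesgue) \<le> 0"
  proof (rule ennreal_le_epsilon)
    fix e :: real assume e: "0 < e"
    \<comment> \<open>The minimum with 1 makes the square of \<open>e'\<close> at most
      \<open>e'\<close>, and the quarter makes \<open>2 * e' + 2 * e' \<le> e\<close>.\<close>
    define e' where "e' = min 1 (e / 4)"
    have e': "0 < e'" "e' \<le> 1" "4 * e' \<le> e" using e by (auto simp: e'_def)
    have "\<forall>\<^sub>F R in at_top. L2w_norm (\<lambda>_. 1) (\<lambda>x. FR R x - g x) < ennreal e' \<and> L2w_norm (\<lambda>_. 1) (\<lambda>x. FR R x - ift f x) < ennreal e'"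
      using Pg Pi e' unfolding P_def by (intro eventually_conj order_tendstoD(2)) auto
    then obtain R where R: "L2w_norm (\<lambda>_. 1) (\<lambda>x. FR R x - g x) < ennreal e'" "L2w_norm (\<lambda>_. 1) (\<lambda>x. FR R x - ift f x) < ennreal e'"
      using eventually_happens'[OF trivial_limit_at_top_linorder] by blast
    have sq: "(\<integral>\<^sup>+x. (ennreal (norm (h x)))\<^sup>2 \<partial>lebesgue) \<le> ennreal e'" if "L2w_norm (\<lambda>_. 1) h < ennreal e'" for h :: "real^'n \<Rightarrow> complex"
    proof -
      have "(L2w_norm (\<lambda>_. 1) h)\<^sup>2 \<le> (ennreal e')\<^sup>2" using that by (intro power_mono) auto
      also have "\<dots> = ennreal (e'\<^sup>2)"
        using e' by (simp add: ennreal_power)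
      also have "\<dots> \<le> ennreal e'"
        using e' by (intro ennreal_leI) (simp add: power2_eq_square mult_left_le_one_le)
      finally show ?thesis by (simp add: nP)
    qed
    have "(\<integral>\<^sup>+x. (ennreal (norm (g x - ift f x)))\<^sup>2 \<partial>lebesgue)
        \<le> (\<integral>\<^sup>+x. 2 * (ennreal (norm (FR R x - g x)))\<^sup>2 + 2 * (ennreal (norm (FR R x - ift f x)))\<^sup>2 \<partial>lebesgue)"
    proof (rule nn_integral_mono)
      fix x
      have "(norm (g x - ift f x))\<^sup>2 \<le> 2 * (norm (FR R x - g x))\<^sup>2 + 2 * (norm (FR R x - ift f x))\<^sup>2"
        using norm_add_sq_le[of "- (FR R x - g x)" "FR R x - ift f x"] by (simp only: norm_minus_cancel) simp
      then have "ennreal ((norm (g x - ift f x))\<^sup>2) \<le> ennreal (2 * (norm (FR R x - g x))\<^sup>2 + 2 * (norm (FR R x - ift f x))\<^sup>2)"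
        by (rule ennreal_leI)
      then show "(ennreal (norm (g x - ift f x)))\<^sup>2 \<le> 2 * (ennreal (norm (FR R x - g x)))\<^sup>2 + 2 * (ennreal (norm (FR R x - ift f x)))\<^sup>2"
        by (simp add: ennreal_power ennreal_mult' ennreal_plus)
    qed
    also have "\<dots> = 2 * (\<integral>\<^sup>+x. (ennreal (norm (FR R x - g x)))\<^sup>2 \<partial>lebesgue) + 2 * (\<integral>\<^sup>+x. (ennreal (norm (FR R x - ift f x)))\<^sup>2 \<partial>lebesgue)"
      using mg mil mFRl[of R] by (subst nn_integral_add) (auto simp: nn_integral_cmult)
    also have "\<dots> \<le> 2 * ennreal e' + 2 * ennreal e'"
      using R by (intro add_mono mult_left_mono sq) auto
    also have "\<dots> = ennreal (4 * e')" using e' by (simp add: ennreal_mult' flip: distrib_right)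
    also have "\<dots> \<le> ennreal e" using e' by (intro ennreal_leI)
    finally show "(\<integral>\<^sup>+x. (ennreal (norm (g x - ift f x)))\<^sup>2 \<partial>lebesgue) \<le> 0 + ennreal e" by simp
  qed
  then have "(\<integral>\<^sup>+x. (ennreal (norm (g x - ift f x)))\<^sup>2 \<partial>lebesgue) = 0" by simp
  then have "AE x in lebesgue. (ennreal (norm (g x - ift f x)))\<^sup>2 = 0"
    using mg mil by (subst (asm) nn_integral_0_iff_AE) auto
  then show "AE x in lebesgue. inv_fourier f x = ift f x"
    by eventually_elim (auto simp: g_def ennreal_power)
qed

text \<open>Translating the transforms by \<open>z\<close> and \<open>y\<close> modulates the
  functions by opposite frequencies; after Parseval only the difference \<open>y - z\<close>
  remains.\<close>

lemma L2_inner_translate_inv_fourier: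
  fixes f g :: "real^'n::finite \<Rightarrow> complex"
  assumes f: "fourier_class D f" and g: "fourier_class D g"
  shows "L2_inner (translate z (inv_fourier f)) (translate y (inv_fourier g))
    = (LINT \<xi>|lborel. f \<xi> * cnj (g \<xi>) * cis (2 * pi * ((y - z) \<bullet> \<xi>)))"
proof -
  define fz where "fz \<xi> = f \<xi> * cis (2 * pi * ((- z) \<bullet> \<xi>))" for \<xi>
  define gy where "gy \<xi> = g \<xi> * cis (2 * pi * ((- y) \<bullet> \<xi>))" for \<xi>
  have fz: "fourier_class D fz" and gy: "fourier_class D gy"
    unfolding fz_def gy_def by (rule fourier_class_modulate[OF f], rule fourier_class_modulate[OF g])
  have iz: "ift fz x = ift f (x - z)" and iy: "ift gy x = ift g (x - y)" for x
    unfolding fz_def gy_def ift_modulate by simp_all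
  have tr: "AE x in lebesgue. inv_fourier h (x - u) = ift h (x - u)" if "fourier_class D h" for h and u :: "real^'n"
    using AE_lborel_translate[of "\<lambda>x. inv_fourier h x = ift h x" u] inv_fourier_AE(1)[OF that]
    by (simp add: AE_lebesgue_iff)
  have m: "(\<lambda>x. ift fz x * cnj (ift gy x)) \<in> borel_measurable borel"
    using ift_measurable[OF fourier_classD(2)[OF fz]] ift_measurable[OF fourier_classD(2)[OF gy]] by measurable
  have ae: "AE x in lebesgue. ift fz x * cnj (ift gy x) = inv_fourier f (x - z) * cnj (inv_fourier g (x - y))"
    using tr[OF f, of z] tr[OF g, of y] by eventually_elim (simp add: iz iy)
  have ml: "(\<lambda>x. ift fz x * cnj (ift gy x)) \<in> borel_measurable lebesgue"
    using m by (simp add: measurable_completion)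
  have "L2_inner (translate z (inv_fourier f)) (translate y (inv_fourier g))
      = (LINT x|lebesgue. inv_fourier f (x - z) * cnj (inv_fourier g (x - y)))"
    by (simp add: L2_inner_def translate_def)
  \<comment> \<open>The integrand with the selected representatives is measurable because it agrees
    almost everywhere with a Borel function and Lebesgue measure is complete.\<close>
  also have "\<dots> = (LINT x|lebesgue. ift fz x * cnj (ift gy x))"
    using ae by (intro integral_cong_AE borel_measurable_AE[OF ml ae] ml) auto
  also have "\<dots> = (LINT x|lborel. ift fz x * cnj (ift gy x))"
    using m by (intro integral_completion) simp
  also have "\<dots> = (LINT \<xi>|lborel. fz \<xi> * cnj (gy \<xi>))"
    by (rule parseval[OF fz gy])
  also have "\<dots> = (LINT \<xi>|lborel. f \<xi> * cnj (g \<xi>) * cis (2 * pi * ((y - z) \<bullet> \<xi>)))"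
  proof (intro Bochner_Integration.integral_cong refl)
    fix \<xi>
    have "cis (2 * pi * ((- z) \<bullet> \<xi>)) * cnj (cis (2 * pi * ((- y) \<bullet> \<xi>))) = cis (2 * pi * ((y - z) \<bullet> \<xi>))"
      by (simp add: cis_cnj cis_mult inner_diff_left algebra_simps)
    then show "fz \<xi> * cnj (gy \<xi>) = f \<xi> * cnj (g \<xi>) * cis (2 * pi * ((y - z) \<bullet> \<xi>))"
      by (simp add: fz_def gy_def mult_ac)
  qed
  finally show ?thesis .
qed

subsection \<open>Measurability in the kernel norm\<close>

text \<open>
  Since \<open>esssup\<close> takes the value \<open>\<infinity>\<close> on non-measurable functions, a bound for \<open>B_norm\<close> needs the
  measurability of all its marginals, obtained from a Borel representative of the weighted kernel.
\<close>

lemma borel_measurable_completion_AE: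
  fixes f g :: "'a \<Rightarrow> 'b::topological_space"
  assumes g: "g \<in> borel_measurable (completion M)" and ae: "AE x in M. f x = g x"
  shows "f \<in> borel_measurable (completion M)"
proof (rule measurableI)
  fix B :: "'b set" assume B: "B \<in> sets borel"
  have "Measurable.pred (completion M) (\<lambda>x. f x \<noteq> g x)"
    by (rule sets_completion_AE) (use ae in auto)
  then have 1: "{x \<in> space M. f x \<noteq> g x} \<in> sets (completion M)"
    by (simp add: pred_def)
  have "Measurable.pred (completion M) (\<lambda>x. f x \<noteq> g x \<and> f x \<in> B)"
    by (rule sets_completion_AE) (use ae in auto)
  then have 2: "{x \<in> space M. f x \<noteq> g x \<and> f x \<in> B} \<in> sets (completion M)"
    by (simp add: pred_def)
  have "g -` B \<inter> space (completion M) \<in> sets (completion M)"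
    using g B by (rule measurable_sets)
  then have "(g -` B \<inter> space M - {x \<in> space M. f x \<noteq> g x}) \<union> {x \<in> space M. f x \<noteq> g x \<and> f x \<in> B} \<in> sets (completion M)"
    using 1 2 by auto
  also have "(g -` B \<inter> space M - {x \<in> space M. f x \<noteq> g x}) \<union> {x \<in> space M. f x \<noteq> g x \<and> f x \<in> B} = f -` B \<inter> space (completion M)"
    by auto
  finally show "f -` B \<inter> space (completion M) \<in> sets (completion M)" .
qed auto

lemma esssup_le_iff:
  fixes f :: "'a \<Rightarrow> ennreal"
  assumes "f \<in> borel_measurable M"
  shows "esssup M f \<le> c \<longleftrightarrow> (AE x in M. f x \<le> c)"
proof
  assume "esssup M f \<le> c"
  with esssup_AE[of f M] show "AE x in M. f x \<le> c" by (auto elim: eventually_mono)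
qed (rule esssup_I[OF assms])

text \<open>The condition \<open>esssup M (F p) \<le> c\<close> says that the indicator of an
  exceptional set has integral 0, and this integral depends measurably on \<open>p\<close>.\<close>

lemma (in sigma_finite_measure) borel_measurable_esssup:
  fixes F :: "'b \<Rightarrow> 'a \<Rightarrow> ennreal"
  assumes F[measurable]: "case_prod F \<in> borel_measurable (N \<Otimes>\<^sub>M M)"
  shows "(\<lambda>p. esssup M (F p)) \<in> borel_measurable N"
proof (rule borel_measurableI_le)
  fix c
  have Fp[measurable]: "F p \<in> borel_measurable M" if "p \<in> space N" for p
    using measurable_Pair2[OF F that] by simp
  have "{p \<in> space N. esssup M (F p) \<le> c} = {p \<in> space N. (\<integral>\<^sup>+x. indicator {x. \<not> F p x \<le> c} x \<partial>M) = 0}"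
  proof (intro Collect_cong conj_cong refl)
    fix p assume p: "p \<in> space N"
    note [measurable] = Fp[OF p]
    have "(\<lambda>x. indicator {x. \<not> F p x \<le> c} x :: ennreal) \<in> borel_measurable M" by measurable
    then have "(\<integral>\<^sup>+x. indicator {x. \<not> F p x \<le> c} x \<partial>M) = 0 \<longleftrightarrow> (AE x in M. (indicator {x. \<not> F p x \<le> c} x :: ennreal) = 0)"
      by (rule nn_integral_0_iff_AE)
    then show "esssup M (F p) \<le> c \<longleftrightarrow> (\<integral>\<^sup>+x. indicator {x. \<not> F p x \<le> c} x \<partial>M) = 0"
      by (simp add: esssup_le_iff[OF Fp[OF p]] indicator_eq_0_iff)
  qed
  also have "\<dots> \<in> sets N"
    by measurable
  finally show "{p \<in> space N. esssup M (F p) \<le> c} \<in> sets N" .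
qed

section \<open>Tonelli and slices on products of Euclidean spaces\<close>

lemma nn_integral_lborel_prod:
  fixes f :: "'a::euclidean_space \<times> 'b::euclidean_space \<Rightarrow> ennreal"
  assumes "f \<in> borel_measurable borel"
  shows "(\<integral>\<^sup>+x. f x \<partial>lborel) = (\<integral>\<^sup>+x. \<integral>\<^sup>+y. f (x, y) \<partial>lborel \<partial>lborel)"
  using assms lborel.nn_integral_fst[of f "lborel :: 'a measure"] by (simp add: lborel_prod)

lemma borel_measurable_nn_integral_lborel:
  fixes f :: "'a::euclidean_space \<times> 'b::euclidean_space \<Rightarrow> ennreal"
  assumes "f \<in> borel_measurable borel"
  shows "(\<lambda>x. \<integral>\<^sup>+y. f (x, y) \<partial>lborel) \<in> borel_measurable borel"
  using assms lborel.borel_measurable_nn_integral_fst[of f "lborel :: 'a measure"] by (simp add: lborel_prod)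

lemma nn_integral_lborel_swap:
  fixes f :: "'a::euclidean_space \<times> 'b::euclidean_space \<Rightarrow> ennreal"
  assumes "f \<in> borel_measurable borel"
  shows "(\<integral>\<^sup>+x. \<integral>\<^sup>+y. f (x, y) \<partial>lborel \<partial>lborel) = (\<integral>\<^sup>+y. \<integral>\<^sup>+x. f (x, y) \<partial>lborel \<partial>lborel)"
  using assms by (intro lborel_pair.Fubini'[symmetric]) (simp add: lborel_prod)

lemma borel_measurable_compose_continuous:
  assumes "F \<in> borel_measurable borel" "continuous_on UNIV g"
  shows "(\<lambda>x. F (g x)) \<in> borel_measurable borel"
  using measurable_compose[OF borel_measurable_continuous_onI[OF assms(2)] assms(1)] .

text \<open>Phase-space points come as \<open>((y, \<omega>), (z, \<eta>))\<close>, but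
  \<open>B_norm\<close> fixes both frequencies before integrating in \<open>y\<close> and
  \<open>z\<close>. The regrouping preserves null sets: Tonelli is applied to the indicator of an
  exceptional set, one exchange at a time.\<close>

lemma AE_lborel_permute:
  fixes P :: "((real^'n::finite) \<times> (real^'n)) \<times> ((real^'n) \<times> (real^'n)) \<Rightarrow> bool"
  assumes "AE x in lborel. P x"
  shows "AE x in lborel. P ((fst (snd x), fst (fst x)), (snd (snd x), snd (fst x)))"
proof -
  obtain B where B: "B \<in> null_sets lborel" "{x. \<not> P x} \<subseteq> B"
    using assms unfolding eventually_ae_filter by auto
  define F :: "((real^'n) \<times> (real^'n)) \<times> ((real^'n) \<times> (real^'n)) \<Rightarrow> ennreal" where "F = indicator B"
  have F: "F \<in> borel_measurable borel"
    using B(1) unfolding F_def by (intro borel_measurable_indicator) auto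
  note C = borel_measurable_compose_continuous[OF F]
  note I = borel_measurable_nn_integral_lborel
  define T where "T x = F ((fst (snd x), fst (fst x)), (snd (snd x), snd (fst x)))" for x
  have T: "T \<in> borel_measurable borel"
    unfolding T_def by (intro C continuous_intros)
  note CT = borel_measurable_compose_continuous[OF T]
  have "(\<integral>\<^sup>+x. T x \<partial>lborel) = (\<integral>\<^sup>+p. \<integral>\<^sup>+q. T (p, q) \<partial>lborel \<partial>lborel)"
    by (rule nn_integral_lborel_prod[OF T])
  also have "\<dots> = (\<integral>\<^sup>+\<omega>. \<integral>\<^sup>+\<eta>. \<integral>\<^sup>+q. T ((\<omega>, \<eta>), q) \<partial>lborel \<partial>lborel \<partial>lborel)"
    by (rule nn_integral_lborel_prod[OF I[OF T]])
  also have "\<dots> = (\<integral>\<^sup>+\<omega>. \<integral>\<^sup>+\<eta>. \<integral>\<^sup>+y. \<integral>\<^sup>+z. F ((y, \<omega>), (z, \<eta>)) \<partial>lborel \<partial>lborel \<partial>lborel \<partial>lborel)"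
    by (subst nn_integral_lborel_prod, intro CT continuous_intros) (simp add: T_def)
  also have "\<dots> = (\<integral>\<^sup>+\<omega>. \<integral>\<^sup>+y. \<integral>\<^sup>+\<eta>. \<integral>\<^sup>+z. F ((y, \<omega>), (z, \<eta>)) \<partial>lborel \<partial>lborel \<partial>lborel \<partial>lborel)"
  proof (rule nn_integral_cong)
    fix \<omega> :: "real^'n"
    have "(\<lambda>p. \<integral>\<^sup>+z. F ((snd p, \<omega>), (z, fst p)) \<partial>lborel) \<in> borel_measurable borel"
      using I[of "\<lambda>x. F ((snd (fst x), \<omega>), (snd x, fst (fst x)))"] by (simp add: C continuous_intros)
    from nn_integral_lborel_swap[OF this]
    show "(\<integral>\<^sup>+\<eta>. \<integral>\<^sup>+y. \<integral>\<^sup>+z. F ((y, \<omega>), (z, \<eta>)) \<partial>lborel \<partial>lborel \<partial>lborel)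
        = (\<integral>\<^sup>+y. \<integral>\<^sup>+\<eta>. \<integral>\<^sup>+z. F ((y, \<omega>), (z, \<eta>)) \<partial>lborel \<partial>lborel \<partial>lborel)" by simp
  qed
  also have "\<dots> = (\<integral>\<^sup>+\<omega>. \<integral>\<^sup>+y. \<integral>\<^sup>+q. F ((y, \<omega>), q) \<partial>lborel \<partial>lborel \<partial>lborel)"
  proof (intro nn_integral_cong)
    fix \<omega> y :: "real^'n"
    have 1: "(\<lambda>p. F ((y, \<omega>), (snd p, fst p))) \<in> borel_measurable borel"
      "(\<lambda>q. F ((y, \<omega>), q)) \<in> borel_measurable borel"
      by (intro C continuous_intros)+
    show "(\<integral>\<^sup>+\<eta>. \<integral>\<^sup>+z. F ((y, \<omega>), (z, \<eta>)) \<partial>lborel \<partial>lborel) = (\<integral>\<^sup>+q. F ((y, \<omega>), q) \<partial>lborel)"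
      using nn_integral_lborel_swap[OF 1(1)] nn_integral_lborel_prod[OF 1(2)] by simp
  qed
  also have "\<dots> = (\<integral>\<^sup>+y. \<integral>\<^sup>+\<omega>. \<integral>\<^sup>+q. F ((y, \<omega>), q) \<partial>lborel \<partial>lborel \<partial>lborel)"
  proof -
    have "(\<lambda>p. \<integral>\<^sup>+q. F ((snd p, fst p), q) \<partial>lborel) \<in> borel_measurable borel"
      using I[of "\<lambda>x. F ((snd (fst x), fst (fst x)), snd x)"] by (simp add: C continuous_intros)
    from nn_integral_lborel_swap[OF this] show ?thesis by simp
  qed
  also have "\<dots> = (\<integral>\<^sup>+x. F x \<partial>lborel)"
    by (simp only: nn_integral_lborel_prod[OF F] nn_integral_lborel_prod[OF I[OF F]])
  also have "\<dots> = 0"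
    using B(1) unfolding F_def by (subst nn_integral_indicator) auto
  finally have "AE x in lborel. T x = 0"
    using T by (subst (asm) nn_integral_0_iff_AE) auto
  then show ?thesis
    by eventually_elim (use B(2) in \<open>auto simp: T_def F_def indicator_def split: if_splits\<close>)
qed

lemma AE_lborel_pair:
  fixes Q :: "'a::euclidean_space \<Rightarrow> 'b::euclidean_space \<Rightarrow> bool"
  assumes "AE p in lborel. Q (fst p) (snd p)"
  shows "AE x in lborel. AE y in lborel. Q x y" "AE y in lborel. AE x in lborel. Q x y"
proof -
  have 1: "AE p in lborel \<Otimes>\<^sub>M lborel. Q (fst p) (snd p)"
    unfolding lborel_prod by (rule assms)
  from lborel_pair.AE_pair[OF 1] show "AE x in lborel. AE y in lborel. Q x y" by simp
  have "AE p in distr (lborel \<Otimes>\<^sub>M lborel) (lborel \<Otimes>\<^sub>M lborel) (\<lambda>(x, y). (y, x)). Q (fst p) (snd p)"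
    using 1 by (simp only: lborel_pair.distr_pair_swap[symmetric])
  from AE_distrD[OF _ this] have "AE p in lborel \<Otimes>\<^sub>M lborel. Q (snd p) (fst p)"
    by (simp add: case_prod_beta measurable_pair_swap')
  from lborel_pair.AE_pair[OF this] show "AE y in lborel. AE x in lborel. Q x y" by simp
qed

text \<open>The inner and the outer norm each take both marginals, so an exceptional null set must
  be negligible for every order of slicing.\<close>

lemma AE_A1_slices:
  fixes H H' :: "((real^'n::finite) \<times> (real^'n)) \<times> ((real^'n) \<times> (real^'n)) \<Rightarrow> ennreal"
  assumes "AE x in lborel. H x = H' x"
  shows "AE \<omega> in lborel. AE \<eta> in lborel.
      (AE y in lborel. AE z in lborel. H ((y, \<omega>), (z, \<eta>)) = H' ((y, \<omega>), (z, \<eta>))) \<and>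
      (AE z in lborel. AE y in lborel. H ((y, \<omega>), (z, \<eta>)) = H' ((y, \<omega>), (z, \<eta>)))" (is ?A)
    and "AE \<eta> in lborel. AE \<omega> in lborel.
      (AE y in lborel. AE z in lborel. H ((y, \<omega>), (z, \<eta>)) = H' ((y, \<omega>), (z, \<eta>))) \<and>
      (AE z in lborel. AE y in lborel. H ((y, \<omega>), (z, \<eta>)) = H' ((y, \<omega>), (z, \<eta>)))" (is ?B)
proof -
  have "AE x in lborel. H ((fst (snd x), fst (fst x)), (snd (snd x), snd (fst x))) = H' ((fst (snd x), fst (fst x)), (snd (snd x), snd (fst x)))"
    by (rule AE_lborel_permute[OF assms])
  then have "AE p in lborel. AE q in lborel. H ((fst q, fst p), (snd q, snd p)) = H' ((fst q, fst p), (snd q, snd p))"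
    by (rule AE_lborel_pair(1))
  then have "AE p in lborel.
      (AE y in lborel. AE z in lborel. H ((y, fst p), (z, snd p)) = H' ((y, fst p), (z, snd p))) \<and>
      (AE z in lborel. AE y in lborel. H ((y, fst p), (z, snd p)) = H' ((y, fst p), (z, snd p)))"
  proof eventually_elim
    case (elim p)
    from AE_lborel_pair[of "\<lambda>y z. H ((y, fst p), (z, snd p)) = H' ((y, fst p), (z, snd p))", OF elim] show ?case by blast
  qed
  from AE_lborel_pair[of "\<lambda>\<omega> \<eta>. (AE y in lborel. AE z in lborel. H ((y, \<omega>), (z, \<eta>)) = H' ((y, \<omega>), (z, \<eta>))) \<and>
      (AE z in lborel. AE y in lborel. H ((y, \<omega>), (z, \<eta>)) = H' ((y, \<omega>), (z, \<eta>)))", OF this] show ?A ?B by simp_all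
qed

text \<open>A value is determined by its upper bounds, and for measurable functions these are
  almost-everywhere statements, on which the two functions and the two measures agree.\<close>

lemma esssup_lebesgue_eq:
  fixes G G' :: "'a::euclidean_space \<Rightarrow> ennreal"
  assumes ae: "AE y in lborel. G y = G' y" and G': "G' \<in> borel_measurable borel"
  shows "G \<in> borel_measurable lebesgue" "esssup lebesgue G = esssup lborel G'"
proof -
  show G: "G \<in> borel_measurable lebesgue"
    by (rule borel_measurable_completion_AE[OF _ ae]) (use G' in \<open>simp add: measurable_completion\<close>)
  have "esssup lebesgue G \<le> c \<longleftrightarrow> esssup lborel G' \<le> c" for c
  proof -
    have "esssup lebesgue G \<le> c \<longleftrightarrow> (AE y in lborel. G y \<le> c)"
      by (simp add: esssup_le_iff[OF G] AE_lebesgue_iff)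
    also have "\<dots> \<longleftrightarrow> (AE y in lborel. G' y \<le> c)"
      using ae by (auto elim: eventually_elim2)
    finally show ?thesis using G' by (simp add: esssup_le_iff)
  qed
  then show "esssup lebesgue G = esssup lborel G'"
    by (intro antisym) auto
qed

lemma A1_norm_lebesgue_eq:
  fixes F F' :: "'a::euclidean_space \<Rightarrow> 'a \<Rightarrow> ennreal"
  assumes F': "(\<lambda>p. F' (fst p) (snd p)) \<in> borel_measurable borel"
    and ae: "AE y in lborel. AE z in lborel. F y z = F' y z" "AE z in lborel. AE y in lborel. F y z = F' y z"
  shows "A1_norm lebesgue F = A1_norm lborel F'"
    and "(\<And>y. (\<integral>\<^sup>+z. F y z \<partial>lebesgue) \<le> c) \<Longrightarrow> (\<And>z. (\<integral>\<^sup>+y. F y z \<partial>lebesgue) \<le> c) \<Longrightarrow> A1_norm lebesgue F \<le> c"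
proof -
  have F'2: "(\<lambda>p. F' (snd p) (fst p)) \<in> borel_measurable borel"
    using borel_measurable_compose_continuous[OF F', of "\<lambda>p. (snd p, fst p)"] by (simp add: continuous_intros)
  have 1: "AE y in lborel. (\<integral>\<^sup>+z. F y z \<partial>lebesgue) = (\<integral>\<^sup>+z. F' y z \<partial>lborel)"
    using ae(1) by eventually_elim (simp add: nn_integral_completion cong: nn_integral_cong_AE)
  have 2: "AE z in lborel. (\<integral>\<^sup>+y. F y z \<partial>lebesgue) = (\<integral>\<^sup>+y. F' y z \<partial>lborel)"
    using ae(2) by eventually_elim (simp add: nn_integral_completion cong: nn_integral_cong_AE)
  have m1: "(\<lambda>y. \<integral>\<^sup>+z. F' y z \<partial>lborel) \<in> borel_measurable borel"
    using borel_measurable_nn_integral_lborel[OF F'] by simp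
  have m2: "(\<lambda>z. \<integral>\<^sup>+y. F' y z \<partial>lborel) \<in> borel_measurable borel"
    using borel_measurable_nn_integral_lborel[OF F'2] by simp
  note e1 = esssup_lebesgue_eq[OF 1 m1] and e2 = esssup_lebesgue_eq[OF 2 m2]
  show "A1_norm lebesgue F = A1_norm lborel F'"
    unfolding A1_norm_def e1(2) e2(2) ..
  show "A1_norm lebesgue F \<le> c" if "\<And>y. (\<integral>\<^sup>+z. F y z \<partial>lebesgue) \<le> c" "\<And>z. (\<integral>\<^sup>+y. F y z \<partial>lebesgue) \<le> c"
    unfolding A1_norm_def using that by (simp add: esssup_le_iff[OF e1(1)] esssup_le_iff[OF e2(1)])
qed

text \<open>The Borel function \<open>b\<close> supplies measurability of the marginal, the majorant
  \<open>L\<close> its size.\<close>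

lemma esssup_lebesgue_on_nn_integral_le:
  fixes a b L :: "'a::euclidean_space \<Rightarrow> 'a \<Rightarrow> ennreal"
  assumes D: "open D"
    and ae: "AE \<omega> in lborel. AE \<eta> in lborel. \<omega> \<in> D \<longrightarrow> \<eta> \<in> D \<longrightarrow> a \<omega> \<eta> = b \<omega> \<eta> \<and> a \<omega> \<eta> \<le> L \<omega> \<eta>"
    and b: "(\<lambda>p. b (fst p) (snd p)) \<in> borel_measurable borel"
    and L: "\<And>\<omega>. \<omega> \<in> D \<Longrightarrow> (\<integral>\<^sup>+\<eta>. L \<omega> \<eta> * indicator D \<eta> \<partial>lebesgue) \<le> c"
  shows "esssup (lebesgue_on D) (\<lambda>\<omega>. \<integral>\<^sup>+\<eta>. a \<omega> \<eta> \<partial>lebesgue_on D) \<le> c"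
proof -
  have Db: "D \<in> sets borel" using D by auto
  have Ds: "D \<inter> space lebesgue \<in> sets lebesgue" using Db by auto
  have res: "(\<integral>\<^sup>+\<eta>. a \<omega> \<eta> \<partial>lebesgue_on D) = (\<integral>\<^sup>+\<eta>. a \<omega> \<eta> * indicator D \<eta> \<partial>lborel)" for \<omega>
    by (simp only: nn_integral_restrict_space[OF Ds] nn_integral_completion)
  define f where "f \<omega> = (\<integral>\<^sup>+\<eta>. a \<omega> \<eta> * indicator D \<eta> \<partial>lborel)" for \<omega>
  have 1: "AE \<omega> in lborel. f \<omega> * indicator D \<omega> = (\<integral>\<^sup>+\<eta>. b \<omega> \<eta> * indicator D \<eta> \<partial>lborel) * indicator D \<omega>"
    using ae
  proof eventually_elim
    case (elim \<omega>)
    show ?case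
    proof (cases "\<omega> \<in> D")
      case True
      have "f \<omega> = (\<integral>\<^sup>+\<eta>. b \<omega> \<eta> * indicator D \<eta> \<partial>lborel)"
        unfolding f_def using elim True by (intro nn_integral_cong_AE) (auto elim!: eventually_mono simp: indicator_def)
      then show ?thesis by simp
    qed simp
  qed
  have mb: "(\<lambda>\<omega>. (\<integral>\<^sup>+\<eta>. b \<omega> \<eta> * indicator D \<eta> \<partial>lborel) * indicator D \<omega>) \<in> borel_measurable borel"
  proof -
    have mi: "(indicator D :: 'a \<Rightarrow> ennreal) \<in> borel_measurable borel"
      using Db by (rule borel_measurable_indicator)
    have "(\<lambda>p. indicator D (snd p) :: ennreal) \<in> borel_measurable (borel :: ('a \<times> 'a) measure)"
      by (rule borel_measurable_compose_continuous[OF mi]) (intro continuous_intros)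
    from borel_measurable_times_ennreal[OF b this]
    have "(\<lambda>p. b (fst p) (snd p) * indicator D (snd p)) \<in> borel_measurable borel" .
    from borel_measurable_times_ennreal[OF borel_measurable_nn_integral_lborel[OF this] mi]
    show ?thesis by simp
  qed
  have mf: "f \<in> borel_measurable (lebesgue_on D)"
    unfolding borel_measurable_restrict_space_iff_ennreal[OF Ds] by (rule esssup_lebesgue_eq(1)[OF 1 mb])
  have "AE \<omega> in lebesgue_on D. f \<omega> \<le> c"
    unfolding AE_restrict_space_iff[OF Ds] AE_lebesgue_iff
    using ae
  proof eventually_elim
    case (elim \<omega>)
    show ?case
    proof
      assume \<omega>: "\<omega> \<in> D"
      have "f \<omega> \<le> (\<integral>\<^sup>+\<eta>. L \<omega> \<eta> * indicator D \<eta> \<partial>lborel)"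
        unfolding f_def using elim \<omega> by (intro nn_integral_mono_AE) (auto elim!: eventually_mono simp: indicator_def)
      also have "\<dots> \<le> c" using L[OF \<omega>] by (simp only: nn_integral_completion)
      finally show "f \<omega> \<le> c" .
    qed
  qed
  then show ?thesis
    unfolding res f_def[symmetric] by (simp add: esssup_le_iff[OF mf])
qed

text \<open>A Schur test in two layers: \<open>L\<close> dominates both time marginals at fixed
  frequencies, and \<open>c\<close> dominates both frequency marginals of \<open>L\<close>.\<close>

lemma B_norm_le:
  fixes D :: "(real^'n::finite) set"
  assumes D: "open D"
    and m: "m \<in> borel_measurable (lebesgue_on ((UNIV \<times> D) \<times> (UNIV \<times> D)))"
    and K: "K \<in> borel_measurable (lebesgue_on ((UNIV \<times> D) \<times> (UNIV \<times> D)))"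
    and Ly: "\<And>\<omega> \<eta> y. \<omega> \<in> D \<Longrightarrow> \<eta> \<in> D \<Longrightarrow> (\<integral>\<^sup>+z. ennreal (norm (m ((y, \<omega>), (z, \<eta>)) *\<^sub>R K ((y, \<omega>), (z, \<eta>)))) \<partial>lebesgue) \<le> L \<omega> \<eta>"
    and Lz: "\<And>\<omega> \<eta> z. \<omega> \<in> D \<Longrightarrow> \<eta> \<in> D \<Longrightarrow> (\<integral>\<^sup>+y. ennreal (norm (m ((y, \<omega>), (z, \<eta>)) *\<^sub>R K ((y, \<omega>), (z, \<eta>)))) \<partial>lebesgue) \<le> L \<omega> \<eta>"
    and L\<omega>: "\<And>\<omega>. \<omega> \<in> D \<Longrightarrow> (\<integral>\<^sup>+\<eta>. L \<omega> \<eta> * indicator D \<eta> \<partial>lebesgue) \<le> c"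
    and L\<eta>: "\<And>\<eta>. \<eta> \<in> D \<Longrightarrow> (\<integral>\<^sup>+\<omega>. L \<omega> \<eta> * indicator D \<omega> \<partial>lebesgue) \<le> c"
  shows "B_norm D m K \<le> c"
proof -
  let ?\<Lambda> = "((UNIV :: (real^'n) set) \<times> D) \<times> ((UNIV :: (real^'n) set) \<times> D)"
  define M where "M x = ennreal (norm (m x *\<^sub>R K x))" for x
  define H where "H x = M x * indicator ?\<Lambda> x" for x
  have "open ?\<Lambda>" using D by (intro open_Times) auto
  then have \<Lambda>: "?\<Lambda> \<inter> space lebesgue \<in> sets lebesgue" by auto
  have "M \<in> borel_measurable (lebesgue_on ?\<Lambda>)"
    unfolding M_def using borel_measurable_scaleR[OF m K] by measurable
  then have "H \<in> borel_measurable lebesgue"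
    unfolding H_def borel_measurable_restrict_space_iff_ennreal[OF \<Lambda>] .
  \<comment> \<open>The weighted kernel, cut off outside the frequency domain, is only Lebesgue
    measurable. Slices and marginals are measurable for a Borel representative and are transferred
    from there.\<close>
  then obtain H' where H': "H' \<in> borel_measurable borel" and ae: "AE x in lborel. H x = H' x"
    using completion_ex_borel_measurable[of H lborel] by auto
  define a where "a \<omega> \<eta> = A1_norm lebesgue (\<lambda>y z. M ((y, \<omega>), (z, \<eta>)))" for \<omega> \<eta>
  define b where "b \<omega> \<eta> = A1_norm lborel (\<lambda>y z. H' ((y, \<omega>), (z, \<eta>)))" for \<omega> \<eta>
  have HM: "H ((y, \<omega>), (z, \<eta>)) = M ((y, \<omega>), (z, \<eta>))" if "\<omega> \<in> D" "\<eta> \<in> D" for y z \<omega> \<eta>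
    using that by (simp add: H_def indicator_def)
  have ab: "a \<omega> \<eta> = b \<omega> \<eta> \<and> a \<omega> \<eta> \<le> L \<omega> \<eta>"
    if "\<omega> \<in> D" "\<eta> \<in> D" and g: "AE y in lborel. AE z in lborel. H ((y, \<omega>), (z, \<eta>)) = H' ((y, \<omega>), (z, \<eta>))"
      "AE z in lborel. AE y in lborel. H ((y, \<omega>), (z, \<eta>)) = H' ((y, \<omega>), (z, \<eta>))" for \<omega> \<eta>
  proof -
    have F': "(\<lambda>p. H' ((fst p, \<omega>), (snd p, \<eta>))) \<in> borel_measurable borel"
      by (intro borel_measurable_compose_continuous[OF H'] continuous_intros)
    note A = A1_norm_lebesgue_eq[of "\<lambda>y z. H' ((y, \<omega>), (z, \<eta>))", OF F' g, unfolded HM[OF that(1,2)]]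
    show ?thesis
      unfolding a_def b_def
      using A(1) A(2)[of "L \<omega> \<eta>"] Ly[OF that(1,2)] Lz[OF that(1,2)] by (simp add: M_def)
  qed
  have mm: "borel_measurable (borel \<Otimes>\<^sub>M lborel) = (borel_measurable borel :: (((real^'n) \<times> (real^'n)) \<times> (real^'n) \<Rightarrow> ennreal) set)"
    by (rule measurable_cong_sets) (simp_all add: borel_prod[symmetric] cong: sets_pair_measure_cong)
  have mb: "(\<lambda>p. b (fst p) (snd p)) \<in> borel_measurable borel"
    unfolding b_def A1_norm_def
  proof (intro borel_measurable_max lborel.borel_measurable_esssup)
    have "(\<lambda>x. \<integral>\<^sup>+z. H' ((snd x, fst (fst x)), (z, snd (fst x))) \<partial>lborel) \<in> borel_measurable borel"
      by (rule borel_measurable_nn_integral_lborel[of "\<lambda>u. H' ((snd (fst u), fst (fst (fst u))), (snd u, snd (fst (fst u))))", simplified])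
        (intro borel_measurable_compose_continuous[OF H'] continuous_intros)
    then show "(\<lambda>(p, y). \<integral>\<^sup>+z. H' ((y, fst p), (z, snd p)) \<partial>lborel) \<in> borel_measurable (borel \<Otimes>\<^sub>M lborel)"
      unfolding mm case_prod_beta' by simp
    have "(\<lambda>x. \<integral>\<^sup>+y. H' ((y, fst (fst x)), (snd x, snd (fst x))) \<partial>lborel) \<in> borel_measurable borel"
      by (rule borel_measurable_nn_integral_lborel[of "\<lambda>u. H' ((snd u, fst (fst (fst u))), (snd (fst u), snd (fst (fst u))))", simplified])
        (intro borel_measurable_compose_continuous[OF H'] continuous_intros)
    then show "(\<lambda>(p, z). \<integral>\<^sup>+y. H' ((y, fst p), (z, snd p)) \<partial>lborel) \<in> borel_measurable (borel \<Otimes>\<^sub>M lborel)"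
      unfolding mm case_prod_beta' by simp
  qed
  have mb': "(\<lambda>p. b (snd p) (fst p)) \<in> borel_measurable borel"
    using borel_measurable_compose_continuous[OF mb, of "\<lambda>p. (snd p, fst p)"] by (simp add: continuous_intros)
  have "esssup (lebesgue_on D) (\<lambda>\<omega>. \<integral>\<^sup>+\<eta>. a \<omega> \<eta> \<partial>lebesgue_on D) \<le> c"
  proof (rule esssup_lebesgue_on_nn_integral_le[OF D _ mb L\<omega>])
    show "AE \<omega> in lborel. AE \<eta> in lborel. \<omega> \<in> D \<longrightarrow> \<eta> \<in> D \<longrightarrow> a \<omega> \<eta> = b \<omega> \<eta> \<and> a \<omega> \<eta> \<le> L \<omega> \<eta>"
      using AE_A1_slices(1)[OF ae]
    proof (rule eventually_mono, goal_cases)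
      case (1 \<omega>)
      then show ?case
        by (rule eventually_mono) (intro impI, rule ab, assumption, assumption, erule conjunct1, erule conjunct2)
    qed
  qed
  moreover have "esssup (lebesgue_on D) (\<lambda>\<eta>. \<integral>\<^sup>+\<omega>. a \<omega> \<eta> \<partial>lebesgue_on D) \<le> c"
  proof (rule esssup_lebesgue_on_nn_integral_le[OF D _ mb' L\<eta>, of "\<lambda>\<eta> \<omega>. a \<omega> \<eta>"])
    show "AE \<eta> in lborel. AE \<omega> in lborel. \<eta> \<in> D \<longrightarrow> \<omega> \<in> D \<longrightarrow> a \<omega> \<eta> = b \<omega> \<eta> \<and> a \<omega> \<eta> \<le> L \<omega> \<eta>"
      using AE_A1_slices(2)[OF ae]
    proof (rule eventually_mono, goal_cases)
      case (1 \<eta>)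
      then show ?case
        by (rule eventually_mono) (intro impI, rule ab, assumption, assumption, erule conjunct1, erule conjunct2)
    qed
  qed
  moreover have "B_norm D m K = A1_norm (lebesgue_on D) a"
    unfolding B_norm_def a_def M_def ..
  ultimately show ?thesis by (simp add: A1_norm_def)
qed

subsection \<open>The mixed kernel on the frequency side\<close>

context warping
begin

lemma \<Psi>_borel: "\<Psi> \<in> borel_measurable borel" and w_borel: "w \<in> borel_measurable borel"
  by (intro borel_measurable_continuous_onI \<Psi>_cont w_cont)+

lemma D_borel: "D \<in> sets borel"
  using open_D by auto

lemma warp_measure: "density lborel (indicator D) = distr (density lborel (\<lambda>\<tau>. ennreal (w \<tau>))) borel \<Psi>"
  using distr_diffeo[OF \<Psi>_deriv inj_\<Psi> A_cont] D_borel w_pos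
  by (simp add: range_\<Psi> warp_weight_def[symmetric] abs_of_pos)

lemma nn_integral_warp:
  assumes h: "h \<in> borel_measurable borel"
  shows "(\<integral>\<^sup>+\<xi>. h \<xi> * indicator D \<xi> \<partial>lborel) = (\<integral>\<^sup>+\<tau>. h (\<Psi> \<tau>) * ennreal (w \<tau>) \<partial>lborel)"
proof -
  have hP: "(\<lambda>\<tau>. h (\<Psi> \<tau>)) \<in> borel_measurable borel"
    using measurable_compose[OF \<Psi>_borel h] .
  have "(\<integral>\<^sup>+\<xi>. h \<xi> * indicator D \<xi> \<partial>lborel) = (\<integral>\<^sup>+\<xi>. h \<xi> \<partial>density lborel (indicator D))"
    using h D_borel by (subst nn_integral_density) (auto simp: mult.commute)
  also have "\<dots> = (\<integral>\<^sup>+\<tau>. h (\<Psi> \<tau>) \<partial>density lborel (\<lambda>\<tau>. ennreal (w \<tau>)))"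
    unfolding warp_measure using h \<Psi>_borel by (subst nn_integral_distr) auto
  also have "\<dots> = (\<integral>\<^sup>+\<tau>. h (\<Psi> \<tau>) * ennreal (w \<tau>) \<partial>lborel)"
    using hP w_borel by (subst nn_integral_density) (auto simp: mult.commute)
  finally show ?thesis .
qed

lemma integral_warp:
  fixes h :: "real^'n::_ \<Rightarrow> complex"
  assumes h: "h \<in> borel_measurable borel"
  shows "(LINT \<xi>|lborel. indicator D \<xi> *\<^sub>R h \<xi>) = (LINT \<tau>|lborel. w \<tau> *\<^sub>R h (\<Psi> \<tau>))"
proof -
  have hP: "(\<lambda>\<tau>. h (\<Psi> \<tau>)) \<in> borel_measurable borel"
    using measurable_compose[OF \<Psi>_borel h] .
  have "(LINT \<xi>|lborel. indicator D \<xi> *\<^sub>R h \<xi>) = (LINT \<xi>|density lborel (\<lambda>\<xi>. ennreal (indicator D \<xi>)). h \<xi>)"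
    using h D_borel by (subst integral_density) auto
  also have "(\<lambda>\<xi>. ennreal (indicator D \<xi>)) = indicator D"
    by (auto simp: indicator_def)
  also have "(LINT \<xi>|density lborel (indicator D). h \<xi>) = (LINT \<tau>|density lborel (\<lambda>\<tau>. ennreal (w \<tau>)). h (\<Psi> \<tau>))"
    unfolding warp_measure using h \<Psi>_borel by (subst integral_distr) auto
  also have "\<dots> = (LINT \<tau>|lborel. w \<tau> *\<^sub>R h (\<Psi> \<tau>))"
    using hP w_borel w_pos by (subst integral_density) (auto simp: less_imp_le)
  finally show ?thesis .
qed

lemma continuous_on_extend_borel:
  fixes f :: "real^'n::_ \<Rightarrow> 'b::{second_countable_topology,real_normed_vector}"
  assumes "continuous_on D f"
  shows "(\<lambda>\<xi>. if \<xi> \<in> D then f \<xi> else 0) \<in> borel_measurable borel"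
  using assms by (intro borel_measurable_continuous_on_if D_borel continuous_on_const)

text \<open>Substituting \<open>\<xi> = \<Psi> \<tau>\<close> introduces \<open>w \<tau>\<close>,
  which \<open>w_ratio\<close> replaces by \<open>v0 (\<tau> - \<Phi> \<omega>) ^ CARD('n)\<close>
  up to a constant; this is the weight in both integrability hypotheses.\<close>

lemma fourier_class_warped_freq:
  fixes \<theta> :: "real^'n::_ \<Rightarrow> complex"
  assumes \<theta>: "continuous_on UNIV \<theta>"
    and L1: "(\<integral>\<^sup>+t. ennreal (v0 t ^ CARD('n) * norm (\<theta> t)) \<partial>lborel) < \<infinity>"
    and L2: "(\<integral>\<^sup>+t. ennreal (v0 t ^ CARD('n) * (norm (\<theta> t))\<^sup>2) \<partial>lborel) < \<infinity>"
  shows "fourier_class D (warped_freq D \<Phi> \<theta> \<omega>)"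
proof -
  let ?\<sigma> = "\<Phi> \<omega>"
  define c where "c = w ?\<sigma> powr (- 1 / 2)"
  define f where "f = warped_freq D \<Phi> \<theta> \<omega>"
  have c0: "0 \<le> c" by (simp add: c_def)
  have f_in: "f \<xi> = of_real c * \<theta> (\<Phi> \<xi> - ?\<sigma>)" if "\<xi> \<in> D" for \<xi>
    using that by (simp add: f_def warped_freq_def c_def translate_def)
  have f_out: "f \<xi> = 0" if "\<xi> \<notin> D" for \<xi>
    using that by (simp add: f_def warped_freq_def)
  have fc: "continuous_on D f"
  proof -
    have "continuous_on D (\<lambda>\<xi>. of_real c * \<theta> (\<Phi> \<xi> - ?\<sigma>))"
      by (intro continuous_intros continuous_on_compose2[OF \<theta>] \<Phi>_cont) auto
    then show ?thesis by (rule continuous_on_eq) (simp add: f_in)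
  qed
  have "(\<lambda>\<xi>. if \<xi> \<in> D then f \<xi> else 0) = f" by (auto simp: f_out fun_eq_iff)
  then have mf: "f \<in> borel_measurable borel"
    using continuous_on_extend_borel[OF fc] by simp
  \<comment> \<open>Used for \<open>k = 1\<close> and \<open>k = 2\<close>, that is, for
    integrability and for square integrability.\<close>
  have bound: "(\<integral>\<^sup>+\<xi>. ennreal (norm (f \<xi>) ^ k) \<partial>lborel) < \<infinity>"
    if k: "k > 0" "(\<integral>\<^sup>+t. ennreal (v0 t ^ CARD('n) * norm (\<theta> t) ^ k) \<partial>lborel) < \<infinity>" for k
  proof -
    have "(\<integral>\<^sup>+\<xi>. ennreal (norm (f \<xi>) ^ k) \<partial>lborel) = (\<integral>\<^sup>+\<xi>. ennreal (norm (f \<xi>) ^ k) * indicator D \<xi> \<partial>lborel)"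
      using k(1) by (intro nn_integral_cong) (auto simp: indicator_def f_out)
    also have "\<dots> = (\<integral>\<^sup>+\<tau>. ennreal (norm (f (\<Psi> \<tau>)) ^ k) * ennreal (w \<tau>) \<partial>lborel)"
      by (rule nn_integral_warp) (use mf in measurable)
    also have "\<dots> \<le> (\<integral>\<^sup>+\<tau>. ennreal (c ^ k * fact CARD('n) * w ?\<sigma>) * ennreal (v0 (\<tau> - ?\<sigma>) ^ CARD('n) * norm (\<theta> (\<tau> - ?\<sigma>)) ^ k) \<partial>lborel)"
    proof (rule nn_integral_mono)
      fix \<tau>
      have "norm (f (\<Psi> \<tau>)) ^ k * w \<tau> = c ^ k * norm (\<theta> (\<tau> - ?\<sigma>)) ^ k * w \<tau>"
        using c0 by (simp add: f_in[OF \<Psi>_in] norm_mult power_mult_distrib)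
      also have "\<dots> \<le> c ^ k * norm (\<theta> (\<tau> - ?\<sigma>)) ^ k * (fact CARD('n) * v0 (\<tau> - ?\<sigma>) ^ CARD('n) * w ?\<sigma>)"
        using c0 by (intro mult_left_mono w_ratio) auto
      finally have "norm (f (\<Psi> \<tau>)) ^ k * w \<tau> \<le> (c ^ k * fact CARD('n) * w ?\<sigma>) * (v0 (\<tau> - ?\<sigma>) ^ CARD('n) * norm (\<theta> (\<tau> - ?\<sigma>)) ^ k)"
        by (simp add: mult_ac)
      from ennreal_leI[OF this] show "ennreal (norm (f (\<Psi> \<tau>)) ^ k) * ennreal (w \<tau>) \<le>
          ennreal (c ^ k * fact CARD('n) * w ?\<sigma>) * ennreal (v0 (\<tau> - ?\<sigma>) ^ CARD('n) * norm (\<theta> (\<tau> - ?\<sigma>)) ^ k)"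
        using c0 w_pos[of ?\<sigma>] by (simp add: ennreal_mult'[symmetric] del: ennreal_numeral)
    qed
    also have "\<dots> = ennreal (c ^ k * fact CARD('n) * w ?\<sigma>) * (\<integral>\<^sup>+\<tau>. ennreal (v0 (\<tau> - ?\<sigma>) ^ CARD('n) * norm (\<theta> (\<tau> - ?\<sigma>)) ^ k) \<partial>lborel)"
      by (intro nn_integral_cmult measurable_compose[OF _ measurable_ennreal])
        (auto intro!: borel_measurable_continuous_onI continuous_intros continuous_on_compose2[OF v0_cont] continuous_on_compose2[OF \<theta>])
    also have "(\<integral>\<^sup>+\<tau>. ennreal (v0 (\<tau> - ?\<sigma>) ^ CARD('n) * norm (\<theta> (\<tau> - ?\<sigma>)) ^ k) \<partial>lborel) = (\<integral>\<^sup>+t. ennreal (v0 t ^ CARD('n) * norm (\<theta> t) ^ k) \<partial>lborel)"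
    proof -
      have "(\<lambda>t. ennreal (v0 t ^ CARD('n) * norm (\<theta> t) ^ k)) \<in> borel_measurable borel"
        by (intro measurable_compose[OF _ measurable_ennreal] borel_measurable_continuous_onI continuous_intros v0_cont \<theta>)
      from lborel_nn_integral_translate[OF this, of "- ?\<sigma>"] show ?thesis by simp
    qed
    also have "ennreal (c ^ k * fact CARD('n) * w ?\<sigma>) * \<dots> < \<infinity>"
      using k(2) by (simp add: ennreal_mult_less_top)
    finally show ?thesis .
  qed
  have "fourier_class D f"
    unfolding fourier_class_def
  proof (intro conjI allI impI open_D fc)
    show "integrable lborel f"
      using bound[of 1] L1 mf by (simp add: integrable_iff_bounded)
    show "sq_integrable f"
      using bound[of 2] L2 mf by (simp add: integrable_iff_bounded)
  qed (rule f_out)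
  then show ?thesis by (simp add: f_def)
qed

definition warp_osc :: "(real^'n::_ \<Rightarrow> complex) \<Rightarrow> (real^'n::_ \<Rightarrow> complex) \<Rightarrow> real^'n::_ \<Rightarrow> real^'n::_ \<Rightarrow> real^'n::_ \<Rightarrow> complex" where
  "warp_osc \<theta>1 \<theta>2 \<sigma> x h = (LINT t|lborel. of_real (det (\<phi> \<sigma> t)) * (\<theta>2 (t - h) * cnj (\<theta>1 t)) * phase \<sigma> x t)"

text \<open>This form, with nothing recentred, treats all four arguments alike and is used for joint
  measurability; the recentred form below is used for estimates.\<close>

lemma mixed_kernel_eq_freq:
  fixes \<theta>1 \<theta>2 :: "real^'n::_ \<Rightarrow> complex"
  assumes \<theta>: "continuous_on UNIV \<theta>1" "continuous_on UNIV \<theta>2"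
    and f1: "\<And>\<omega>. fourier_class D (warped_freq D \<Phi> \<theta>1 \<omega>)" and f2: "\<And>\<omega>. fourier_class D (warped_freq D \<Phi> \<theta>2 \<omega>)"
  shows "mixed_kernel D \<Phi> \<theta>1 \<theta>2 ((y, \<omega>), (z, \<eta>)) =
    of_real (w (\<Phi> \<eta>) powr (- 1 / 2) * w (\<Phi> \<omega>) powr (- 1 / 2)) *
      (LINT \<tau>|lborel. of_real (w \<tau>) * (\<theta>2 (\<tau> - \<Phi> \<eta>) * cnj (\<theta>1 (\<tau> - \<Phi> \<omega>))) * cis (2 * pi * ((y - z) \<bullet> \<Psi> \<tau>)))"
proof -
  let ?c = "w (\<Phi> \<eta>) powr (- 1 / 2) * w (\<Phi> \<omega>) powr (- 1 / 2)"
  let ?f1 = "warped_freq D \<Phi> \<theta>1 \<omega>" and ?f2 = "warped_freq D \<Phi> \<theta>2 \<eta>"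
  define G where "G \<xi> = ?f2 \<xi> * cnj (?f1 \<xi>) * cis (2 * pi * ((y - z) \<bullet> \<xi>))" for \<xi>
  have G: "G \<in> borel_measurable borel"
    unfolding G_def using fourier_classD(3)[OF f1] fourier_classD(3)[OF f2] by measurable
  have GD: "indicator D \<xi> *\<^sub>R G \<xi> = G \<xi>" for \<xi>
    by (auto simp: G_def indicator_def warped_freq_def)
  have "mixed_kernel D \<Phi> \<theta>1 \<theta>2 ((y, \<omega>), (z, \<eta>)) = (LINT \<xi>|lborel. G \<xi>)"
    unfolding mixed_kernel_def warped_system_def G_def
    using L2_inner_translate_inv_fourier[OF f2 f1] by simp
  also have "\<dots> = (LINT \<tau>|lborel. w \<tau> *\<^sub>R G (\<Psi> \<tau>))"
    using integral_warp[OF G] by (simp only: GD)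
  also have "\<dots> = (LINT \<tau>|lborel. of_real ?c * (of_real (w \<tau>) * (\<theta>2 (\<tau> - \<Phi> \<eta>) * cnj (\<theta>1 (\<tau> - \<Phi> \<omega>))) * cis (2 * pi * ((y - z) \<bullet> \<Psi> \<tau>))))"
    by (intro Bochner_Integration.integral_cong refl)
      (simp add: G_def warped_freq_def \<Psi>_in translate_def scaleR_conv_of_real mult_ac)
  finally show ?thesis by (simp only: integral_mult_right_zero)
qed

text \<open>Recentring at \<open>\<sigma> = \<Phi> \<omega>\<close> factors
  \<open>w (t + \<sigma>)\<close> as \<open>det (\<phi> \<sigma> t) * w \<sigma>\<close>, so the
  remaining integral is covered by the uniform oscillatory estimates.\<close>

lemma mixed_kernel_eq_osc:
  fixes \<theta>1 \<theta>2 :: "real^'n::_ \<Rightarrow> complex"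
  assumes \<theta>: "continuous_on UNIV \<theta>1" "continuous_on UNIV \<theta>2"
    and f1: "\<And>\<omega>. fourier_class D (warped_freq D \<Phi> \<theta>1 \<omega>)" and f2: "\<And>\<omega>. fourier_class D (warped_freq D \<Phi> \<theta>2 \<omega>)"
  shows "mixed_kernel D \<Phi> \<theta>1 \<theta>2 ((y, \<omega>), (z, \<eta>)) =
    of_real (w (\<Phi> \<eta>) powr (- 1 / 2) * w (\<Phi> \<omega>) powr (- 1 / 2) * w (\<Phi> \<omega>)) *
      warp_osc \<theta>1 \<theta>2 (\<Phi> \<omega>) (transpose (A (\<Phi> \<omega>)) *v (y - z)) (\<Phi> \<eta> - \<Phi> \<omega>)"
proof -
  let ?\<sigma> = "\<Phi> \<omega>"
  define g where "g \<tau> = of_real (w \<tau>) * (\<theta>2 (\<tau> - \<Phi> \<eta>) * cnj (\<theta>1 (\<tau> - ?\<sigma>))) * cis (2 * pi * ((y - z) \<bullet> \<Psi> \<tau>))" for \<tau>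
  have "continuous_on UNIV g"
    unfolding g_def
    by (intro continuous_intros w_cont continuous_on_compose2[OF \<theta>(1)] continuous_on_compose2[OF \<theta>(2)] \<Psi>_cont) auto
  then have mg: "g \<in> borel_measurable borel" by (rule borel_measurable_continuous_onI)
  have "transpose (matrix_inv (A ?\<sigma>)) ** transpose (A ?\<sigma>) = mat 1"
    by (simp add: matrix_transpose_mul[symmetric] matrix_inv_A)
  then have ph: "phase ?\<sigma> (transpose (A ?\<sigma>) *v (y - z)) t = cis (2 * pi * ((y - z) \<bullet> \<Psi> (t + ?\<sigma>)))" for t
    by (simp only: phase_def matrix_vector_mul_assoc matrix_vector_mul_lid)
  have "(LINT \<tau>|lborel. g \<tau>) = (LINT t|lborel. g (t + ?\<sigma>))"
    by (rule lborel_integral_translate[OF mg, symmetric])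
  also have "\<dots> = (LINT t|lborel. of_real (w ?\<sigma>) * (of_real (det (\<phi> ?\<sigma> t)) * (\<theta>2 (t - (\<Phi> \<eta> - ?\<sigma>)) * cnj (\<theta>1 t))
      * phase ?\<sigma> (transpose (A ?\<sigma>) *v (y - z)) t))"
    unfolding ph by (intro Bochner_Integration.integral_cong refl) (simp add: g_def det_\<phi> algebra_simps)
  also have "\<dots> = of_real (w ?\<sigma>) * warp_osc \<theta>1 \<theta>2 ?\<sigma> (transpose (A ?\<sigma>) *v (y - z)) (\<Phi> \<eta> - ?\<sigma>)"
    unfolding warp_osc_def by (rule integral_mult_right_zero)
  finally show ?thesis
    unfolding mixed_kernel_eq_freq[OF assms] g_def by (simp add: mult.assoc)
qed

text \<open>The kernel depends on its arguments through \<open>y - z\<close>,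
  \<open>\<Phi> \<omega>\<close> and \<open>\<Phi> \<eta>\<close> only, and the integrand is jointly
  continuous in these and \<open>\<tau>\<close>.\<close>

lemma mixed_kernel_measurable:
  fixes \<theta>1 \<theta>2 :: "real^'n::_ \<Rightarrow> complex"
  assumes \<theta>: "continuous_on UNIV \<theta>1" "continuous_on UNIV \<theta>2"
    and f1: "\<And>\<omega>. fourier_class D (warped_freq D \<Phi> \<theta>1 \<omega>)" and f2: "\<And>\<omega>. fourier_class D (warped_freq D \<Phi> \<theta>2 \<omega>)"
  shows "mixed_kernel D \<Phi> \<theta>1 \<theta>2 \<in> borel_measurable (lebesgue_on ((UNIV \<times> D) \<times> (UNIV \<times> D)))"
proof -
  \<comment> \<open>Nothing is known about \<open>\<Phi>\<close> off \<open>D\<close>; the value 0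
    there makes it Borel, and only frequencies in \<open>D\<close> are compared.\<close>
  define \<Phi>0 where "\<Phi>0 \<xi> = (if \<xi> \<in> D then \<Phi> \<xi> else 0)" for \<xi>
  have m\<Phi>0: "\<Phi>0 \<in> borel_measurable borel"
    unfolding \<Phi>0_def by (rule continuous_on_extend_borel[OF \<Phi>_cont])
  define Q where "Q u \<tau> = of_real (w (snd (snd u)) powr (- 1 / 2) * w (fst (snd u)) powr (- 1 / 2)) *
      (of_real (w \<tau>) * (\<theta>2 (\<tau> - snd (snd u)) * cnj (\<theta>1 (\<tau> - fst (snd u)))) * cis (2 * pi * (fst u \<bullet> \<Psi> \<tau>)))"
    for u :: "(real^'n::_) \<times> (real^'n::_) \<times> (real^'n::_)" and \<tau> :: "real^'n::_"
  have w0: "w x \<noteq> 0" for x using w_pos[of x] by simp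
  have "continuous_on UNIV (\<lambda>p. Q (fst p) (snd p))"
    unfolding Q_def
    by (intro continuous_intros continuous_on_compose2[OF w_cont] continuous_on_compose2[OF \<theta>(1)]
        continuous_on_compose2[OF \<theta>(2)] continuous_on_compose2[OF \<Psi>_cont]) (auto simp: w0)
  from borel_measurable_continuous_onI[OF this]
  have "(\<lambda>(u, \<tau>). Q u \<tau>) \<in> borel_measurable (borel \<Otimes>\<^sub>M lborel)"
    by (simp add: case_prod_beta' borel_prod[symmetric] cong: measurable_cong_sets sets_pair_measure_cong)
  from lborel.borel_measurable_lebesgue_integral[OF this]
  have mQ: "(\<lambda>u. LINT \<tau>|lborel. Q u \<tau>) \<in> borel_measurable borel" .
  have mp: "(\<lambda>x::((real^'n::_) \<times> (real^'n::_)) \<times> ((real^'n::_) \<times> (real^'n::_)). (fst (fst x) - fst (snd x), \<Phi>0 (snd (fst x)), \<Phi>0 (snd (snd x)))) \<in> borel_measurable borel"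
    unfolding borel_prod[symmetric] using m\<Phi>0 by measurable
  have "(\<lambda>x. LINT \<tau>|lborel. Q (fst (fst x) - fst (snd x), \<Phi>0 (snd (fst x)), \<Phi>0 (snd (snd x))) \<tau>) \<in> borel_measurable borel"
    using measurable_compose[OF mp mQ] .
  then have "(\<lambda>x. LINT \<tau>|lborel. Q (fst (fst x) - fst (snd x), \<Phi>0 (snd (fst x)), \<Phi>0 (snd (snd x))) \<tau>)
      \<in> borel_measurable (lebesgue_on ((UNIV \<times> D) \<times> (UNIV \<times> D)))"
    by (intro measurable_restrict_space1) (simp add: measurable_completion)
  then show ?thesis
  proof (rule measurable_cong[THEN iffD1, rotated])
    fix x :: "((real^'n::_) \<times> (real^'n::_)) \<times> ((real^'n::_) \<times> (real^'n::_))"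
    assume "x \<in> space (lebesgue_on ((UNIV \<times> D) \<times> (UNIV \<times> D)))"
    then obtain y \<omega> z \<eta> where x: "x = ((y, \<omega>), (z, \<eta>))" "\<omega> \<in> D" "\<eta> \<in> D"
      by (cases x) (auto simp: space_restrict_space)
    show "(LINT \<tau>|lborel. Q (fst (fst x) - fst (snd x), \<Phi>0 (snd (fst x)), \<Phi>0 (snd (snd x))) \<tau>) = mixed_kernel D \<Phi> \<theta>1 \<theta>2 x"
      using mixed_kernel_eq_freq[OF assms, of y \<omega> z \<eta>] x by (simp add: Q_def \<Phi>0_def)
  qed
qed

end

subsection \<open>Weighted estimates\<close>

lemma lborel_nn_integral_reflect:
  fixes f :: "'a::euclidean_space \<Rightarrow> ennreal"
  assumes f: "f \<in> borel_measurable borel"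
  shows "(\<integral>\<^sup>+x. f (t - x) \<partial>lborel) = (\<integral>\<^sup>+x. f x \<partial>lborel)"
  using f by (subst (2) lborel_affine[of "-1" t]) (simp_all add: nn_integral_density nn_integral_distr)

lemma nn_integral_lborel_linear:
  fixes M :: "real^'n::{finite,wellorder}^'n::_" and g :: "real^'n::_ \<Rightarrow> ennreal"
  assumes g: "g \<in> borel_measurable borel" and M: "0 < det M"
  shows "(\<integral>\<^sup>+x. g (M *v x) \<partial>lborel) * ennreal (det M) = (\<integral>\<^sup>+x. g x \<partial>lborel)"
proof -
  have inv: "invertible M" using M by (simp add: invertible_det_nz)
  have inj: "inj ((*v) M)" using inv by (simp add: inj_matrix_vector_mult)
  have ran: "range ((*v) M) = UNIV"
    using inv invertible_left_inverse matrix_left_invertible_injective[of M] matrix_right_invertible_surjective[of M] invertible_right_inverse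
    by blast
  have der: "((*v) M has_derivative (\<lambda>h. M *v h)) (at x)" for x
    by (rule bounded_linear.has_derivative[OF matrix_vector_mul_bounded_linear has_derivative_ident])
  have "density lborel (indicator UNIV) = distr (density lborel (\<lambda>x. ennreal \<bar>det M\<bar>)) borel ((*v) M)"
    using distr_diffeo[OF der inj continuous_on_const] by (simp add: ran)
  moreover have "(indicator UNIV :: real^'n::_ \<Rightarrow> ennreal) = (\<lambda>_. 1)" by auto
  ultimately have lb: "lborel = distr (density lborel (\<lambda>x. ennreal (det M))) borel ((*v) M)"
    using M by (simp add: density_1)
  have mM: "(*v) M \<in> borel_measurable borel"
    by (intro borel_measurable_continuous_onI linear_continuous_on matrix_vector_mul_bounded_linear)
  have "(\<integral>\<^sup>+x. g x \<partial>lborel) = (\<integral>\<^sup>+x. g x \<partial>distr (density lborel (\<lambda>x. ennreal (det M))) borel ((*v) M))"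
    using lb by simp
  also have "\<dots> = (\<integral>\<^sup>+x. g (M *v x) \<partial>density lborel (\<lambda>x. ennreal (det M)))"
    using g mM by (subst nn_integral_distr) auto
  also have "\<dots> = (\<integral>\<^sup>+x. ennreal (det M) * g (M *v x) \<partial>lborel)"
    using measurable_compose[OF mM g] by (subst nn_integral_density) auto
  also have "\<dots> = ennreal (det M) * (\<integral>\<^sup>+x. g (M *v x) \<partial>lborel)"
    using measurable_compose[OF mM g] by (intro nn_integral_cmult) auto
  finally show ?thesis by (simp add: mult.commute)
qed

text \<open>Dyadic shells: \<open>2 ^ n \<le> 1 + norm x < 2 ^ (n + 1)\<close> lies in a ball of volume \<open>O(2 ^ (n DIM('a)))\<close>.\<close>
lemma nn_integral_tail_finite:
  "(\<integral>\<^sup>+x. ennreal (inverse ((1 + norm (x::'a::euclidean_space)) ^ (DIM('a) + 1))) \<partial>lborel) < \<infinity>"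
proof -
  let ?d = "DIM('a)"
  define f where "f n x = ennreal (inverse ((2 ^ n) ^ (?d + 1))) * indicator (ball (0::'a) (2 ^ Suc n)) x" for n :: nat and x
  have "(\<integral>\<^sup>+x. ennreal (inverse ((1 + norm (x::'a)) ^ (?d + 1))) \<partial>lborel) \<le> (\<integral>\<^sup>+x. (\<Sum>n. f n x) \<partial>lborel)"
  proof (rule nn_integral_mono)
    fix x :: 'a
    define n where "n = (LEAST n. 1 + norm x < 2 ^ Suc n)"
    obtain k where "1 + norm x < 2 ^ k" using real_arch_pow[of 2 "1 + norm x"] by auto
    then have "1 + norm x < 2 ^ Suc k" by (rule order_less_le_trans) simp
    then have n1: "1 + norm x < 2 ^ Suc n" unfolding n_def by (rule LeastI)
    have n2: "2 ^ n \<le> 1 + norm x"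
    proof (cases n)
      case (Suc l)
      then have "\<not> 1 + norm x < 2 ^ Suc l" using not_less_Least[of l "\<lambda>n. 1 + norm x < 2 ^ Suc n"] by (simp add: n_def)
      then show ?thesis using Suc by simp
    qed simp
    have "inverse ((1 + norm x) ^ (?d + 1)) \<le> inverse ((2 ^ n) ^ (?d + 1))"
      using n2 by (intro le_imp_inverse_le power_mono) auto
    moreover have "x \<in> ball 0 (2 ^ Suc n)" using n1 by simp
    ultimately have "ennreal (inverse ((1 + norm x) ^ (?d + 1))) \<le> f n x"
      by (simp add: f_def ennreal_leI del: power_Suc)
    also have "\<dots> \<le> (\<Sum>n. f n x)"
      using sum_le_suminf[of "\<lambda>n. f n x" "{n}"] by (simp add: summableI)
    finally show "ennreal (inverse ((1 + norm x) ^ (?d + 1))) \<le> (\<Sum>n. f n x)" .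
  qed
  also have "\<dots> = (\<Sum>n. \<integral>\<^sup>+x. f n x \<partial>lborel)"
    unfolding f_def by (intro nn_integral_suminf borel_measurable_times_ennreal borel_measurable_const borel_measurable_indicator) auto
  also have "\<dots> = (\<Sum>n. ennreal (unit_ball_vol ?d * 2 ^ ?d * (1 / 2) ^ n))"
  proof (rule suminf_cong)
    fix n
    have "(\<integral>\<^sup>+x. f n x \<partial>lborel) = ennreal (inverse ((2 ^ n) ^ (?d + 1))) * emeasure lborel (ball (0::'a) (2 ^ Suc n))"
      unfolding f_def by (subst nn_integral_cmult_indicator) auto
    also have "\<dots> = ennreal (inverse ((2 ^ n) ^ (?d + 1)) * (unit_ball_vol ?d * (2 ^ Suc n) ^ ?d))"
      by (subst emeasure_ball) (auto simp: ennreal_mult')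
    \<comment> \<open>The decay exponent exceeds the dimension by 1, which leaves a geometric
      series.\<close>
    also have "inverse ((2 ^ n) ^ (?d + 1)) * (unit_ball_vol ?d * (2 ^ Suc n) ^ ?d) = unit_ball_vol ?d * 2 ^ ?d * (1 / 2) ^ n"
      by (simp add: power_mult_distrib power_add field_simps power_one_over)
    finally show "(\<integral>\<^sup>+x. f n x \<partial>lborel) = ennreal (unit_ball_vol ?d * 2 ^ ?d * (1 / 2) ^ n)" .
  qed
  also have "\<dots> < \<infinity>"
    by (subst suminf_ennreal2) (auto intro!: summable_mult summable_geometric mult_nonneg_nonneg simp: less_imp_le)
  finally show ?thesis .
qed

lemma ennreal_power2_le_imp_le:
  fixes a b :: ennreal
  assumes "a\<^sup>2 \<le> b\<^sup>2" shows "a \<le> b"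
proof (rule ccontr)
  assume "\<not> a \<le> b"
  then have ba: "b < a" by simp
  then obtain r where r: "b = ennreal r" "0 \<le> r" by (cases b rule: ennreal_cases) auto
  show False
  proof (cases a rule: ennreal_cases)
    case (real q)
    then have "r < q" using ba r by (simp add: ennreal_less_iff)
    moreover have "q \<le> r" using assms r real by (simp add: ennreal_power ennreal_le_iff)
    ultimately show False by simp
  next
    case top
    then show False using assms r by (simp add: ennreal_power top_unique)
  qed
qed

text \<open>Cauchy--Schwarz, where the square of \<open>(1 + norm t) ^ -(d + 1)\<close> is bounded
  by the function itself, so the integral from the dyadic shells can be reused.\<close>

lemma weighted_L1_le_L2w:
  fixes f :: "real^'n::finite \<Rightarrow> complex" and u :: "real^'n \<Rightarrow> real"
  assumes u: "u \<in> borel_measurable borel" "\<And>t. 0 \<le> u t" and f: "f \<in> borel_measurable borel"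
  shows "(\<integral>\<^sup>+t. ennreal (u t * norm (f t)) \<partial>lborel)
    \<le> max 1 (\<integral>\<^sup>+x. ennreal (inverse ((1 + norm (x::real^'n)) ^ (CARD('n) + 1))) \<partial>lborel) * L2w_norm (\<lambda>t. (1 + norm t) ^ (CARD('n) + 1) * u t) f"
proof -
  let ?d = "CARD('n) + 1"
  let ?w = "\<lambda>t. (1 + norm t) ^ ?d * u t"
  define \<kappa> where "\<kappa> = (\<integral>\<^sup>+x. ennreal (inverse ((1 + norm (x::real^'n)) ^ ?d)) \<partial>lborel)"
  have n1: "0 < 1 + norm t" for t :: "real^'n" by (rule add_pos_nonneg) auto
  note [measurable] = u(1) f
  have "(\<integral>\<^sup>+t. ennreal (u t * norm (f t)) \<partial>lborel)
      = (\<integral>\<^sup>+t. ennreal (inverse ((1 + norm t) ^ ?d)) * ennreal (norm (?w t *\<^sub>R f t)) \<partial>lborel)"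
  proof (intro nn_integral_cong)
    fix t
    have "u t * norm (f t) = inverse ((1 + norm t) ^ ?d) * norm (?w t *\<^sub>R f t)"
    proof -
      define P where "P = (1 + norm t) ^ ?d"
      have "P > 0" unfolding P_def by (intro zero_less_power n1)
      then show ?thesis unfolding P_def[symmetric] using u(2)[of t] by (simp add: abs_mult)
    qed
    then show "ennreal (u t * norm (f t)) = ennreal (inverse ((1 + norm t) ^ ?d)) * ennreal (norm (?w t *\<^sub>R f t))"
      using n1[of t] by (simp add: ennreal_mult' del: norm_scaleR)
  qed
  also have "(\<dots>)\<^sup>2 \<le> (\<integral>\<^sup>+t. (ennreal (inverse ((1 + norm (t::real^'n)) ^ ?d)))\<^sup>2 \<partial>lborel) * (\<integral>\<^sup>+t. (ennreal (norm (?w t *\<^sub>R f t)))\<^sup>2 \<partial>lborel)"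
    by (rule Cauchy_Schwarz_nn_integral) measurable
  also have "(\<integral>\<^sup>+t. (ennreal (norm (?w t *\<^sub>R f t)))\<^sup>2 \<partial>lborel) = (L2w_norm ?w f)\<^sup>2"
    unfolding L2w_norm_sq by (rule nn_integral_completion[symmetric])
  also have "(\<integral>\<^sup>+t. (ennreal (inverse ((1 + norm (t::real^'n)) ^ ?d)))\<^sup>2 \<partial>lborel) \<le> \<kappa>"
    unfolding \<kappa>_def
  proof (rule nn_integral_mono)
    fix t :: "real^'n"
    have "inverse ((1 + norm t) ^ ?d) \<le> 1"
      using n1[of t] by (simp add: inverse_le_1_iff one_le_power del: power_Suc)
    then have "(inverse ((1 + norm t) ^ ?d))\<^sup>2 \<le> inverse ((1 + norm t) ^ ?d)"
      unfolding power2_eq_square using n1[of t] by (intro mult_left_le_one_le) auto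
    then show "(ennreal (inverse ((1 + norm t) ^ ?d)))\<^sup>2 \<le> ennreal (inverse ((1 + norm t) ^ ?d))"
      using n1[of t] by (subst ennreal_power) (auto intro!: ennreal_leI less_imp_le simp del: power_Suc)
  qed
  \<comment> \<open>The maximum with 1 replaces a square root of \<open>\<kappa>\<close> in the
    extended reals.\<close>
  also have "\<kappa> \<le> (max 1 \<kappa>)\<^sup>2"
  proof -
    have "\<kappa> \<le> max 1 \<kappa> * 1" by simp
    also have "\<dots> \<le> max 1 \<kappa> * max 1 \<kappa>" by (intro mult_left_mono) auto
    finally show ?thesis by (simp add: power2_eq_square)
  qed
  finally have "(\<integral>\<^sup>+t. ennreal (u t * norm (f t)) \<partial>lborel)\<^sup>2 \<le> (max 1 \<kappa> * L2w_norm ?w f)\<^sup>2"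
    by (simp add: power_mult_distrib mult_right_mono)
  then show ?thesis unfolding \<kappa>_def by (rule ennreal_power2_le_imp_le)
qed

text \<open>\<open>R_warp\<close> controls the Jacobian of \<open>\<Phi>\<close>, whereas the
  rescaling of displacements involves its transpose. The bound follows from
  \<open>norm z ^ 2 = y \<bullet> (B *v z)\<close> for \<open>z = transpose B *v y\<close>.\<close>

lemma matrix_opnorm_transpose: "norm (transpose B *v y) \<le> matrix_opnorm (B :: real^'n::finite^'n) * norm y"
proof (cases "transpose B *v y = 0")
  case True
  then show ?thesis
    using matrix_opnorm_vector[of B y] by (simp add: matrix_opnorm_def onorm_pos_le mult_nonneg_nonneg)
next
  case False
  let ?z = "transpose B *v y"
  have "norm ?z * norm ?z = ?z \<bullet> ?z" by (simp only: power2_norm_eq_inner[symmetric] power2_eq_square)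
  also have "\<dots> = y \<bullet> (B *v ?z)" by (simp add: dot_lmul_matrix)
  also have "\<dots> \<le> norm y * norm (B *v ?z)" by (rule norm_cauchy_schwarz)
  also have "\<dots> \<le> norm y * (matrix_opnorm B * norm ?z)" by (intro mult_left_mono matrix_opnorm_vector) auto
  finally have "norm ?z * norm ?z \<le> (matrix_opnorm B * norm y) * norm ?z" by (simp add: mult_ac)
  then show ?thesis using False by (subst (asm) mult_le_cancel_right_pos) auto
qed

context warping
begin

lemma jacobian_\<Phi>_inverse: "jacobian \<Phi> (at (\<Psi> \<sigma>)) = matrix_inv (A \<sigma>)"
proof -
  let ?J = "jacobian \<Phi> (at (\<Psi> \<sigma>))"
  have "(\<Phi> has_derivative (\<lambda>h. ?J *v h)) (at (\<Psi> \<sigma>))"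
    using \<Phi>_differentiable[OF \<Psi>_in] by (simp add: jacobian_works)
  from has_derivative_compose[OF \<Psi>_deriv this]
  have "((\<lambda>\<tau>. \<tau>) has_derivative (\<lambda>h. ?J *v (A \<sigma> *v h))) (at \<sigma>)" by simp
  then have "(\<lambda>h. ?J *v (A \<sigma> *v h)) = (\<lambda>h. h)"
    by (rule has_derivative_unique) (rule has_derivative_ident)
  then have JA: "?J ** A \<sigma> = mat 1"
    by (simp add: matrix_eq matrix_vector_mul_assoc[symmetric] fun_eq_iff)
  have "?J = ?J ** (A \<sigma> ** matrix_inv (A \<sigma>))" by (simp add: matrix_inv_A)
  also have "\<dots> = matrix_inv (A \<sigma>)" by (simp add: matrix_mul_assoc JA)
  finally show ?thesis .
qed

text \<open>A bounded Jacobian of \<open>\<Phi>\<close> means that rescaling by the transpose of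
  \<open>A \<sigma>\<close> cannot shrink displacements by more than a fixed factor. Choosing
  \<open>R \<ge> 1\<close> gives \<open>1 + norm x \<le> R * (1 + norm y)\<close> for the rescaled
  \<open>y\<close>.\<close>

lemma norm_le_transpose_A:
  assumes "R_warp D \<Phi> < \<infinity>"
  shows "\<exists>R\<ge>1. \<forall>\<sigma> x. norm x \<le> R * norm (transpose (A \<sigma>) *v x)"
proof -
  obtain r where r: "R_warp D \<Phi> = ennreal r" "0 \<le> r" using assms by (cases "R_warp D \<Phi>") auto
  show ?thesis
  proof (intro exI[of _ "max 1 r"] conjI allI)
    fix \<sigma> x
    have "ennreal (matrix_opnorm (jacobian \<Phi> (at (\<Psi> \<sigma>)))) \<le> R_warp D \<Phi>"
      unfolding R_warp_def by (intro SUP_upper \<Psi>_in)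
    then have le: "matrix_opnorm (matrix_inv (A \<sigma>)) \<le> r"
      using r by (simp add: jacobian_\<Phi>_inverse ennreal_le_iff)
    have "transpose (matrix_inv (A \<sigma>)) ** transpose (A \<sigma>) = mat 1"
      by (simp add: matrix_transpose_mul[symmetric] matrix_inv_A)
    then have "norm x = norm (transpose (matrix_inv (A \<sigma>)) *v (transpose (A \<sigma>) *v x))"
      by (simp only: matrix_vector_mul_assoc matrix_vector_mul_lid)
    also have "\<dots> \<le> matrix_opnorm (matrix_inv (A \<sigma>)) * norm (transpose (A \<sigma>) *v x)"
      by (rule matrix_opnorm_transpose)
    also have "\<dots> \<le> max 1 r * norm (transpose (A \<sigma>) *v x)"
      using le by (intro mult_right_mono) auto
    finally show "norm x \<le> max 1 r * norm (transpose (A \<sigma>) *v x)" .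
  qed simp
qed

text \<open>Of the decay of order \<open>N\<close>, the part \<open>p\<close> pays for the weight
  and the part \<open>CARD('n) + 1\<close> for integrability. The factor \<open>w \<sigma>\<close>
  is the determinant of the rescaling and is consumed by the substitution. For \<open>p = 0\<close>
  no comparison of \<open>x\<close> with its rescaling is used.\<close>

lemma warp_osc_moment:
  assumes N: "N = CARD('n) + p + 1"
    and R: "R \<ge> 1" "p = 0 \<or> (\<forall>\<sigma> x. norm x \<le> R * norm (transpose (A \<sigma>) *v x))"
  shows "\<exists>C>0. \<forall>\<sigma> h \<theta>1 \<theta>2. C_k_on N \<theta>1 UNIV \<longrightarrow> C_k_on N \<theta>2 UNIV \<longrightarrow>
     (\<integral>\<^sup>+x. ennreal ((1 + norm x) ^ p * norm (warp_osc \<theta>1 \<theta>2 \<sigma> (transpose (A \<sigma>) *v x) h)) \<partial>lborel) * ennreal (w \<sigma>)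
       \<le> ennreal C * (\<integral>\<^sup>+t. ennreal (v0 t ^ (CARD('n) + 3 * N) * (deriv_sum N \<theta>2 (t - h) * deriv_sum N \<theta>1 t)) \<partial>lborel)"
proof -
  obtain C0 where C0: "C0 > 0" and osc: "\<And>\<sigma> x h \<theta>1 \<theta>2. C_k_on N \<theta>1 UNIV \<Longrightarrow> C_k_on N \<theta>2 UNIV \<Longrightarrow>
     ennreal (norm (warp_osc \<theta>1 \<theta>2 \<sigma> x h) * (1 + norm x) ^ N)
       \<le> ennreal C0 * (\<integral>\<^sup>+t. ennreal (v0 t ^ (CARD('n) + 3 * N) * (deriv_sum N \<theta>2 (t - h) * deriv_sum N \<theta>1 t)) \<partial>lborel)"
    using oscillatory_uniform unfolding warp_osc_def by blast
  define g where "g x = ennreal (inverse ((1 + norm (x::real^'n::_)) ^ (CARD('n) + 1)))" for x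
  obtain k where k: "(\<integral>\<^sup>+x. g x \<partial>lborel) = ennreal k" "0 \<le> k"
    using nn_integral_tail_finite[where 'a="real^'n::_"] unfolding g_def
    by (cases "\<integral>\<^sup>+x. ennreal (inverse ((1 + norm (x::real^'n::_)) ^ (CARD('n) + 1))) \<partial>lborel") auto
  have mg: "g \<in> borel_measurable borel"
    unfolding g_def by measurable
  have n1: "1 \<le> 1 + norm (x::real^'n::_)" for x by simp
  show ?thesis
  \<comment> \<open>\<open>R ^ p\<close> is the price of rewriting the weight in the rescaled
    variable, and \<open>k\<close> the integral of \<open>g\<close>, raised by 1 to keep the
    constant positive.\<close>
  proof (intro exI[of _ "C0 * R ^ p * (k + 1)"] conjI allI impI)
    show "0 < C0 * R ^ p * (k + 1)" using C0 R k by (simp add: add_nonneg_pos)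
    fix \<sigma> h \<theta>1 \<theta>2
    assume \<theta>: "C_k_on N (\<theta>1 :: real^'n::_ \<Rightarrow> complex) UNIV" "C_k_on N (\<theta>2 :: real^'n::_ \<Rightarrow> complex) UNIV"
    define W where "W = (\<integral>\<^sup>+t. ennreal (v0 t ^ (CARD('n) + 3 * N) * (deriv_sum N \<theta>2 (t - h) * deriv_sum N \<theta>1 t)) \<partial>lborel)"
    have pw: "ennreal ((1 + norm x) ^ p * norm (warp_osc \<theta>1 \<theta>2 \<sigma> (transpose (A \<sigma>) *v x) h)) \<le>
        ennreal (C0 * R ^ p) * W * g (transpose (A \<sigma>) *v x)" for x
    proof -
      let ?y = "transpose (A \<sigma>) *v x"
      let ?o = "norm (warp_osc \<theta>1 \<theta>2 \<sigma> ?y h)"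
      have "(1 + norm x) ^ p \<le> (R * (1 + norm ?y)) ^ p"
      proof (cases "p = 0")
        case False
        then have "norm x \<le> R * norm ?y" using R by blast
        then have "1 + norm x \<le> R * (1 + norm ?y)" using R(1) by (simp add: distrib_left)
        then show ?thesis by (intro power_mono) auto
      qed simp
      also have "\<dots> = R ^ p * ((1 + norm ?y) ^ N * inverse ((1 + norm ?y) ^ (CARD('n) + 1)))"
      proof -
        have "(1 + norm ?y) ^ N = (1 + norm ?y) ^ p * (1 + norm ?y) ^ (CARD('n) + 1)"
          unfolding N power_add[symmetric] by (simp add: add_ac)
        moreover have "(1 + norm ?y) ^ (CARD('n) + 1) * inverse ((1 + norm ?y) ^ (CARD('n) + 1)) = 1"
        proof (rule right_inverse)
          have "0 < 1 + norm ?y" using n1[of ?y] by linarith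
          then show "(1 + norm ?y) ^ (CARD('n) + 1) \<noteq> 0" by (metis less_irrefl zero_less_power)
        qed
        ultimately show ?thesis by (simp only: power_mult_distrib mult.assoc mult_1_right)
      qed
      finally have "(1 + norm x) ^ p * ?o \<le> R ^ p * ((1 + norm ?y) ^ N * inverse ((1 + norm ?y) ^ (CARD('n) + 1))) * ?o"
        by (rule mult_right_mono) simp
      then have "(1 + norm x) ^ p * ?o \<le> R ^ p * inverse ((1 + norm ?y) ^ (CARD('n) + 1)) * (?o * (1 + norm ?y) ^ N)"
        by (simp only: mult_ac)
      then have "ennreal ((1 + norm x) ^ p * ?o) \<le> ennreal (R ^ p * inverse ((1 + norm ?y) ^ (CARD('n) + 1)) * (?o * (1 + norm ?y) ^ N))"
        by (rule ennreal_leI)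
      also have "\<dots> = ennreal (R ^ p) * g ?y * ennreal (?o * (1 + norm ?y) ^ N)"
        using R(1) n1[of ?y] unfolding g_def by (simp only: ennreal_mult' ennreal_mult'' zero_le_power norm_ge_zero inverse_nonnegative_iff_nonnegative mult_nonneg_nonneg order_trans[OF zero_le_one])
      also have "\<dots> \<le> ennreal (R ^ p) * g ?y * (ennreal C0 * W)"
        unfolding W_def by (intro mult_left_mono osc \<theta>) auto
      also have "\<dots> = ennreal (C0 * R ^ p) * W * g ?y"
        using C0 R(1) by (simp add: ennreal_mult' mult_ac)
      finally show ?thesis .
    qed
    have det: "0 < det (transpose (A \<sigma>))" "det (transpose (A \<sigma>)) = w \<sigma>"
      using w_pos[of \<sigma>] by (simp_all add: det_transpose warp_weight_def)
    have mgA: "(\<lambda>x. g (transpose (A \<sigma>) *v x)) \<in> borel_measurable borel"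
      by (rule borel_measurable_compose_continuous[OF mg]) (intro linear_continuous_on matrix_vector_mul_bounded_linear)
    have "(\<integral>\<^sup>+x. ennreal ((1 + norm x) ^ p * norm (warp_osc \<theta>1 \<theta>2 \<sigma> (transpose (A \<sigma>) *v x) h)) \<partial>lborel)
        \<le> (\<integral>\<^sup>+x. ennreal (C0 * R ^ p) * W * g (transpose (A \<sigma>) *v x) \<partial>lborel)"
      by (rule nn_integral_mono) (rule pw)
    also have "\<dots> = ennreal (C0 * R ^ p) * W * (\<integral>\<^sup>+x. g (transpose (A \<sigma>) *v x) \<partial>lborel)"
      using mgA by (intro nn_integral_cmult) simp
    finally have "(\<integral>\<^sup>+x. ennreal ((1 + norm x) ^ p * norm (warp_osc \<theta>1 \<theta>2 \<sigma> (transpose (A \<sigma>) *v x) h)) \<partial>lborel) * ennreal (w \<sigma>)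
        \<le> ennreal (C0 * R ^ p) * W * (\<integral>\<^sup>+x. g (transpose (A \<sigma>) *v x) \<partial>lborel) * ennreal (w \<sigma>)"
      by (rule mult_right_mono) simp
    also have "\<dots> = ennreal (C0 * R ^ p) * W * ennreal k"
      using nn_integral_lborel_linear[OF mg det(1)] unfolding det(2) k(1) by (simp only: mult.assoc)
    also have "\<dots> \<le> ennreal (C0 * R ^ p) * W * ennreal (k + 1)"
      by (intro mult_left_mono ennreal_leI) auto
    also have "\<dots> = ennreal (C0 * R ^ p * (k + 1)) * W"
      using C0 R(1) k(2) by (simp add: ennreal_mult' mult_ac)
    finally show "(\<integral>\<^sup>+x. ennreal ((1 + norm x) ^ p * norm (warp_osc \<theta>1 \<theta>2 \<sigma> (transpose (A \<sigma>) *v x) h)) \<partial>lborel) * ennreal (w \<sigma>)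
       \<le> ennreal (C0 * R ^ p * (k + 1)) * (\<integral>\<^sup>+t. ennreal (v0 t ^ (CARD('n) + 3 * N) * (deriv_sum N \<theta>2 (t - h) * deriv_sum N \<theta>1 t)) \<partial>lborel)"
      by (simp only: W_def)
  qed
qed

end

lemma L2w_norm_le_max_deriv_norm:
  assumes "n \<le> N"
  shows "L2w_norm v ((partial_deriv j ^^ n) \<theta>) \<le> max_deriv_norm N v \<theta>"
proof -
  have "L2w_norm v ((partial_deriv j ^^ n) \<theta>) \<le> (MAX n\<in>{0..N}. L2w_norm v ((partial_deriv j ^^ n) \<theta>))"
    using assms by (intro Max_ge) auto
  also have "\<dots> \<le> max_deriv_norm N v \<theta>"
    unfolding max_deriv_norm_def by (intro Max_ge) auto
  finally show ?thesis .
qed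

lemma max_deriv_norm_finite:
  assumes "\<And>j n. n \<le> N \<Longrightarrow> (partial_deriv j ^^ n) \<theta> \<in> L2w v"
  shows "max_deriv_norm N v \<theta> < \<infinity>"
  unfolding max_deriv_norm_def using assms by (subst Max_less_iff; auto simp: L2w_def)+

section \<open>The weights of the theorem and the Schur test\<close>

locale weighted_warping = warping N D \<Phi> v0
  for N :: nat and D :: "(real^'n::{finite,wellorder}) set"
    and \<Phi> :: "real^'n::_ \<Rightarrow> real^'n::_" and v0 :: "real^'n::_ \<Rightarrow> real" +
  fixes p :: nat and v1 :: "real^'n::_ \<Rightarrow> real"
  assumes N_eq: "N = CARD('n) + p + 1"
    and v1_pos: "0 < v1 \<upsilon>" and v1_cont: "continuous_on UNIV v1"
    and v1_add: "v1 (\<sigma> + \<tau>) \<le> v1 \<sigma> * v1 \<tau>" and v1_minus: "v1 (- \<upsilon>) = v1 \<upsilon>"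
    and p_cases: "R_warp D \<Phi> = \<infinity> \<Longrightarrow> p = 0"
begin

text \<open>The weight \<open>w2_weight\<close> without its polynomial factor, which is reserved for
  Cauchy--Schwarz.\<close>

definition u :: "real^'n::_ \<Rightarrow> real" where
  "u t = v1 t * v0 t powr (9 * real CARD('n) / 2 + 3 * real p + 3)"

text \<open>The majorant left by the oscillatory estimate. The power of \<open>v0\<close> sits on
  \<open>t\<close> alone because the phase is centred at the first prototype.\<close>

definition conv :: "(real^'n::_ \<Rightarrow> complex) \<Rightarrow> (real^'n::_ \<Rightarrow> complex) \<Rightarrow> real^'n::_ \<Rightarrow> ennreal" where
  "conv \<theta>1 \<theta>2 h = (\<integral>\<^sup>+t. ennreal (v0 t ^ (CARD('n) + 3 * N) * (deriv_sum N \<theta>2 (t - h) * deriv_sum N \<theta>1 t)) \<partial>lborel)"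

text \<open>\<open>v1\<close> need not be radial, so evenness is used instead:
  \<open>1 \<le> v1 0 \<le> v1 \<upsilon> * v1 (- \<upsilon>)\<close>, which is the square of
  \<open>v1 \<upsilon>\<close>.\<close>

lemma v1_ge1: "1 \<le> v1 \<upsilon>"
proof -
  have 0: "1 \<le> v1 0"
    using v1_add[of 0 0] v1_pos[of 0] by simp
  also have "v1 0 \<le> v1 \<upsilon> * v1 \<upsilon>"
    using v1_add[of \<upsilon> "- \<upsilon>"] by (simp add: v1_minus)
  finally have "1\<^sup>2 \<le> (v1 \<upsilon>)\<^sup>2" by (simp add: power2_eq_square)
  then show ?thesis by (rule power2_le_imp_le) (rule less_imp_le[OF v1_pos])
qed

lemma u_pos: "0 < u t"
  using v1_pos[of t] v0_pos[of t] by (simp add: u_def)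

lemma u_cont: "continuous_on UNIV u"
proof -
  have "v0 t \<noteq> 0" for t using v0_pos[of t] by simp
  then show ?thesis unfolding u_def by (intro continuous_intros v1_cont v0_cont) auto
qed

lemma w2_weight_eq: "w2_weight p v0 v1 = (\<lambda>t. (1 + norm t) ^ (CARD('n) + 1) * u t)"
  by (simp add: w2_weight_def u_def fun_eq_iff mult.assoc)

lemma v0_power_le_u: "v0 t ^ CARD('n) \<le> u t"
proof -
  have "v0 t ^ CARD('n) = v0 t powr real CARD('n)" using v0_pos[of t] by (simp add: powr_realpow)
  also have "\<dots> \<le> v0 t powr (9 * real CARD('n) / 2 + 3 * real p + 3)"
    using v0_ge1[of t] by (intro powr_mono) auto
  also have "\<dots> \<le> u t"
    using v1_ge1[of t] unfolding u_def by (simp add: mult_le_cancel_right1)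
  finally show ?thesis .
qed

text \<open>Write \<open>h = t - (t - h)\<close> and use submultiplicativity and evenness. On
  \<open>t\<close> the exponent becomes exactly that of \<open>u\<close>; on \<open>t - h\<close> it
  is only \<open>CARD('n) / 2\<close> and is enlarged, so that both prototypes carry the same
  weight.\<close>

lemma weight_conv_le:
  "v0 h powr (real CARD('n) / 2) * v1 h * v0 t ^ (CARD('n) + 3 * N) \<le> u t * u (t - h)"
proof -
  let ?a = "real CARD('n) / 2" and ?b = "9 * real CARD('n) / 2 + 3 * real p + 3"
  have "v0 h \<le> v0 t * v0 (t - h)"
    using v0_add[of t "- (t - h)"] v0_minus[of "t - h"] by simp
  then have 1: "v0 h powr ?a \<le> v0 t powr ?a * v0 (t - h) powr ?a"
    using v0_pos by (simp add: powr_mult[symmetric] powr_mono2 less_imp_le)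
  have 2: "v1 h \<le> v1 t * v1 (t - h)"
    using v1_add[of t "- (t - h)"] v1_minus[of "t - h"] by simp
  have "v0 h powr ?a * v1 h \<le> (v0 t powr ?a * v0 (t - h) powr ?a) * (v1 t * v1 (t - h))"
    using 1 2 v1_pos by (intro mult_mono) (auto intro: less_imp_le)
  then have "v0 h powr ?a * v1 h * v0 t ^ (CARD('n) + 3 * N)
      \<le> (v0 t powr ?a * v0 (t - h) powr ?a) * (v1 t * v1 (t - h)) * v0 t powr real (CARD('n) + 3 * N)"
    unfolding powr_realpow[OF v0_pos] using v0_pos[of t] by (intro mult_right_mono zero_le_power) auto
  also have "\<dots> = (v1 t * (v0 t powr ?a * v0 t powr real (CARD('n) + 3 * N))) * (v1 (t - h) * v0 (t - h) powr ?a)"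
    by (simp only: mult_ac)
  also have "v0 t powr ?a * v0 t powr real (CARD('n) + 3 * N) = v0 t powr ?b"
    unfolding powr_add[symmetric] by (rule arg_cong[where f = "\<lambda>e. v0 t powr e"]) (simp add: N_eq field_simps)
  also have "(v1 t * v0 t powr ?b) * (v1 (t - h) * v0 (t - h) powr ?a) \<le> (v1 t * v0 t powr ?b) * (v1 (t - h) * v0 (t - h) powr ?b)"
    using v0_ge1[of "t - h"] by (intro mult_left_mono powr_mono) (auto intro!: mult_nonneg_nonneg less_imp_le[OF v1_pos])
  finally show ?thesis by (simp add: u_def)
qed

lemma conv_measurable:
  assumes "C_k_on N \<theta>1 UNIV" "C_k_on N \<theta>2 UNIV"
  shows "conv \<theta>1 \<theta>2 \<in> borel_measurable borel"
proof -
  have "continuous_on UNIV (\<lambda>q. v0 (snd q) ^ (CARD('n) + 3 * N) * (deriv_sum N \<theta>2 (snd q - fst q) * deriv_sum N \<theta>1 (snd q)))"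
    by (intro continuous_intros continuous_on_compose2[OF v0_cont] continuous_on_compose2[OF deriv_sum_cont[OF assms(1)]]
        continuous_on_compose2[OF deriv_sum_cont[OF assms(2)]]) auto
  from borel_measurable_nn_integral_lborel[OF measurable_compose[OF borel_measurable_continuous_onI[OF this] measurable_ennreal]]
  show ?thesis by (simp add: conv_def[abs_def])
qed

text \<open>Once the weight has been distributed, the integrand is dominated by a product of
  functions of \<open>t\<close> and of \<open>t - h\<close>, and Tonelli with a reflection separates
  them.\<close>

lemma nn_integral_conv_le:
  assumes \<theta>: "C_k_on N \<theta>1 UNIV" "C_k_on N \<theta>2 UNIV"
  shows "(\<integral>\<^sup>+h. ennreal (v0 h powr (real CARD('n) / 2) * v1 h) * conv \<theta>1 \<theta>2 h \<partial>lborel)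
    \<le> (\<integral>\<^sup>+t. ennreal (u t * deriv_sum N \<theta>1 t) \<partial>lborel) * (\<integral>\<^sup>+t. ennreal (u t * deriv_sum N \<theta>2 t) \<partial>lborel)"
proof -
  define f1 where "f1 t = ennreal (u t * deriv_sum N \<theta>1 t)" for t
  define f2 where "f2 t = ennreal (u t * deriv_sum N \<theta>2 t)" for t
  have m: "f1 \<in> borel_measurable borel" "f2 \<in> borel_measurable borel"
    unfolding f1_def f2_def
    by (intro measurable_compose[OF _ measurable_ennreal] borel_measurable_continuous_onI continuous_intros u_cont deriv_sum_cont \<theta>)+
  have mc: "(\<lambda>t. ennreal (v0 t ^ (CARD('n) + 3 * N) * (deriv_sum N \<theta>2 (t - h) * deriv_sum N \<theta>1 t))) \<in> borel_measurable lborel" for h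
    using measurable_compose[OF borel_measurable_continuous_onI measurable_ennreal,
        of "\<lambda>t. v0 t ^ (CARD('n) + 3 * N) * (deriv_sum N \<theta>2 (t - h) * deriv_sum N \<theta>1 t)"]
    by (simp add: continuous_intros v0_cont continuous_on_compose2[OF deriv_sum_cont[OF \<theta>(2)]] deriv_sum_cont[OF \<theta>(1)])
  have "(\<integral>\<^sup>+h. ennreal (v0 h powr (real CARD('n) / 2) * v1 h) * conv \<theta>1 \<theta>2 h \<partial>lborel) \<le> (\<integral>\<^sup>+h. \<integral>\<^sup>+t. f1 t * f2 (t - h) \<partial>lborel \<partial>lborel)"
  proof (rule nn_integral_mono)
    fix h
    have "ennreal (v0 h powr (real CARD('n) / 2) * v1 h) * conv \<theta>1 \<theta>2 h
        = (\<integral>\<^sup>+t. ennreal (v0 h powr (real CARD('n) / 2) * v1 h) * ennreal (v0 t ^ (CARD('n) + 3 * N) * (deriv_sum N \<theta>2 (t - h) * deriv_sum N \<theta>1 t)) \<partial>lborel)"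
      unfolding conv_def by (rule nn_integral_cmult[OF mc, symmetric])
    also have "\<dots> \<le> (\<integral>\<^sup>+t. f1 t * f2 (t - h) \<partial>lborel)"
    proof (rule nn_integral_mono)
      fix t
      have "v0 h powr (real CARD('n) / 2) * v1 h * v0 t ^ (CARD('n) + 3 * N) * (deriv_sum N \<theta>2 (t - h) * deriv_sum N \<theta>1 t)
          \<le> u t * u (t - h) * (deriv_sum N \<theta>2 (t - h) * deriv_sum N \<theta>1 t)"
        by (intro mult_right_mono weight_conv_le mult_nonneg_nonneg deriv_sum_nonneg)
      from ennreal_leI[OF this]
      show "ennreal (v0 h powr (real CARD('n) / 2) * v1 h) * ennreal (v0 t ^ (CARD('n) + 3 * N) * (deriv_sum N \<theta>2 (t - h) * deriv_sum N \<theta>1 t)) \<le> f1 t * f2 (t - h)"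
        unfolding f1_def f2_def
        using v1_pos[of h] v0_pos[of t] u_pos[of t] u_pos[of "t - h"] deriv_sum_nonneg[of N \<theta>1 t] deriv_sum_nonneg[of N \<theta>2 "t - h"]
        by (simp add: ennreal_mult'[symmetric] ennreal_mult''[symmetric] mult_ac)
    qed
    finally show "ennreal (v0 h powr (real CARD('n) / 2) * v1 h) * conv \<theta>1 \<theta>2 h \<le> (\<integral>\<^sup>+t. f1 t * f2 (t - h) \<partial>lborel)" .
  qed
  also have "\<dots> = (\<integral>\<^sup>+t. \<integral>\<^sup>+h. f1 t * f2 (t - h) \<partial>lborel \<partial>lborel)"
  proof -
    have 1: "(\<lambda>q::(real^'n::_) \<times> (real^'n::_). f1 (snd q)) \<in> borel_measurable borel"
      by (rule borel_measurable_compose_continuous[OF m(1)]) (intro continuous_intros)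
    have 2: "(\<lambda>q::(real^'n::_) \<times> (real^'n::_). f2 (snd q - fst q)) \<in> borel_measurable borel"
      by (rule borel_measurable_compose_continuous[OF m(2)]) (intro continuous_intros)
    from nn_integral_lborel_swap[OF borel_measurable_times_ennreal[OF 1 2]] show ?thesis by simp
  qed
  also have "\<dots> = (\<integral>\<^sup>+t. f1 t * (\<integral>\<^sup>+h. f2 h \<partial>lborel) \<partial>lborel)"
  proof (rule nn_integral_cong)
    fix t
    have "(\<lambda>h. f2 (t - h)) \<in> borel_measurable borel"
      by (rule borel_measurable_compose_continuous[OF m(2)]) (intro continuous_intros)
    then have "(\<integral>\<^sup>+h. f1 t * f2 (t - h) \<partial>lborel) = f1 t * (\<integral>\<^sup>+h. f2 (t - h) \<partial>lborel)"
      by (intro nn_integral_cmult) simp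
    then show "(\<integral>\<^sup>+h. f1 t * f2 (t - h) \<partial>lborel) = f1 t * (\<integral>\<^sup>+h. f2 h \<partial>lborel)"
      by (simp only: lborel_nn_integral_reflect[OF m(2)])
  qed
  also have "\<dots> = (\<integral>\<^sup>+t. f1 t \<partial>lborel) * (\<integral>\<^sup>+t. f2 t \<partial>lborel)"
    by (rule nn_integral_multc) (use m in simp)
  finally show ?thesis by (simp only: f1_def f2_def)
qed

lemma nn_integral_deriv_sum_le:
  "\<exists>C>0. \<forall>\<theta>. C_k_on N \<theta> UNIV \<longrightarrow>
     (\<integral>\<^sup>+t. ennreal (u t * deriv_sum N \<theta> t) \<partial>lborel) \<le> ennreal C * max_deriv_norm N (w2_weight p v0 v1) \<theta>"
proof -
  define k where "k = max 1 (\<integral>\<^sup>+x. ennreal (inverse ((1 + norm (x::real^'n::_)) ^ (CARD('n) + 1))) \<partial>lborel)"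
  have "k < \<infinity>"
    using nn_integral_tail_finite[where 'a="real^'n::_"] by (simp add: k_def)
  then obtain r where r: "k = ennreal r" "0 \<le> r" by (cases k) auto
  have "ennreal 1 \<le> ennreal r" unfolding r(1)[symmetric] k_def by simp
  then have "1 \<le> r" using r(2) by (simp only: ennreal_le_iff)
  \<comment> \<open>\<open>deriv_sum\<close> has \<open>CARD('n) * (N + 1)\<close> terms, each
    costing the factor \<open>r\<close> from Cauchy--Schwarz.\<close>
  define C where "C = real CARD('n) * (real N + 1) * r"
  show ?thesis
  proof (intro exI[of _ C] conjI allI impI)
    show "0 < C" using \<open>1 \<le> r\<close> by (simp add: C_def)
    fix \<theta> :: "real^'n::_ \<Rightarrow> complex"
    assume \<theta>: "C_k_on N \<theta> UNIV"
    let ?M = "max_deriv_norm N (w2_weight p v0 v1) \<theta>"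
    have mu: "u \<in> borel_measurable borel" by (rule borel_measurable_continuous_onI[OF u_cont])
    have md: "(partial_deriv j ^^ n) \<theta> \<in> borel_measurable borel" if "n \<le> N" for j n
      by (rule borel_measurable_continuous_onI[OF C_k_on_continuous_iterate[OF \<theta> that]])
    have mt: "(\<lambda>t. ennreal (u t * norm ((partial_deriv j ^^ n) \<theta> t))) \<in> borel_measurable lborel" if "n \<le> N" for j n
      using mu md[OF that, of j] by measurable
    have "(\<integral>\<^sup>+t. ennreal (u t * deriv_sum N \<theta> t) \<partial>lborel)
        = (\<integral>\<^sup>+t. (\<Sum>j\<in>UNIV. \<Sum>n\<le>N. ennreal (u t * norm ((partial_deriv j ^^ n) \<theta> t))) \<partial>lborel)"
    proof (rule nn_integral_cong)
      fix t
      have nn: "0 \<le> u t * norm ((partial_deriv j ^^ n) \<theta> t)" for j n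
        by (intro mult_nonneg_nonneg less_imp_le[OF u_pos] norm_ge_zero)
      have "(\<Sum>j\<in>UNIV. \<Sum>n\<le>N. ennreal (u t * norm ((partial_deriv j ^^ n) \<theta> t)))
          = (\<Sum>j\<in>UNIV. ennreal (\<Sum>n\<le>N. u t * norm ((partial_deriv j ^^ n) \<theta> t)))"
        by (intro sum.cong refl sum_ennreal nn)
      also have "\<dots> = ennreal (\<Sum>j\<in>UNIV. \<Sum>n\<le>N. u t * norm ((partial_deriv j ^^ n) \<theta> t))"
        by (intro sum_ennreal sum_nonneg nn)
      finally show "ennreal (u t * deriv_sum N \<theta> t) = (\<Sum>j\<in>UNIV. \<Sum>n\<le>N. ennreal (u t * norm ((partial_deriv j ^^ n) \<theta> t)))"
        by (simp only: deriv_sum_def sum_distrib_left)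
    qed
    also have "\<dots> = (\<Sum>j\<in>UNIV. \<integral>\<^sup>+t. (\<Sum>n\<le>N. ennreal (u t * norm ((partial_deriv j ^^ n) \<theta> t))) \<partial>lborel)"
      by (intro nn_integral_sum borel_measurable_sum mt) auto
    also have "\<dots> = (\<Sum>j\<in>UNIV. \<Sum>n\<le>N. \<integral>\<^sup>+t. ennreal (u t * norm ((partial_deriv j ^^ n) \<theta> t)) \<partial>lborel)"
      by (intro sum.cong refl nn_integral_sum mt) auto
    also have "\<dots> \<le> (\<Sum>j\<in>(UNIV::'n set). \<Sum>n\<le>N. k * ?M)"
    proof (intro sum_mono)
      fix j n assume "n \<in> {..N}"
      then have n: "n \<le> N" by simp
      have "(\<integral>\<^sup>+t. ennreal (u t * norm ((partial_deriv j ^^ n) \<theta> t)) \<partial>lborel) \<le> k * L2w_norm (w2_weight p v0 v1) ((partial_deriv j ^^ n) \<theta>)"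
        unfolding k_def w2_weight_eq by (rule weighted_L1_le_L2w[OF mu less_imp_le[OF u_pos] md[OF n]])
      also have "\<dots> \<le> k * ?M" by (intro mult_left_mono L2w_norm_le_max_deriv_norm n) simp
      finally show "(\<integral>\<^sup>+t. ennreal (u t * norm ((partial_deriv j ^^ n) \<theta> t)) \<partial>lborel) \<le> k * ?M" .
    qed
    also have "\<dots> = ennreal (real CARD('n)) * (ennreal (real (N + 1)) * (k * ?M))"
      by (simp add: ennreal_of_nat_eq_real_of_nat)
    also have "\<dots> = ennreal C * ?M"
      unfolding C_def r(1) using r(2) by (simp add: ennreal_mult' ennreal_mult'' mult.assoc add.commute)
    finally show "(\<integral>\<^sup>+t. ennreal (u t * deriv_sum N \<theta> t) \<partial>lborel) \<le> ennreal C * ?M" .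
  qed
qed

text \<open>The left side is the square root of \<open>w \<rho> / w \<sigma>\<close>: the
  normalisations of both systems times the Jacobian of integration over one frequency. This is where
  the exponent \<open>CARD('n) / 2\<close> arises; the root of the factorial is rounded up.\<close>

lemma w_sqrt_ratio:
  "w \<rho> powr (- 1 / 2) * w \<sigma> powr (- 1 / 2) * w \<rho> \<le> fact CARD('n) * v0 (\<rho> - \<sigma>) powr (real CARD('n) / 2)"
proof -
  have pos: "0 < w \<rho>" "0 < w \<sigma>" by (rule w_pos)+
  have r: "w \<rho> / w \<sigma> \<le> fact CARD('n) * v0 (\<rho> - \<sigma>) ^ CARD('n)"
    using w_ratio[of \<rho> \<sigma>] pos by (simp add: divide_le_eq)
  have "w \<rho> powr (- 1 / 2) * w \<sigma> powr (- 1 / 2) * w \<rho> = w \<rho> powr (1 / 2) * w \<sigma> powr (- (1 / 2))"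
  proof -
    have "w \<rho> powr (- 1 / 2) * w \<rho> powr 1 = w \<rho> powr (1 / 2)"
      unfolding powr_add[symmetric] by simp
    then show ?thesis using pos by (simp add: mult_ac)
  qed
  also have "\<dots> = (w \<rho> / w \<sigma>) powr (1 / 2)"
    using pos by (simp add: powr_divide powr_minus_divide)
  also have "\<dots> \<le> (fact CARD('n) * v0 (\<rho> - \<sigma>) ^ CARD('n)) powr (1 / 2)"
    using r pos by (intro powr_mono2) auto
  also have "\<dots> = fact CARD('n) powr (1 / 2) * v0 (\<rho> - \<sigma>) powr (real CARD('n) / 2)"
    using v0_pos[of "\<rho> - \<sigma>"] by (simp add: powr_mult powr_realpow[symmetric] powr_powr)
  also have "\<dots> \<le> fact CARD('n) powr 1 * v0 (\<rho> - \<sigma>) powr (real CARD('n) / 2)"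
    by (intro mult_right_mono powr_mono) auto
  finally show ?thesis by simp
qed

lemma warp_osc_measurable:
  fixes M :: "real^'n::_^'n::_"
  assumes \<theta>: "continuous_on UNIV \<theta>1" "continuous_on UNIV \<theta>2"
  shows "(\<lambda>x. warp_osc \<theta>1 \<theta>2 \<sigma> (M *v x) h) \<in> borel_measurable borel"
proof -
  have Mc: "continuous_on UNIV (\<lambda>q::(real^'n::_) \<times> (real^'n::_). transpose (matrix_inv (A \<sigma>)) *v (M *v fst q))"
    by (rule linear_continuous_on[OF bounded_linear_compose[OF matrix_vector_mul_bounded_linear
          bounded_linear_compose[OF matrix_vector_mul_bounded_linear bounded_linear_fst]]])
  have "continuous_on UNIV (\<lambda>q. complex_of_real (det (\<phi> \<sigma> (snd q))) * (\<theta>2 (snd q - h) * cnj (\<theta>1 (snd q))) * phase \<sigma> (M *v fst q) (snd q))"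
    unfolding phase_def det_def
    by (intro continuous_intros Mc continuous_on_compose2[OF \<phi>_cont] continuous_on_compose2[OF \<theta>(1)]
        continuous_on_compose2[OF \<theta>(2)] continuous_on_compose2[OF \<Psi>_cont]) auto
  from borel_measurable_continuous_onI[OF this]
  have "(\<lambda>(x, t). complex_of_real (det (\<phi> \<sigma> t)) * (\<theta>2 (t - h) * cnj (\<theta>1 t)) * phase \<sigma> (M *v x) t) \<in> borel_measurable (borel \<Otimes>\<^sub>M lborel)"
    by (simp add: case_prod_beta' borel_prod[symmetric] cong: measurable_cong_sets sets_pair_measure_cong)
  from lborel.borel_measurable_lebesgue_integral[OF this] show ?thesis
    by (simp add: warp_osc_def)
qed

text \<open>The quantifier order matters: one constant is fixed before the weight and the
  prototypes, which enter the bound only through the two integrals.\<close>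

lemma B_norm_mixed_kernel_le:
  "\<exists>C>0. \<forall>m \<theta>1 \<theta>2. symmetric_weight D m \<longrightarrow>
     (\<forall>y z. \<forall>\<xi>\<in>D. \<forall>\<eta>\<in>D. m ((y, \<xi>), (z, \<eta>)) \<le> (1 + norm (y - z)) ^ p * v1 (\<Phi> \<xi> - \<Phi> \<eta>)) \<longrightarrow>
     C_k_on N \<theta>1 UNIV \<longrightarrow> C_k_on N \<theta>2 UNIV \<longrightarrow>
     (\<forall>\<omega>. fourier_class D (warped_freq D \<Phi> \<theta>1 \<omega>)) \<longrightarrow> (\<forall>\<omega>. fourier_class D (warped_freq D \<Phi> \<theta>2 \<omega>)) \<longrightarrow>
     B_norm D m (mixed_kernel D \<Phi> \<theta>1 \<theta>2) \<le> ennreal C * ((\<integral>\<^sup>+t. ennreal (u t * deriv_sum N \<theta>1 t) \<partial>lborel) * (\<integral>\<^sup>+t. ennreal (u t * deriv_sum N \<theta>2 t) \<partial>lborel))"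
proof -
  have "\<exists>R\<ge>1. p = 0 \<or> (\<forall>\<sigma> x. norm x \<le> R * norm (transpose (A \<sigma>) *v x))"
  proof (cases "R_warp D \<Phi> = \<infinity>")
    case True
    then show ?thesis using p_cases by (intro exI[of _ 1]) auto
  next
    case False
    then show ?thesis using norm_le_transpose_A by (auto simp: top.not_eq_extremum)
  qed
  then obtain R where R: "R \<ge> 1" "p = 0 \<or> (\<forall>\<sigma> x. norm x \<le> R * norm (transpose (A \<sigma>) *v x))" by blast
  obtain C where C: "C > 0" and mom: "\<And>\<sigma> h \<theta>1 \<theta>2. C_k_on N \<theta>1 UNIV \<Longrightarrow> C_k_on N \<theta>2 UNIV \<Longrightarrow>
     (\<integral>\<^sup>+x. ennreal ((1 + norm x) ^ p * norm (warp_osc \<theta>1 \<theta>2 \<sigma> (transpose (A \<sigma>) *v x) h)) \<partial>lborel) * ennreal (w \<sigma>)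
       \<le> ennreal C * conv \<theta>1 \<theta>2 h"
    using warp_osc_moment[OF N_eq R] unfolding conv_def by blast
  define C' where "C' = C * fact CARD('n)"
  have C'0: "C' > 0" using C by (simp add: C'_def)
  show ?thesis
  proof (intro exI[of _ C'] conjI C'0 allI impI)
    fix m \<theta>1 \<theta>2
    assume sym: "symmetric_weight D m"
      and mle: "\<forall>y z. \<forall>\<xi>\<in>D. \<forall>\<eta>\<in>D. m ((y, \<xi>), (z, \<eta>)) \<le> (1 + norm (y - z)) ^ p * v1 (\<Phi> \<xi> - \<Phi> \<eta>)"
      and \<theta>: "C_k_on N \<theta>1 UNIV" "C_k_on N \<theta>2 UNIV"
      and fc: "\<forall>\<omega>. fourier_class D (warped_freq D \<Phi> \<theta>1 \<omega>)" "\<forall>\<omega>. fourier_class D (warped_freq D \<Phi> \<theta>2 \<omega>)"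
    note \<theta>c = C_k_on_continuous[OF \<theta>(1)] C_k_on_continuous[OF \<theta>(2)]
    note mK = mixed_kernel_measurable[OF \<theta>c spec[OF fc(1)] spec[OF fc(2)]]
    have mm: "m \<in> borel_measurable (lebesgue_on ((UNIV \<times> D) \<times> (UNIV \<times> D)))"
      and m0: "\<And>y \<omega> z \<eta>. \<omega> \<in> D \<Longrightarrow> \<eta> \<in> D \<Longrightarrow> 0 < m ((y, \<omega>), (z, \<eta>))"
      using sym by (auto simp: symmetric_weight_def Let_def)
    define c where "c \<sigma> \<rho> = w \<rho> powr (- 1 / 2) * w \<sigma> powr (- 1 / 2)" for \<sigma> \<rho>
    have c0: "0 \<le> c \<sigma> \<rho>" for \<sigma> \<rho> by (simp add: c_def)
    \<comment> \<open>Majorant of both time marginals. They share it because the pointwise bound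
      depends on \<open>y\<close> and \<open>z\<close> through \<open>y - z\<close> only.\<close>
    define L where "L \<sigma> \<rho> = ennreal (C * c \<sigma> \<rho> * v1 (\<rho> - \<sigma>)) * conv \<theta>1 \<theta>2 (\<rho> - \<sigma>)" for \<sigma> \<rho>
    define F where "F \<sigma> h x = ennreal ((1 + norm x) ^ p * norm (warp_osc \<theta>1 \<theta>2 \<sigma> (transpose (A \<sigma>) *v x) h))" for \<sigma> h x
    have mF: "F \<sigma> h \<in> borel_measurable borel" for \<sigma> h
      unfolding F_def using warp_osc_measurable[OF \<theta>c, of \<sigma> "transpose (A \<sigma>)" h] by measurable
    have pw: "ennreal (norm (m ((y, \<omega>), (z, \<eta>)) *\<^sub>R mixed_kernel D \<Phi> \<theta>1 \<theta>2 ((y, \<omega>), (z, \<eta>))))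
        \<le> ennreal (c (\<Phi> \<omega>) (\<Phi> \<eta>) * v1 (\<Phi> \<eta> - \<Phi> \<omega>) * w (\<Phi> \<omega>)) * F (\<Phi> \<omega>) (\<Phi> \<eta> - \<Phi> \<omega>) (y - z)"
      if "\<omega> \<in> D" "\<eta> \<in> D" for y \<omega> z \<eta>
    proof -
      let ?\<sigma> = "\<Phi> \<omega>" and ?\<rho> = "\<Phi> \<eta>"
      let ?o = "norm (warp_osc \<theta>1 \<theta>2 ?\<sigma> (transpose (A ?\<sigma>) *v (y - z)) (?\<rho> - ?\<sigma>))"
      have K: "norm (mixed_kernel D \<Phi> \<theta>1 \<theta>2 ((y, \<omega>), (z, \<eta>))) = c ?\<sigma> ?\<rho> * w ?\<sigma> * ?o"
        unfolding mixed_kernel_eq_osc[OF \<theta>c spec[OF fc(1)] spec[OF fc(2)]] norm_mult norm_of_real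
        using w_pos[of ?\<sigma>] by (simp add: c_def abs_mult)
      have "m ((y, \<omega>), (z, \<eta>)) \<le> (1 + norm (y - z)) ^ p * v1 (?\<rho> - ?\<sigma>)"
        using mle that v1_minus[of "?\<rho> - ?\<sigma>"] by (metis minus_diff_eq)
      then have "norm (m ((y, \<omega>), (z, \<eta>)) *\<^sub>R mixed_kernel D \<Phi> \<theta>1 \<theta>2 ((y, \<omega>), (z, \<eta>)))
          \<le> ((1 + norm (y - z)) ^ p * v1 (?\<rho> - ?\<sigma>)) * (c ?\<sigma> ?\<rho> * w ?\<sigma> * ?o)"
        unfolding norm_scaleR K using m0[OF that, of y z] c0 w_pos[of ?\<sigma>] by (intro mult_right_mono) auto
      also have "\<dots> = (c ?\<sigma> ?\<rho> * v1 (?\<rho> - ?\<sigma>) * w ?\<sigma>) * ((1 + norm (y - z)) ^ p * ?o)"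
        by (simp only: mult_ac)
      finally show ?thesis
        unfolding F_def using c0 v1_pos[of "?\<rho> - ?\<sigma>"] w_pos[of ?\<sigma>]
        by (subst ennreal_mult'[symmetric]) (auto intro!: ennreal_leI mult_nonneg_nonneg less_imp_le)
    qed
    \<comment> \<open>The factor \<open>w \<sigma>\<close> of the recentred kernel is exactly the
      one in the moment bound.\<close>
    have FL: "ennreal (c \<sigma> \<rho> * v1 (\<rho> - \<sigma>) * w \<sigma>) * (\<integral>\<^sup>+x. F \<sigma> (\<rho> - \<sigma>) x \<partial>lborel) \<le> L \<sigma> \<rho>" for \<sigma> \<rho>
    proof -
      have "ennreal (c \<sigma> \<rho> * v1 (\<rho> - \<sigma>) * w \<sigma>) = ennreal (c \<sigma> \<rho> * v1 (\<rho> - \<sigma>)) * ennreal (w \<sigma>)"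
        using w_pos[of \<sigma>] by (intro ennreal_mult'') simp
      then have "ennreal (c \<sigma> \<rho> * v1 (\<rho> - \<sigma>) * w \<sigma>) * (\<integral>\<^sup>+x. F \<sigma> (\<rho> - \<sigma>) x \<partial>lborel)
          = ennreal (c \<sigma> \<rho> * v1 (\<rho> - \<sigma>)) * ((\<integral>\<^sup>+x. F \<sigma> (\<rho> - \<sigma>) x \<partial>lborel) * ennreal (w \<sigma>))"
        by (simp add: mult_ac)
      also have "\<dots> \<le> ennreal (c \<sigma> \<rho> * v1 (\<rho> - \<sigma>)) * (ennreal C * conv \<theta>1 \<theta>2 (\<rho> - \<sigma>))"
        unfolding F_def by (intro mult_left_mono mom \<theta>) simp
      also have "\<dots> = L \<sigma> \<rho>"
        using C by (simp add: L_def ennreal_mult' mult_ac)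
      finally show ?thesis .
    qed
    have Ly: "(\<integral>\<^sup>+z. ennreal (norm (m ((y, \<omega>), (z, \<eta>)) *\<^sub>R mixed_kernel D \<Phi> \<theta>1 \<theta>2 ((y, \<omega>), (z, \<eta>)))) \<partial>lebesgue) \<le> L (\<Phi> \<omega>) (\<Phi> \<eta>)"
      if "\<omega> \<in> D" "\<eta> \<in> D" for \<omega> \<eta> y
    proof -
      let ?k = "ennreal (c (\<Phi> \<omega>) (\<Phi> \<eta>) * v1 (\<Phi> \<eta> - \<Phi> \<omega>) * w (\<Phi> \<omega>))" and ?F = "F (\<Phi> \<omega>) (\<Phi> \<eta> - \<Phi> \<omega>)"
      have "(\<integral>\<^sup>+z. ennreal (norm (m ((y, \<omega>), (z, \<eta>)) *\<^sub>R mixed_kernel D \<Phi> \<theta>1 \<theta>2 ((y, \<omega>), (z, \<eta>)))) \<partial>lebesgue) \<le> (\<integral>\<^sup>+z. ?k * ?F (y - z) \<partial>lborel)"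
        unfolding nn_integral_completion by (intro nn_integral_mono pw that)
      also have "\<dots> = ?k * (\<integral>\<^sup>+z. ?F (y - z) \<partial>lborel)"
      proof (rule nn_integral_cmult)
        have "(\<lambda>z. ?F (y - z)) \<in> borel_measurable borel"
          by (rule borel_measurable_compose_continuous[OF mF]) (intro continuous_intros)
        then show "(\<lambda>z. ?F (y - z)) \<in> borel_measurable lborel" by simp
      qed
      also have "\<dots> \<le> L (\<Phi> \<omega>) (\<Phi> \<eta>)"
        unfolding lborel_nn_integral_reflect[OF mF] by (rule FL)
      finally show ?thesis .
    qed
    have Lz: "(\<integral>\<^sup>+y. ennreal (norm (m ((y, \<omega>), (z, \<eta>)) *\<^sub>R mixed_kernel D \<Phi> \<theta>1 \<theta>2 ((y, \<omega>), (z, \<eta>)))) \<partial>lebesgue) \<le> L (\<Phi> \<omega>) (\<Phi> \<eta>)"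
      if "\<omega> \<in> D" "\<eta> \<in> D" for \<omega> \<eta> z
    proof -
      let ?k = "ennreal (c (\<Phi> \<omega>) (\<Phi> \<eta>) * v1 (\<Phi> \<eta> - \<Phi> \<omega>) * w (\<Phi> \<omega>))" and ?F = "F (\<Phi> \<omega>) (\<Phi> \<eta> - \<Phi> \<omega>)"
      have "(\<integral>\<^sup>+y. ennreal (norm (m ((y, \<omega>), (z, \<eta>)) *\<^sub>R mixed_kernel D \<Phi> \<theta>1 \<theta>2 ((y, \<omega>), (z, \<eta>)))) \<partial>lebesgue) \<le> (\<integral>\<^sup>+y. ?k * ?F (y - z) \<partial>lborel)"
        unfolding nn_integral_completion by (intro nn_integral_mono pw that)
      also have "\<dots> = ?k * (\<integral>\<^sup>+y. ?F (y - z) \<partial>lborel)"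
      proof (rule nn_integral_cmult)
        have "(\<lambda>y. ?F (y - z)) \<in> borel_measurable borel"
          by (rule borel_measurable_compose_continuous[OF mF]) (intro continuous_intros)
        then show "(\<lambda>y. ?F (y - z)) \<in> borel_measurable lborel" by simp
      qed
      also have "(\<integral>\<^sup>+y. ?F (y - z) \<partial>lborel) = (\<integral>\<^sup>+x. ?F x \<partial>lborel)"
        using lborel_nn_integral_translate[OF mF, of _ _ "- z"] by simp
      also have "?k * \<dots> \<le> L (\<Phi> \<omega>) (\<Phi> \<eta>)" by (rule FL)
      finally show ?thesis .
    qed
    define G where "G h = ennreal (v0 h powr (real CARD('n) / 2) * v1 h) * conv \<theta>1 \<theta>2 h" for h
    have v0n: "v0 t \<noteq> 0" for t using v0_pos[of t] by simp
    have mG: "G \<in> borel_measurable borel"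
      unfolding G_def
      by (intro borel_measurable_times_ennreal conv_measurable \<theta> measurable_compose[OF _ measurable_ennreal]
          borel_measurable_continuous_onI continuous_intros v0_cont v1_cont) (auto simp: v0n)
    have mL: "(\<lambda>(\<sigma>, \<rho>). L \<sigma> \<rho>) \<in> borel_measurable borel"
    proof -
      have w0: "w x \<noteq> 0" for x using w_pos[of x] by simp
      have "continuous_on UNIV (\<lambda>q. C * c (fst q) (snd q) * v1 (snd q - fst q))"
        unfolding c_def
        by (intro continuous_intros continuous_on_compose2[OF w_cont] continuous_on_compose2[OF v1_cont]) (auto simp: w0)
      then have 1: "(\<lambda>q. ennreal (C * c (fst q) (snd q) * v1 (snd q - fst q))) \<in> borel_measurable borel"
        by (intro measurable_compose[OF _ measurable_ennreal] borel_measurable_continuous_onI)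
      have 2: "(\<lambda>q. conv \<theta>1 \<theta>2 (snd q - fst q)) \<in> borel_measurable borel"
        by (rule borel_measurable_compose_continuous[OF conv_measurable[OF \<theta>]]) (intro continuous_intros)
      from borel_measurable_times_ennreal[OF 1 2] show ?thesis by (simp add: L_def case_prod_beta')
    qed
    have mLs: "(\<lambda>\<rho>. L \<sigma> \<rho>) \<in> borel_measurable borel" "(\<lambda>\<sigma>. L \<sigma> \<rho>) \<in> borel_measurable borel" for \<sigma> \<rho>
      using borel_measurable_compose_continuous[OF mL, of "\<lambda>\<rho>. (\<sigma>, \<rho>)"]
        borel_measurable_compose_continuous[OF mL, of "\<lambda>\<sigma>. (\<sigma>, \<rho>)"] by (simp_all add: continuous_intros)
    \<comment> \<open>One substitution for both frequency marginals: \<open>l\<close> is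
      \<open>L\<close> with one argument fixed, and \<open>G'\<close> is a translate or a reflected
      translate of \<open>G\<close>, with the same integral.\<close>
    have schur: "(\<integral>\<^sup>+\<xi>. l (\<Phi> \<xi>) * indicator D \<xi> \<partial>lebesgue) \<le> ennreal C' * (\<integral>\<^sup>+h. G h \<partial>lborel)"
      if l: "l \<in> borel_measurable borel" and le: "\<And>\<tau>. l \<tau> * ennreal (w \<tau>) \<le> ennreal C' * G' \<tau>"
        and G': "(\<integral>\<^sup>+\<tau>. G' \<tau> \<partial>lborel) = (\<integral>\<^sup>+h. G h \<partial>lborel)" "G' \<in> borel_measurable borel" for l G'
    proof -
      define \<Phi>0 where "\<Phi>0 \<xi> = (if \<xi> \<in> D then \<Phi> \<xi> else 0)" for \<xi>
      have m\<Phi>0: "\<Phi>0 \<in> borel_measurable borel"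
        unfolding \<Phi>0_def by (rule continuous_on_extend_borel[OF \<Phi>_cont])
      have "(\<integral>\<^sup>+\<xi>. l (\<Phi> \<xi>) * indicator D \<xi> \<partial>lebesgue) = (\<integral>\<^sup>+\<xi>. l (\<Phi>0 \<xi>) * indicator D \<xi> \<partial>lborel)"
        unfolding nn_integral_completion by (intro nn_integral_cong) (auto simp: \<Phi>0_def indicator_def)
      also have "\<dots> = (\<integral>\<^sup>+\<tau>. l (\<Phi>0 (\<Psi> \<tau>)) * ennreal (w \<tau>) \<partial>lborel)"
        by (rule nn_integral_warp) (rule measurable_compose[OF m\<Phi>0 l])
      also have "\<dots> = (\<integral>\<^sup>+\<tau>. l \<tau> * ennreal (w \<tau>) \<partial>lborel)"
        by (simp add: \<Phi>0_def \<Psi>_in)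
      also have "\<dots> \<le> (\<integral>\<^sup>+\<tau>. ennreal C' * G' \<tau> \<partial>lborel)"
        by (intro nn_integral_mono le)
      also have "\<dots> = ennreal C' * (\<integral>\<^sup>+\<tau>. G' \<tau> \<partial>lborel)"
        using G'(2) by (intro nn_integral_cmult) simp
      finally show ?thesis by (simp only: G'(1))
    qed
    \<comment> \<open>\<open>\<tau>\<close> is the frequency being integrated, \<open>\<rho>\<close>
      in one marginal and \<open>\<sigma>\<close> in the other; \<open>w_sqrt_ratio\<close> provides
      the premise in both cases because \<open>v0\<close> is even.\<close>
    have Lw: "L \<sigma> \<rho> * ennreal (w \<tau>) \<le> ennreal C' * G (\<rho> - \<sigma>)"
      if "c \<sigma> \<rho> * w \<tau> \<le> fact CARD('n) * v0 (\<rho> - \<sigma>) powr (real CARD('n) / 2)" for \<sigma> \<rho> \<tau>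
    proof -
      have "L \<sigma> \<rho> * ennreal (w \<tau>) = ennreal (C * v1 (\<rho> - \<sigma>) * (c \<sigma> \<rho> * w \<tau>)) * conv \<theta>1 \<theta>2 (\<rho> - \<sigma>)"
        using C c0 v1_pos[of "\<rho> - \<sigma>"] w_pos[of \<tau>] by (simp add: L_def ennreal_mult'' mult_ac less_imp_le)
      also have "\<dots> \<le> ennreal (C * v1 (\<rho> - \<sigma>) * (fact CARD('n) * v0 (\<rho> - \<sigma>) powr (real CARD('n) / 2))) * conv \<theta>1 \<theta>2 (\<rho> - \<sigma>)"
        using C v1_pos[of "\<rho> - \<sigma>"] that by (intro mult_right_mono ennreal_leI mult_left_mono) (auto simp: less_imp_le)
      also have "C * v1 (\<rho> - \<sigma>) * (fact CARD('n) * v0 (\<rho> - \<sigma>) powr (real CARD('n) / 2)) = C' * (v0 (\<rho> - \<sigma>) powr (real CARD('n) / 2) * v1 (\<rho> - \<sigma>))"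
        by (simp add: C'_def)
      also have "ennreal \<dots> = ennreal C' * ennreal (v0 (\<rho> - \<sigma>) powr (real CARD('n) / 2) * v1 (\<rho> - \<sigma>))"
        using C'0 by (intro ennreal_mult') simp
      finally show ?thesis by (simp only: G_def mult.assoc)
    qed
    have B: "B_norm D m (mixed_kernel D \<Phi> \<theta>1 \<theta>2) \<le> ennreal C' * (\<integral>\<^sup>+h. G h \<partial>lborel)"
    proof (rule B_norm_le[OF open_D mm mK Ly Lz])
      show "(\<integral>\<^sup>+\<eta>. L (\<Phi> \<omega>) (\<Phi> \<eta>) * indicator D \<eta> \<partial>lebesgue) \<le> ennreal C' * (\<integral>\<^sup>+h. G h \<partial>lborel)" for \<omega>
      proof (rule schur[where G'="\<lambda>\<rho>. G (\<rho> - \<Phi> \<omega>)"])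
        show "L (\<Phi> \<omega>) \<tau> * ennreal (w \<tau>) \<le> ennreal C' * G (\<tau> - \<Phi> \<omega>)" for \<tau>
          by (rule Lw) (use w_sqrt_ratio[of \<tau> "\<Phi> \<omega>"] in \<open>simp add: c_def\<close>)
        show "(\<integral>\<^sup>+\<tau>. G (\<tau> - \<Phi> \<omega>) \<partial>lborel) = (\<integral>\<^sup>+h. G h \<partial>lborel)"
          using lborel_nn_integral_translate[OF mG, of "- \<Phi> \<omega>"] by simp
        show "(\<lambda>\<rho>. G (\<rho> - \<Phi> \<omega>)) \<in> borel_measurable borel"
          by (rule borel_measurable_compose_continuous[OF mG]) (intro continuous_intros)
      qed (rule mLs)
      show "(\<integral>\<^sup>+\<omega>. L (\<Phi> \<omega>) (\<Phi> \<eta>) * indicator D \<omega> \<partial>lebesgue) \<le> ennreal C' * (\<integral>\<^sup>+h. G h \<partial>lborel)" for \<eta>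
      proof (rule schur[where G'="\<lambda>\<sigma>. G (\<Phi> \<eta> - \<sigma>)"])
        show "L \<tau> (\<Phi> \<eta>) * ennreal (w \<tau>) \<le> ennreal C' * G (\<Phi> \<eta> - \<tau>)" for \<tau>
          by (rule Lw) (use w_sqrt_ratio[of \<tau> "\<Phi> \<eta>"] v0_minus[of "\<Phi> \<eta> - \<tau>"] in \<open>simp add: c_def mult_ac\<close>)
        show "(\<integral>\<^sup>+\<tau>. G (\<Phi> \<eta> - \<tau>) \<partial>lborel) = (\<integral>\<^sup>+h. G h \<partial>lborel)"
          by (rule lborel_nn_integral_reflect[OF mG])
        show "(\<lambda>\<sigma>. G (\<Phi> \<eta> - \<sigma>)) \<in> borel_measurable borel"
          by (rule borel_measurable_compose_continuous[OF mG]) (intro continuous_intros)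
      qed (rule mLs)
    qed
    also have "\<dots> \<le> ennreal C' * ((\<integral>\<^sup>+t. ennreal (u t * deriv_sum N \<theta>1 t) \<partial>lborel) * (\<integral>\<^sup>+t. ennreal (u t * deriv_sum N \<theta>2 t) \<partial>lborel))"
      unfolding G_def by (intro mult_left_mono nn_integral_conv_le \<theta>) simp
    finally show "B_norm D m (mixed_kernel D \<Phi> \<theta>1 \<theta>2) \<le> ennreal C' * ((\<integral>\<^sup>+t. ennreal (u t * deriv_sum N \<theta>1 t) \<partial>lborel) * (\<integral>\<^sup>+t. ennreal (u t * deriv_sum N \<theta>2 t) \<partial>lborel))" .
  qed
qed

text \<open>The weighted conditions on the prototypes imply both hypotheses of
  \<open>fourier_class_warped_freq\<close>, as \<open>v0 ^ CARD('n)\<close> is at most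
  \<open>u\<close> and at most the square of \<open>w2_weight\<close>.\<close>

lemma fourier_class_prototype:
  assumes \<theta>: "C_k_on N \<theta> UNIV" and L2: "\<And>j n. n \<le> N \<Longrightarrow> (partial_deriv j ^^ n) \<theta> \<in> L2w (w2_weight p v0 v1)"
  shows "fourier_class D (warped_freq D \<Phi> \<theta> \<omega>)"
proof (rule fourier_class_warped_freq)
  show "continuous_on UNIV \<theta>" using \<theta> by (rule C_k_on_continuous)
  obtain C where "(\<integral>\<^sup>+t. ennreal (u t * deriv_sum N \<theta> t) \<partial>lborel) \<le> ennreal C * max_deriv_norm N (w2_weight p v0 v1) \<theta>"
    using nn_integral_deriv_sum_le \<theta> by blast
  also have "\<dots> < \<infinity>" using max_deriv_norm_finite[OF L2] by (simp add: ennreal_mult_less_top)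
  finally have fin: "(\<integral>\<^sup>+t. ennreal (u t * deriv_sum N \<theta> t) \<partial>lborel) < \<infinity>" .
  have "(\<integral>\<^sup>+t. ennreal (v0 t ^ CARD('n) * norm (\<theta> t)) \<partial>lborel) \<le> (\<integral>\<^sup>+t. ennreal (u t * deriv_sum N \<theta> t) \<partial>lborel)"
    using u_pos by (intro nn_integral_mono ennreal_leI mult_mono v0_power_le_u norm_le_deriv_sum) (auto simp: less_imp_le)
  then show "(\<integral>\<^sup>+t. ennreal (v0 t ^ CARD('n) * norm (\<theta> t)) \<partial>lborel) < \<infinity>"
    using fin by (rule le_less_trans)
  \<comment> \<open>At order 0 the direction does not matter, so an arbitrary one is taken.\<close>
  have "\<theta> \<in> L2w (w2_weight p v0 v1)" using L2[of 0 undefined] by simp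
  then have "(L2w_norm (w2_weight p v0 v1) \<theta>)\<^sup>2 < \<infinity>"
    by (simp add: L2w_def power_less_top_ennreal)
  then have "(\<integral>\<^sup>+t. (ennreal (norm (w2_weight p v0 v1 t *\<^sub>R \<theta> t)))\<^sup>2 \<partial>lborel) < \<infinity>"
    unfolding L2w_norm_sq nn_integral_completion .
  moreover have "(\<integral>\<^sup>+t. ennreal (v0 t ^ CARD('n) * (norm (\<theta> t))\<^sup>2) \<partial>lborel) \<le> (\<integral>\<^sup>+t. (ennreal (norm (w2_weight p v0 v1 t *\<^sub>R \<theta> t)))\<^sup>2 \<partial>lborel)"
  proof (rule nn_integral_mono)
    fix t
    let ?w = "w2_weight p v0 v1 t"
    have "1 * u t \<le> ?w"
      unfolding w2_weight_eq using u_pos[of t] by (intro mult_right_mono one_le_power) auto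
    then have le: "v0 t ^ CARD('n) \<le> ?w" using v0_power_le_u[of t] by simp
    have ge1: "1 \<le> v0 t ^ CARD('n)" using v0_ge1[of t] by (rule one_le_power)
    have "?w * 1 \<le> ?w * ?w" using le ge1 by (intro mult_left_mono) auto
    then have "v0 t ^ CARD('n) \<le> ?w\<^sup>2" using le by (simp add: power2_eq_square)
    then have "v0 t ^ CARD('n) * (norm (\<theta> t))\<^sup>2 \<le> (norm (?w *\<^sub>R \<theta> t))\<^sup>2"
      by (simp add: power_mult_distrib mult_right_mono)
    from ennreal_leI[OF this] show "ennreal (v0 t ^ CARD('n) * (norm (\<theta> t))\<^sup>2) \<le> (ennreal (norm (?w *\<^sub>R \<theta> t)))\<^sup>2"
      by (subst ennreal_power) auto
  qed
  ultimately show "(\<integral>\<^sup>+t. ennreal (v0 t ^ CARD('n) * (norm (\<theta> t))\<^sup>2) \<partial>lborel) < \<infinity>"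
    by (rule le_less_trans[rotated])
qed

lemma warp_compatible_weight:
  assumes "\<forall>y z. \<forall>\<xi>\<in>D. \<forall>\<eta>\<in>D. m ((y, \<xi>), (z, \<eta>)) \<le> (1 + norm (y - z)) ^ p * v1 (\<Phi> \<xi> - \<Phi> \<eta>)"
  shows "warp_compatible D \<Phi> m (\<lambda>(x, \<tau>). (1 + norm x) ^ p * v1 \<tau>)"
  unfolding warp_compatible_def
proof (intro conjI allI)
  fix z :: "(real^'n::_) \<times> (real^'n::_)"
  have "0 < 1 + norm (fst z)" by (rule add_pos_nonneg) auto
  then show "0 < (case z of (x, \<tau>) \<Rightarrow> (1 + norm x) ^ p * v1 \<tau>)"
    using v1_pos by (simp add: case_prod_beta)
next
  show "continuous_on UNIV (\<lambda>(x, \<tau>). (1 + norm x) ^ p * v1 \<tau>)"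
    unfolding case_prod_beta' by (intro continuous_intros continuous_on_compose2[OF v1_cont]) auto
next
  fix x y \<sigma> \<tau>
  show "m ((x, \<Psi> \<sigma>), y, \<Psi> \<tau>) \<le> (case (x - y, \<sigma> - \<tau>) of (x, \<tau>) \<Rightarrow> (1 + norm x) ^ p * v1 \<tau>)"
    using assms[rule_format, OF \<Psi>_in \<Psi>_in, of x \<sigma> y \<tau>] by simp
next
  show "R_warp D \<Phi> < \<infinity> \<or> (\<exists>c. \<forall>x \<sigma>. (case (x, \<sigma>) of (x, \<tau>) \<Rightarrow> (1 + norm x) ^ p * v1 \<tau>) \<le> c * (case (0, \<sigma>) of (x, \<tau>) \<Rightarrow> (1 + norm x) ^ p * v1 \<tau>))"
  proof (cases "R_warp D \<Phi> = \<infinity>")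
    case True
    \<comment> \<open>Here \<open>p = 0\<close>, so the dominating weight is constant in its first
      argument and 1 serves as the constant.\<close>
    then show ?thesis using p_cases by (intro disjI2 exI[of _ 1]) auto
  qed (simp add: top.not_eq_extremum)
qed

end

theorem theorem4p4:
  fixes D :: "(real^'n::{finite,wellorder}) set"
    and \<Phi> :: "real^'n::_ \<Rightarrow> real^'n::_"
    and v0 v1 :: "real^'n::_ \<Rightarrow> real"
    and p :: nat
  assumes "open D" and "D \<noteq> {}"
    and "admissible_warping (CARD('n) + p + 1) D \<Phi> v0"
    and "R_warp D \<Phi> = \<infinity> \<longrightarrow> p = 0"
    and "\<forall>\<upsilon>. 0 < v1 \<upsilon>" and "continuous_on UNIV v1" and "submultiplicative v1"
    and "\<forall>\<upsilon>. v1 \<upsilon> = v1 (- \<upsilon>)"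
  shows "\<exists>C::real. C > 0 \<and>
    (\<forall>(m :: ((real^'n::_) \<times> (real^'n::_)) \<times> ((real^'n::_) \<times> (real^'n::_)) \<Rightarrow> real)
      (\<theta>1 :: real^'n::_ \<Rightarrow> complex) (\<theta>2 :: real^'n::_ \<Rightarrow> complex).
      symmetric_weight D m \<longrightarrow>
      (\<forall>y z. \<forall>\<xi>\<in>D. \<forall>\<eta>\<in>D.
         m ((y, \<xi>), (z, \<eta>)) \<le> (1 + norm (y - z)) ^ p * v1 (\<Phi> \<xi> - \<Phi> \<eta>)) \<longrightarrow>
      (\<forall>\<theta>\<in>{\<theta>1, \<theta>2}.
         C_k_on (CARD('n) + p + 1) \<theta> UNIV \<and>
         (\<forall>j. \<forall>n\<in>{0..CARD('n) + p + 1}.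
            (partial_deriv j ^^ n) \<theta> \<in> L2w (w2_weight p v0 v1))) \<longrightarrow>
      (let C_max = max_deriv_norm (CARD('n) + p + 1) (w2_weight p v0 v1) \<theta>1
                 * max_deriv_norm (CARD('n) + p + 1) (w2_weight p v0 v1) \<theta>2
       in warp_compatible D \<Phi> m (\<lambda>(x, \<tau>). (1 + norm x) ^ p * v1 \<tau>) \<and>
          B_norm D m (mixed_kernel D \<Phi> \<theta>1 \<theta>2) \<le> ennreal C * C_max \<and>
          ennreal C * C_max < \<infinity>))"
proof -
  let ?N = "CARD('n) + p + 1"
  let ?w = "w2_weight p v0 v1"
  interpret weighted_warping ?N D \<Phi> v0 p v1
    by unfold_locales (use assms in \<open>auto simp: submultiplicative_def\<close>)
  obtain C where C: "C > 0" and B: "\<And>m \<theta>1 \<theta>2. symmetric_weight D m \<Longrightarrow>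
     (\<forall>y z. \<forall>\<xi>\<in>D. \<forall>\<eta>\<in>D. m ((y, \<xi>), (z, \<eta>)) \<le> (1 + norm (y - z)) ^ p * v1 (\<Phi> \<xi> - \<Phi> \<eta>)) \<Longrightarrow>
     C_k_on ?N \<theta>1 UNIV \<Longrightarrow> C_k_on ?N \<theta>2 UNIV \<Longrightarrow>
     (\<forall>\<omega>. fourier_class D (warped_freq D \<Phi> \<theta>1 \<omega>)) \<Longrightarrow> (\<forall>\<omega>. fourier_class D (warped_freq D \<Phi> \<theta>2 \<omega>)) \<Longrightarrow>
     B_norm D m (mixed_kernel D \<Phi> \<theta>1 \<theta>2) \<le> ennreal C * ((\<integral>\<^sup>+t. ennreal (u t * deriv_sum ?N \<theta>1 t) \<partial>lborel) * (\<integral>\<^sup>+t. ennreal (u t * deriv_sum ?N \<theta>2 t) \<partial>lborel))"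
    using B_norm_mixed_kernel_le by blast
  obtain C1 where C1: "C1 > 0" and P: "\<And>\<theta>. C_k_on ?N \<theta> UNIV \<Longrightarrow>
     (\<integral>\<^sup>+t. ennreal (u t * deriv_sum ?N \<theta> t) \<partial>lborel) \<le> ennreal C1 * max_deriv_norm ?N ?w \<theta>"
    using nn_integral_deriv_sum_le by blast
  show ?thesis
  \<comment> \<open>\<open>C\<close> comes from the Schur test, and one \<open>C1\<close> from
    passing to the weighted norms for each prototype.\<close>
  proof (intro exI[of _ "C * (C1 * C1)"] conjI allI impI)
    show "0 < C * (C1 * C1)" using C C1 by simp
    fix m \<theta>1 \<theta>2
    assume sym: "symmetric_weight D m"
      and mle: "\<forall>y z. \<forall>\<xi>\<in>D. \<forall>\<eta>\<in>D. m ((y, \<xi>), (z, \<eta>)) \<le> (1 + norm (y - z)) ^ p * v1 (\<Phi> \<xi> - \<Phi> \<eta>)"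
      and \<theta>: "\<forall>\<theta>\<in>{\<theta>1, \<theta>2}. C_k_on ?N \<theta> UNIV \<and> (\<forall>j. \<forall>n\<in>{0..?N}. (partial_deriv j ^^ n) \<theta> \<in> L2w ?w)"
    let ?M1 = "max_deriv_norm ?N ?w \<theta>1" and ?M2 = "max_deriv_norm ?N ?w \<theta>2"
    have \<theta>C: "C_k_on ?N \<theta>1 UNIV" "C_k_on ?N \<theta>2 UNIV" using \<theta> by auto
    have \<theta>L: "(partial_deriv j ^^ n) \<theta>1 \<in> L2w ?w" "(partial_deriv j ^^ n) \<theta>2 \<in> L2w ?w" if "n \<le> ?N" for j n
      using \<theta> that by auto
    have "B_norm D m (mixed_kernel D \<Phi> \<theta>1 \<theta>2) \<le> ennreal C * ((\<integral>\<^sup>+t. ennreal (u t * deriv_sum ?N \<theta>1 t) \<partial>lborel) * (\<integral>\<^sup>+t. ennreal (u t * deriv_sum ?N \<theta>2 t) \<partial>lborel))"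
      using fourier_class_prototype[OF \<theta>C(1) \<theta>L(1)] fourier_class_prototype[OF \<theta>C(2) \<theta>L(2)]
      by (intro B sym mle \<theta>C allI) auto
    also have "\<dots> \<le> ennreal C * ((ennreal C1 * ?M1) * (ennreal C1 * ?M2))"
      by (intro mult_left_mono mult_mono P \<theta>C) auto
    also have "\<dots> = ennreal (C * (C1 * C1)) * (?M1 * ?M2)"
      using C C1 by (simp add: ennreal_mult' mult_ac)
    finally have bound: "B_norm D m (mixed_kernel D \<Phi> \<theta>1 \<theta>2) \<le> ennreal (C * (C1 * C1)) * (?M1 * ?M2)" .
    have fin: "ennreal (C * (C1 * C1)) * (?M1 * ?M2) < \<infinity>"
      using max_deriv_norm_finite[of ?N \<theta>1 ?w, OF \<theta>L(1)] max_deriv_norm_finite[of ?N \<theta>2 ?w, OF \<theta>L(2)]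
      by (simp add: ennreal_mult_less_top)
    show "let C_max = ?M1 * ?M2
       in warp_compatible D \<Phi> m (\<lambda>(x, \<tau>). (1 + norm x) ^ p * v1 \<tau>) \<and>
          B_norm D m (mixed_kernel D \<Phi> \<theta>1 \<theta>2) \<le> ennreal (C * (C1 * C1)) * C_max \<and>
          ennreal (C * (C1 * C1)) * C_max < \<infinity>"
      unfolding Let_def using warp_compatible_weight[OF mle] bound fin by blast
  qed
qed

end
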